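(* Let $\Psi$ be the distribution function of a probability measure on $(0,1]$. Assume that $\Psi$ is continuous and that $\mathfrak F\neq\emptyset$. Then there is a unique distribution function $F^\Psi\in\mathcal D_1$ such that for any $\mathbf F\in\mathfrak F$, $$\|\mathbf F_t-F^\Psi\|_{x^{-2}}\le 2e^{-t}\qquad\forall t\ge0.$$ Also, the constant evolution $\mathbf F^*$ defined by $\mathbf F^*_t=F^\Psi$ for all $t\ge0$ belongs to $\mathfrak F$. Furthermore, $F^\Psi$ is continuously differentiable and for all $x\ge0$, $$(F^\Psi)'(x)=x\int_x^\infty\frac1z\,d\Psi(F^\Psi(z)).$$ Finally, $\|F^\Psi\|_{x^{-2}}=1$ and the Lebesgue–Stieltjes measure $x^{-1}dF^\Psi(x)$ is a probability measure with mean $1$.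
   Context: $L^1_{\mathrm{loc}}$ is the space of locally integrable functions $[0,\infty)\to\mathbb R$ with its usual topology ($L^1$ convergence on compacts). $\mathcal D\subset L^1_{\mathrm{loc}}$ is the set of nondecreasing càdlàg functions $F:[0,\infty]\to[0,1]$. For $f\in L^1_{\mathrm{loc}}$ let $\|f\|_{x^{-2}}=\int_0^\infty x^{-2}|f(x)|\,dx\in[0,\infty]$, and $\mathcal D_1=\{F\in\mathcal D:\|F\|_{x^{-2}}\le1\}$. A "distribution function" is the cumulative distribution function of a probability measure (here on $[0,\infty)$). A family $\{F_\alpha\}$ of distribution functions on $[0,\infty)$ is tight if for every $\epsilon>0$ there is $N$ with $F_\alpha(N)>1-\epsilon$ for all $\alpha$. $\mathcal X$ (resp. $\mathcal X_1$) is the set of Borel measurable maps $\mathbf F=(\mathbf F_t)_{t\ge0}$ from $[0,\infty)$ to $\mathcal D$ (resp. $\mathcal D_1$). For $\mathbf F\in\mathcal X$, $$\mathscr S^\Psi(\mathbf F)_t(x)=\mathbf F_0(e^{-t}x)+\int_0^t(e^{s-t}x)^2\Big[\int_{e^{s-t}x}^\infty\frac1z\,d\Psi(\mathbf F_s(z))\Big]ds,$$ where $\int_y^\infty$ is over $(y,\infty)$ and $d\Psi(\mathbf F_s(z))$ is the Lebesgue–Stieltjes measure of $z\mapsto\Psi(\mathbf F_s(z))$. Finally $$\mathfrak F=\{\mathbf F\in\mathcal X_1:\ \mathbf F=\mathscr S^\Psi(\mathbf F),\ \mathbf F_t(+\infty)=1\ \forall t\ge0,\ \{\mathbf F_t\}_{t\ge0}\text{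 tight}\}.$$ *)

theory Defs
  imports "HOL-Probability.Probability"
begin

text \<open>A function on \<open>[0,\<infinity>)\<close> is represented by a function of type \<^typ>\<open>real \<Rightarrow> real\<close>.
  Local integrability and the topology below only look at \<open>[0,\<infinity>)\<close>.\<close>

definition L1_loc :: "(real \<Rightarrow> real) set" where
  "L1_loc = {f. \<forall>N. set_integrable lborel {0..N} f}"

definition L1_dist :: "real \<Rightarrow> (real \<Rightarrow> real) \<Rightarrow> (real \<Rightarrow> real) \<Rightarrow> real" where
  "L1_dist N f g = (LINT x:{0..N}|lborel. \<bar>f x - g x\<bar>)"

text \<open>Functions are not identified almost everywhere, so this topology is not Hausdorff on
  \<open>L1_loc\<close>; on the set \<open>\<D>\<close> below, whose elements are right-continuous, it is.\<close>

definition L1_loc_topology :: "(real \<Rightarrow> real) topology" where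
  "L1_loc_topology = topology (\<lambda>U. U \<subseteq> L1_loc \<and>
     (\<forall>f\<in>U. \<exists>N>0. \<exists>e>0. \<forall>g\<in>L1_loc. L1_dist N f g < e \<longrightarrow> g \<in> U))"

lemma L1_dist_mono:
  assumes "f \<in> L1_loc" "g \<in> L1_loc" "M \<le> N"
  shows "L1_dist M f g \<le> L1_dist N f g"
proof -
  have "set_integrable lborel {0..N} (\<lambda>x. \<bar>f x - g x\<bar>)" for N
    using assms by (auto simp: L1_loc_def intro!: set_integrable_abs set_integral_diff)
  then show ?thesis
    unfolding L1_dist_def set_lebesgue_integral_def set_integrable_def
    using \<open>M \<le> N\<close> by (intro integral_mono) (auto simp: indicator_def)
qed

lemma openin_L1_loc_topology:
  "openin L1_loc_topology U \<longleftrightarrow> U \<subseteq> L1_loc \<and>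
     (\<forall>f\<in>U. \<exists>N>0. \<exists>e>0. \<forall>g\<in>L1_loc. L1_dist N f g < e \<longrightarrow> g \<in> U)"
proof -
  let ?P = "\<lambda>U. U \<subseteq> L1_loc \<and>
     (\<forall>f\<in>U. \<exists>N>0. \<exists>e>0. \<forall>g\<in>L1_loc. L1_dist N f g < e \<longrightarrow> g \<in> U)"
  have "istopology ?P"
    unfolding istopology_def
  proof (intro conjI allI impI)
    fix S T assume S: "?P S" and T: "?P T"
    show "S \<inter> T \<subseteq> L1_loc" using S by blast
    show "\<forall>f\<in>S \<inter> T. \<exists>N>0. \<exists>e>0. \<forall>g\<in>L1_loc. L1_dist N f g < e \<longrightarrow> g \<in> S \<inter> T"
    proof
      fix f assume f: "f \<in> S \<inter> T"
      obtain N e where 1: "N > 0" "e > 0" "\<And>g. g\<in>L1_loc \<Longrightarrow> L1_dist N f g < e \<Longrightarrow> g \<in> S"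
        using S f by blast
      obtain M d where 2: "M > 0" "d > 0" "\<And>g. g\<in>L1_loc \<Longrightarrow> L1_dist M f g < d \<Longrightarrow> g \<in> T"
        using T f by blast
      have fL: "f \<in> L1_loc" using S f by blast
      have "g \<in> S \<inter> T" if g: "g \<in> L1_loc" "L1_dist (max N M) f g < min e d" for g
        using 1(3)[OF g(1)] 2(3)[OF g(1)] g(2)
          L1_dist_mono[OF fL g(1), of N "max N M"] L1_dist_mono[OF fL g(1), of M "max N M"]
        by auto
      then show "\<exists>N>0. \<exists>e>0. \<forall>g\<in>L1_loc. L1_dist N f g < e \<longrightarrow> g \<in> S \<inter> T"
        using 1 2 by (intro exI[of _ "max N M"] conjI exI[of _ "min e d"]) auto
    qed
  next
    fix K assume K: "\<forall>S\<in>K. ?P S"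
    show "\<Union>K \<subseteq> L1_loc" using K by blast
    show "\<forall>f\<in>\<Union>K. \<exists>N>0. \<exists>e>0. \<forall>g\<in>L1_loc. L1_dist N f g < e \<longrightarrow> g \<in> \<Union>K"
      using K by (meson UnionE UnionI)
  qed
  then show ?thesis
    unfolding L1_loc_topology_def by (simp add: topology_inverse')
qed

lemma topspace_L1_loc_topology: "topspace L1_loc_topology = L1_loc"
proof -
  have "openin L1_loc_topology L1_loc"
    unfolding openin_L1_loc_topology by (auto intro: exI[of _ 1])
  then show ?thesis
    using openin_subset openin_topspace openin_L1_loc_topology by (metis subset_antisym)
qed

definition borel_of :: "'a topology \<Rightarrow> 'a measure" where
  "borel_of X = sigma (topspace X) {U. openin X U}"

definition is_cadlag :: "(real \<Rightarrow> real) \<Rightarrow> bool" where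
  "is_cadlag F \<longleftrightarrow> (\<forall>x\<ge>0. continuous (at_right x) F) \<and> (\<forall>x>0. \<exists>l. (F \<longlongrightarrow> l) (at_left x))"

text \<open>Members of \<open>\<D>\<close> are extended by 0 to the negative half-line, as is usual for distribution
  functions of measures on \<open>[0,\<infinity>)\<close>; this makes the representation unique. The value at \<open>+\<infinity>\<close>
  is not stored: it is the limit at \<open>+\<infinity>\<close>, which always exists by monotonicity.\<close>

definition cal_D :: "(real \<Rightarrow> real) set" ("\<D>") where
  "\<D> = {F. mono_on {0..} F \<and> is_cadlag F \<and> F ` {0..} \<subseteq> {0..1} \<and> (\<forall>x<0. F x = 0)}"

definition norm_x2 :: "(real \<Rightarrow> real) \<Rightarrow> ennreal" where
  "norm_x2 f = (\<integral>\<^sup>+x\<in>{0<..}. ennreal (\<bar>f x\<bar> / x\<^sup>2) \<partial>lborel)"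

definition cal_D1 :: "(real \<Rightarrow> real) set" ("\<D>\<^sub>1") where
  "\<D>\<^sub>1 = {F \<in> \<D>. norm_x2 F \<le> 1}"

definition distribution_function_on :: "real set \<Rightarrow> (real \<Rightarrow> real) \<Rightarrow> bool" where
  "distribution_function_on A F \<longleftrightarrow> (\<exists>M. real_distribution M \<and> measure M A = 1 \<and> F = cdf M)"

definition tight_family :: "'i set \<Rightarrow> ('i \<Rightarrow> real \<Rightarrow> real) \<Rightarrow> bool" where
  "tight_family I F \<longleftrightarrow> (\<forall>e>0. \<exists>N\<ge>0. \<forall>i\<in>I. F i N > 1 - e)"

definition measurable_evolutions :: "(real \<Rightarrow> real) set \<Rightarrow> (real \<Rightarrow> real \<Rightarrow> real) set" where
  "measurable_evolutions A =
     measurable (restrict_space borel {0..}) (borel_of (subtopology L1_loc_topology A))"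

abbreviation cal_X :: "(real \<Rightarrow> real \<Rightarrow> real) set" ("\<X>") where
  "\<X> \<equiv> measurable_evolutions \<D>"

abbreviation cal_X1 :: "(real \<Rightarrow> real \<Rightarrow> real) set" ("\<X>\<^sub>1") where
  "\<X>\<^sub>1 \<equiv> measurable_evolutions \<D>\<^sub>1"

text \<open>For \<open>y > 0\<close> the integrand is bounded and the measure is finite. For \<open>y = 0\<close> the integral may
  diverge, in which case the Bochner integral is 0 by convention; it then only occurs multiplied
  by \<open>0\<close>, in accordance with \<open>0 \<cdot> \<infinity> = 0\<close>.\<close>

definition stieltjes_tail :: "(real \<Rightarrow> real) \<Rightarrow> (real \<Rightarrow> real) \<Rightarrow> real \<Rightarrow> real" where
  "stieltjes_tail \<Psi> F y = (LINT z:{y<..}|interval_measure (\<lambda>z. \<Psi> (F z)). 1 / z)"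

definition S_op :: "(real \<Rightarrow> real) \<Rightarrow> (real \<Rightarrow> real \<Rightarrow> real) \<Rightarrow> real \<Rightarrow> real \<Rightarrow> real" where
  "S_op \<Psi> F t x = F 0 (exp (- t) * x) +
     (LINT s:{0..t}|lborel. (exp (s - t) * x)\<^sup>2 * stieltjes_tail \<Psi> (F s) (exp (s - t) * x))"

definition frak_F :: "(real \<Rightarrow> real) \<Rightarrow> (real \<Rightarrow> real \<Rightarrow> real) set" where
  "frak_F \<Psi> = {F \<in> \<X>\<^sub>1. (\<forall>t\<ge>0. \<forall>x\<ge>0. F t x = S_op \<Psi> F t x) \<and>
     (\<forall>t\<ge>0. (F t \<longlongrightarrow> 1) at_top) \<and> tight_family {0..} F}"

end

theory Submission
  imports Defs
begin

text \<open>
  Write \<open>G = \<Psi> \<circ> F\<close>.  Tonelli turns the Stieltjes term of the evolution into a Lebesgue integral: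
  \<open>y\<^sup>2 \<integral>\<^bsub>(y,\<infinity>)\<^esub> 1/z dG(z)\<close> equals the flux \<open>y\<^sup>2 \<integral>\<^bsub>(y,\<infinity>)\<^esub> G(z)/z\<^sup>2 dz - y G(y)\<close>.  Hence a member of
  \<open>\<FF>\<close> is a solution of a transport equation: along each characteristic \<open>t \<mapsto> e\<^sup>t w\<close> its value changes
  at the rate given by the flux (\<open>frak_F_mild_solution\<close>).  Two facts about the flux drive the proof.
  It is linear in \<open>G\<close>, with a nonlocal part that is nonnegative and a local part that damps; and
  \<open>\<integral>\<^bsub>(a,b)\<^esub> x\<^sup>-\<^sup>2 flux(x) dx\<close> consists of two boundary terms only (\<open>integral_flux\<close>).

  Contraction (\<open>mild_contraction\<close>).  Let \<open>D\<close> be the difference of two solutions and \<open>g\<close> the difference of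
  their compositions with \<open>\<Psi>\<close>.  Since \<open>\<Psi>\<close> is nondecreasing, \<open>g\<close> has the sign of \<open>D\<close>, so along a
  characteristic \<open>|D|\<close> grows at most at the rate of the flux of \<open>|g|\<close> (\<open>abs_integral_comparison\<close>).
  Integrated against \<open>x\<^sup>-\<^sup>2\<close> this leaves a boundary term at \<open>0\<close> of the good sign and one at infinity
  that vanishes by tightness and the continuity of \<open>\<Psi>\<close> at \<open>1\<close>.  So the weighted norm does not
  increase along characteristics, and undoing the dilation by \<open>e\<^sup>t\<close> produces the factor \<open>e\<^sup>-\<^sup>t\<close>.

  Limit.  Comparing a solution with its own time shifts shows that it is a Cauchy family at rate
  \<open>2 e\<^sup>-\<^sup>t\<close>; Helly's selection theorem supplies a limit \<open>L\<close> in \<open>\<D>\<^sub>1\<close> (\<open>mild_limit_exists\<close>).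

  Stationarity.  Pointwise limits in the evolution equation would only be available almost
  everywhere, so the equation is first integrated against \<open>z\<^sup>-\<^sup>2\<close> over \<open>(a,\<infinity>)\<close>.  With
  \<open>V(y) = \<integral>\<^bsub>(y,\<infinity>)\<^esub> L(z)/z\<^sup>2 dz\<close> and \<open>A(y) = y \<integral>\<^bsub>(y,\<infinity>)\<^esub> \<Psi>(L(z))/z\<^sup>2 dz\<close> the limit satisfies
  \<open>e\<^sup>t V(e\<^sup>t a) = V(a) + \<integral>\<^bsub>(0,t)\<^esub> e\<^sup>s (1 - A(e\<^sup>s a)) ds\<close> for every \<open>a > 0\<close> (\<open>limit_equation\<close>).  The right-hand
  side is differentiable in \<open>t\<close>, hence so is \<open>V\<close>; as \<open>L\<close> is monotone, \<open>L = - y\<^sup>2 V'\<close> holds at every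
  point and not just almost everywhere, that is \<open>L(y) = y (A(y) + V(y) - 1)\<close> (\<open>limit_formula\<close>).
  This makes \<open>L\<close> continuous, then continuously differentiable with \<open>L' = A - \<Psi> \<circ> L\<close>, which is
  the asserted derivative, and integrating \<open>L'\<close> along characteristics shows that \<open>L\<close> is stationary.

  Norm.  Near \<open>0\<close> both \<open>A(y)\<close> and \<open>L(y)/y\<close> tend to \<open>0\<close>, so \<open>limit_formula\<close> forces \<open>V(0+) = 1\<close>, and
  \<open>V(0+)\<close> is the norm of \<open>L\<close>.  The total mass of \<open>x\<^sup>-\<^sup>1 dL\<close> is the same integral, by Tonelli.
\<close>

section \<open>Integrals over compact intervals\<close>

lemma set_integrable_bounded_Icc:
  fixes q :: "real \<Rightarrow> real"
  assumes [measurable]: "q \<in> borel_measurable borel" and "\<And>s. a \<le> s \<Longrightarrow> s \<le> b \<Longrightarrow> \<bar>q s\<bar> \<le> K"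
  shows "set_integrable lborel {a..b} q"
  unfolding set_integrable_def
proof (rule integrableI_bounded_set_indicator[where B=K])
  show "emeasure lborel {a..b} < \<infinity>" by (simp add: emeasure_lborel_Icc_eq)
  show "AE x in lborel. x \<in> {a..b} \<longrightarrow> norm (q x) \<le> K"
    using assms(2) by auto
qed auto

lemma set_integral_Icc_split:
  fixes q :: "real \<Rightarrow> real"
  assumes "set_integrable lborel {a..c} q" "a \<le> b" "b \<le> c"
  shows "(LINT s:{a..c}|lborel. q s) = (LINT s:{a..b}|lborel. q s) + (LINT s:{b..c}|lborel. q s)"
proof -
  have i: "set_integrable lborel {a..b} q" "set_integrable lborel {b<..c} q"
    by (rule set_integrable_subset[OF assms(1)]; use assms in auto)+
  have "{a..c} = {a..b} \<union> {b<..c}" using assms by auto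
  then have "(LINT s:{a..c}|lborel. q s) = (LINT s:{a..b}|lborel. q s) + (LINT s:{b<..c}|lborel. q s)"
    by (simp add: set_integral_Un[OF _ i] disjoint_iff)
  also have "(LINT s:{b<..c}|lborel. q s) = (LINT s:{b..c}|lborel. q s)"
    unfolding set_lebesgue_integral_def
  proof (rule integral_cong_AE)
    show "(\<lambda>x. indicat_real {b<..c} x *\<^sub>R q x) \<in> borel_measurable lborel"
      using i(2) unfolding set_integrable_def by (rule borel_measurable_integrable)
    have "set_integrable lborel {b..c} q"
      by (rule set_integrable_subset[OF assms(1)]; use assms in auto)
    then show "(\<lambda>x. indicat_real {b..c} x *\<^sub>R q x) \<in> borel_measurable lborel"
      unfolding set_integrable_def by (rule borel_measurable_integrable)
    show "AE x in lborel. indicat_real {b<..c} x *\<^sub>R q x = indicat_real {b..c} x *\<^sub>R q x"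
      using AE_lborel_singleton[of b] by eventually_elim (auto simp: indicator_def)
  qed
  finally show ?thesis .
qed

lemma set_integral_Icc_abs_le:
  fixes q :: "real \<Rightarrow> real"
  assumes [measurable]: "q \<in> borel_measurable borel" and "\<And>s. a \<le> s \<Longrightarrow> s \<le> b \<Longrightarrow> \<bar>q s\<bar> \<le> K" and "a \<le> b"
  shows "\<bar>LINT s:{a..b}|lborel. q s\<bar> \<le> K * (b - a)"
proof -
  have i: "set_integrable lborel {a..b} q" by (rule set_integrable_bounded_Icc[OF assms(1,2)])
  have ic: "set_integrable lborel {a..b} (\<lambda>_. K)" by (rule set_integrable_bounded_Icc[where K="\<bar>K\<bar>"]) auto
  have "\<bar>LINT s:{a..b}|lborel. q s\<bar> \<le> (LINT s:{a..b}|lborel. \<bar>q s\<bar>)"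
    unfolding set_lebesgue_integral_def
    by (rule order_trans[OF integral_abs_bound]) (auto simp: abs_mult)
  also have "\<dots> \<le> (LINT s:{a..b}|lborel. K)"
    by (intro set_integral_mono set_integrable_abs i ic) (use assms in auto)
  also have "\<dots> = K * (b - a)" using assms(3) by (simp add: set_lebesgue_integral_def)
  finally show ?thesis .
qed

lemma set_integral_Icc_bounded_convergence:
  fixes u :: "nat \<Rightarrow> real \<Rightarrow> real"
  assumes [measurable]: "\<And>n. u n \<in> borel_measurable borel" "v \<in> borel_measurable borel"
    and b: "\<And>n s. a \<le> s \<Longrightarrow> s \<le> b \<Longrightarrow> \<bar>u n s\<bar> \<le> K"
    and lim: "\<And>s. a \<le> s \<Longrightarrow> s \<le> b \<Longrightarrow> (\<lambda>n. u n s) \<longlonglongrightarrow> v s"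
  shows "(\<lambda>n. LINT s:{a..b}|lborel. u n s) \<longlonglongrightarrow> (LINT s:{a..b}|lborel. v s)"
  unfolding set_lebesgue_integral_def
proof (rule integral_dominated_convergence)
  show "integrable lborel (\<lambda>s. indicator {a..b} s *\<^sub>R K)"
    using set_integrable_bounded_Icc[of "\<lambda>_. K" a b "\<bar>K\<bar>"] by (simp add: set_integrable_def)
  show "AE s in lborel. (\<lambda>n. indicator {a..b} s *\<^sub>R u n s) \<longlonglongrightarrow> indicator {a..b} s *\<^sub>R v s"
    using lim by (auto simp: indicator_def)
  show "AE s in lborel. norm (indicator {a..b} s *\<^sub>R u n s) \<le> indicator {a..b} s *\<^sub>R K" for n
    using b by (auto simp: indicator_def)
qed measurable

lemma has_derivative_set_integral:
  fixes g :: "real \<Rightarrow> real"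
  assumes g: "continuous_on {0..T} g" and t: "0 < t" "t < T"
  shows "((\<lambda>u. LINT s:{0..u}|lborel. g s) has_real_derivative g t) (at t)"
proof -
  have eq: "(LINT s:{0..u}|lborel. g s) = integral {0..u} g" if "u \<le> T" for u
    using that by (intro set_borel_integral_eq_integral(2) borel_integrable_atLeastAtMost' continuous_on_subset[OF g]) auto
  have "((\<lambda>u. integral {0..u} g) has_real_derivative g t) (at t within {0..T})"
    by (rule integral_has_real_derivative[OF g]) (use t in auto)
  then have "((\<lambda>u. integral {0..u} g) has_real_derivative g t) (at t)"
    using t by (simp add: at_within_Icc_at)
  then show ?thesis
    by (rule has_field_derivative_transform_within_open[of _ _ _ "{..<T}"]) (use t eq in auto)
qed

lemma integral_swap_bounded:
  fixes f :: "real \<Rightarrow> real \<Rightarrow> real"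
  assumes f [measurable]: "(\<lambda>(x, y). f x y) \<in> borel_measurable (borel \<Otimes>\<^sub>M borel)"
    and b: "\<And>x y. a \<le> x \<Longrightarrow> x \<le> b \<Longrightarrow> c \<le> y \<Longrightarrow> y \<le> d \<Longrightarrow> \<bar>f x y\<bar> \<le> C"
  shows "(LINT x:{a..b}|lborel. (LINT y:{c..d}|lborel. f x y))
       = (LINT y:{c..d}|lborel. (LINT x:{a..b}|lborel. f x y))"
    and "set_integrable lborel {a..b} (\<lambda>x. (LINT y:{c..d}|lborel. f x y))"
proof -
  let ?h = "\<lambda>x y. indicator {a..b} x * (indicator {c..d} y * f x y)"
  have meas: "(\<lambda>(x, y). ?h x y) \<in> borel_measurable (lborel \<Otimes>\<^sub>M lborel)" by measurable
  have int: "integrable (lborel \<Otimes>\<^sub>M lborel) (\<lambda>(x, y). ?h x y)"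
  proof (rule Bochner_Integration.integrable_bound[OF _ meas])
    show "integrable (lborel \<Otimes>\<^sub>M lborel) (\<lambda>z. \<bar>C\<bar> * indicator ({a..b} \<times> {c..d}) z)"
      by (intro integrable_mult_right integrable_real_indicator)
        (auto simp: lborel.emeasure_pair_measure_Times ennreal_mult_less_top emeasure_lborel_Icc_eq)
    show "AE z in lborel \<Otimes>\<^sub>M lborel. norm (case z of (x, y) \<Rightarrow> ?h x y)
        \<le> norm (\<bar>C\<bar> * indicator ({a..b} \<times> {c..d}) z)"
    proof (rule AE_I2)
      fix z :: "real \<times> real"
      show "norm (case z of (x, y) \<Rightarrow> ?h x y) \<le> norm (\<bar>C\<bar> * indicator ({a..b} \<times> {c..d}) z)"
        using b[of "fst z" "snd z"] by (cases z) (auto simp: indicator_def)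
    qed
  qed
  show "(LINT x:{a..b}|lborel. (LINT y:{c..d}|lborel. f x y))
       = (LINT y:{c..d}|lborel. (LINT x:{a..b}|lborel. f x y))"
  proof -
    have "(LINT x|lborel. (LINT y|lborel. ?h x y)) = (LINT y|lborel. (LINT x|lborel. ?h x y))"
      using lborel_pair.Fubini_integral[OF int] by simp
    also have "(\<lambda>y. (LINT x|lborel. ?h x y)) = (\<lambda>y. (LINT x|lborel. indicator {c..d} y * (indicator {a..b} x * f x y)))"
      by (simp add: ac_simps)
    finally show ?thesis unfolding set_lebesgue_integral_def by simp
  qed
  show "set_integrable lborel {a..b} (\<lambda>x. (LINT y:{c..d}|lborel. f x y))"
    using lborel_pair.integrable_fst'[OF int]
    by (simp add: set_lebesgue_integral_def set_integrable_def)
qed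

section \<open>Absolute values along an integral curve\<close>

text \<open>Such a function has derivative \<open>0\<close> at every point.\<close>

lemma quadratic_increment_imp_const:
  fixes \<Phi> :: "real \<Rightarrow> real"
  assumes "\<And>x y. a \<le> x \<Longrightarrow> x \<le> y \<Longrightarrow> y \<le> b \<Longrightarrow> \<bar>\<Phi> y - \<Phi> x\<bar> \<le> M * (y - x)\<^sup>2" and "a \<le> b"
  shows "\<Phi> b = \<Phi> a"
proof -
  have "\<exists>c. \<forall>x\<in>{a..b}. \<Phi> x = c"
  proof (rule has_field_derivative_zero_constant)
    fix x assume x: "x \<in> {a..b}"
    have "((\<lambda>y. (\<Phi> y - \<Phi> x) / (y - x)) \<longlongrightarrow> 0) (at x within {a..b})"
    proof (rule Lim_null_comparison)
      show "((\<lambda>y. \<bar>M\<bar> * \<bar>y - x\<bar>) \<longlongrightarrow> 0) (at x within {a..b})"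
        by (auto intro!: tendsto_eq_intros)
      show "\<forall>\<^sub>F y in at x within {a..b}. norm ((\<Phi> y - \<Phi> x) / (y - x)) \<le> \<bar>M\<bar> * \<bar>y - x\<bar>"
        unfolding eventually_at_filter
      proof (intro always_eventually allI impI)
        fix y assume y: "y \<noteq> x" "y \<in> {a..b}"
        have "\<bar>\<Phi> y - \<Phi> x\<bar> \<le> M * (y - x)\<^sup>2"
          using assms(1)[of x y] assms(1)[of y x] x y
          by (cases "x \<le> y") (auto simp: abs_minus_commute power2_commute)
        also have "\<dots> \<le> \<bar>M\<bar> * (y - x)\<^sup>2" by (intro mult_right_mono) auto
        finally have "\<bar>\<Phi> y - \<Phi> x\<bar> \<le> (\<bar>M\<bar> * \<bar>y - x\<bar>) * \<bar>y - x\<bar>"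
          by (simp add: power2_eq_square abs_mult_self_eq mult.assoc)
        then show "norm ((\<Phi> y - \<Phi> x) / (y - x)) \<le> \<bar>M\<bar> * \<bar>y - x\<bar>"
          using y by (simp add: divide_le_eq)
      qed
    qed
    then show "(\<Phi> has_field_derivative 0) (at x within {a..b})"
      by (simp add: has_field_derivative_iff)
  qed simp
  then show ?thesis using assms(2) by auto
qed

text \<open>The chain rule for \<open>\<phi> \<circ> d\<close> when \<open>d\<close> is an indefinite integral of a bounded measurable \<open>q\<close>.
  Such a \<open>d\<close> is differentiable only almost everywhere.  This is avoided by looking at
  the difference of the two sides as a function of the upper limit: since \<open>d\<close> is Lipschitz and \<open>\<phi>'\<close> is
  Lipschitz, its increments are quadratically small, so it is constant.\<close>

lemma chain_rule_integral:
  fixes d q \<phi> \<phi>' :: "real \<Rightarrow> real"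
  assumes q [measurable]: "q \<in> borel_measurable borel" and K: "\<And>s. 0 \<le> s \<Longrightarrow> s \<le> t \<Longrightarrow> \<bar>q s\<bar> \<le> K"
    and d: "\<And>s. 0 \<le> s \<Longrightarrow> s \<le> t \<Longrightarrow> d s = d 0 + (LINT u:{0..s}|lborel. q u)"
    and [measurable]: "d \<in> borel_measurable borel"
    and \<phi>: "\<And>x. (\<phi> has_real_derivative \<phi>' x) (at x)" 
    and lip: "\<And>x y. \<bar>\<phi>' x - \<phi>' y\<bar> \<le> M * \<bar>x - y\<bar>" and b1: "\<And>x. \<bar>\<phi>' x\<bar> \<le> 1" and t: "0 \<le> t"
  shows "\<phi> (d t) = \<phi> (d 0) + (LINT s:{0..t}|lborel. \<phi>' (d s) * q s)"
proof -
  have K0: "0 \<le> K" using K[of 0] t by linarith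
  have M0: "0 \<le> M" using order_trans[OF abs_ge_zero lip[of 1 0]] by simp
  have [measurable]: "\<phi>' \<in> borel_measurable borel"
  proof (rule borel_measurable_continuous_onI)
    show "continuous_on UNIV \<phi>'"
      by (rule lipschitz_on_continuous_on[where L=M]) (auto simp: lipschitz_on_def dist_real_def lip M0)
  qed
  have iq: "set_integrable lborel {a..c} q" if "0 \<le> a" "c \<le> t" for a c
    by (rule set_integrable_bounded_Icc[where K=K]) (use K that in auto)
  have bpq: "\<bar>\<phi>' (d s) * q s\<bar> \<le> K" if "0 \<le> s" "s \<le> t" for s
    using mult_mono[OF b1 K[OF that], of "d s"] K0 by (simp add: abs_mult)
  have ipq: "set_integrable lborel {a..c} (\<lambda>s. \<phi>' (d s) * q s)" if "0 \<le> a" "c \<le> t" for a c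
    by (rule set_integrable_bounded_Icc[where K=K]) (use bpq that in auto)
  have inc: "d y - d x = (LINT s:{x..y}|lborel. q s)" if "0 \<le> x" "x \<le> y" "y \<le> t" for x y
    using d[of x] d[of y] set_integral_Icc_split[OF iq, of 0 y x] that by auto
  have dlip: "\<bar>d y - d x\<bar> \<le> K * (y - x)" if "0 \<le> x" "x \<le> y" "y \<le> t" for x y
    unfolding inc[OF that] by (rule set_integral_Icc_abs_le) (use K that in auto)
  define \<Phi> where "\<Phi> x = \<phi> (d x) - (LINT s:{0..x}|lborel. \<phi>' (d s) * q s)" for x
  have "\<Phi> t = \<Phi> 0"
  proof (rule quadratic_increment_imp_const[OF _ t])
    fix x y assume xy: "0 \<le> x" "x \<le> y" "y \<le> t"
    obtain \<xi> where \<xi>: "\<phi> (d y) - \<phi> (d x) = \<phi>' \<xi> * (d y - d x)" "\<bar>\<xi> - d x\<bar> \<le> \<bar>d y - d x\<bar>"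
    proof (cases "d x" "d y" rule: linorder_cases)
      case less
      then show ?thesis using MVT2[OF less, of \<phi> \<phi>'] \<phi> that by (auto simp: mult.commute)
    next
      case greater
      obtain z where "d y < z" "z < d x" "\<phi> (d x) - \<phi> (d y) = (d x - d y) * \<phi>' z"
        using MVT2[OF greater, of \<phi> \<phi>'] \<phi> by auto
      then show ?thesis using that[of z] by (auto simp: algebra_simps)
    qed (use that in auto)
    have "\<Phi> y - \<Phi> x = \<phi>' \<xi> * (d y - d x) - (LINT s:{x..y}|lborel. \<phi>' (d s) * q s)"
      using set_integral_Icc_split[OF ipq, of 0 y x] xy \<xi>(1) by (simp add: \<Phi>_def)
    also have "\<dots> = (LINT s:{x..y}|lborel. \<phi>' \<xi> * q s - \<phi>' (d s) * q s)"
      using xy by (simp add: inc set_integral_diff set_integrable_mult_right iq ipq)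
    also have "\<bar>\<dots>\<bar> \<le> (2 * M * K * (y - x) * K) * (y - x)"
    proof (rule set_integral_Icc_abs_le)
      fix s assume s: "x \<le> s" "s \<le> y"
      have "\<bar>\<xi> - d s\<bar> \<le> \<bar>\<xi> - d x\<bar> + \<bar>d s - d x\<bar>" by simp
      also have "\<dots> \<le> K * (y - x) + K * (s - x)"
        using \<xi>(2) dlip[of x y] dlip[of x s] xy s by auto
      also have "\<dots> \<le> 2 * K * (y - x)" using s K0 by (simp add: algebra_simps mult_left_mono)
      finally have "\<bar>\<xi> - d s\<bar> \<le> 2 * K * (y - x)" .
      from order_trans[OF lip mult_left_mono[OF this M0]]
      have "\<bar>\<phi>' \<xi> - \<phi>' (d s)\<bar> \<le> 2 * M * K * (y - x)" by (simp add: ac_simps)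
      then have "\<bar>\<phi>' \<xi> - \<phi>' (d s)\<bar> * \<bar>q s\<bar> \<le> 2 * M * K * (y - x) * K"
        using K[of s] s xy M0 K0 by (intro mult_mono) auto
      then show "\<bar>\<phi>' \<xi> * q s - \<phi>' (d s) * q s\<bar> \<le> 2 * M * K * (y - x) * K"
        by (simp add: abs_mult[symmetric] left_diff_distrib)
    qed (use xy in auto)
    finally show "\<bar>\<Phi> y - \<Phi> x\<bar> \<le> (2 * M * K * K) * (y - x)\<^sup>2"
      by (simp add: power2_eq_square ac_simps)
  qed
  moreover have "(LINT s:{0..0}|lborel. \<phi>' (d s) * q s) = 0"
    using set_integral_Icc_abs_le[of "\<lambda>s. \<phi>' (d s) * q s" 0 0 K] bpq t by simp
  ultimately show ?thesis by (simp add: \<Phi>_def)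
qed

text \<open>The smooth approximation \<open>sqrt (x\<^sup>2 + e\<^sup>2)\<close> of \<open>\<bar>x\<bar>\<close> fulfils the hypotheses of \<open>chain_rule_integral\<close>.\<close>

lemma sqrt_regularization:
  fixes e :: real assumes "0 < e"
  shows "((\<lambda>x. sqrt (x\<^sup>2 + e\<^sup>2)) has_real_derivative x / sqrt (x\<^sup>2 + e\<^sup>2)) (at x)"
    and "\<bar>x / sqrt (x\<^sup>2 + e\<^sup>2)\<bar> \<le> 1"
    and "\<bar>x / sqrt (x\<^sup>2 + e\<^sup>2) - y / sqrt (y\<^sup>2 + e\<^sup>2)\<bar> \<le> (1 / e) * \<bar>x - y\<bar>"
proof -
  have pos: "0 < z\<^sup>2 + e\<^sup>2" for z using assms by (simp add: add_nonneg_pos)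
  show "((\<lambda>x. sqrt (x\<^sup>2 + e\<^sup>2)) has_real_derivative x / sqrt (x\<^sup>2 + e\<^sup>2)) (at x)"
    using pos[of x] by (auto intro!: derivative_eq_intros simp: field_simps)
  show "\<bar>x / sqrt (x\<^sup>2 + e\<^sup>2)\<bar> \<le> 1"
    using pos[of x] real_sqrt_le_mono[of "x\<^sup>2" "x\<^sup>2 + e\<^sup>2"] by (simp add: abs_divide divide_le_eq)
  have der: "((\<lambda>x. x / sqrt (x\<^sup>2 + e\<^sup>2)) has_real_derivative e\<^sup>2 / ((z\<^sup>2 + e\<^sup>2) * sqrt (z\<^sup>2 + e\<^sup>2))) (at z within UNIV)" for z
  proof -
    have "((\<lambda>x. x / sqrt (x\<^sup>2 + e\<^sup>2)) has_real_derivative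
       (1 * sqrt (z\<^sup>2 + e\<^sup>2) - z * (z / sqrt (z\<^sup>2 + e\<^sup>2))) / (sqrt (z\<^sup>2 + e\<^sup>2) * sqrt (z\<^sup>2 + e\<^sup>2))) (at z)"
      using pos[of z] by (auto intro!: derivative_eq_intros simp: field_simps)
    also have "(1 * sqrt (z\<^sup>2 + e\<^sup>2) - z * (z / sqrt (z\<^sup>2 + e\<^sup>2))) = e\<^sup>2 / sqrt (z\<^sup>2 + e\<^sup>2)"
    proof -
      define r where "r = sqrt (z\<^sup>2 + e\<^sup>2)"
      have "0 < r" "r * r = z * z + e * e"
        using pos[of z] by (simp_all add: r_def flip: power2_eq_square)
      then show ?thesis unfolding r_def[symmetric] by (simp add: field_simps power2_eq_square)
    qed
    finally show ?thesis using pos[of z] by (simp add: field_simps)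
  qed
  have "norm (x / sqrt (x\<^sup>2 + e\<^sup>2) - y / sqrt (y\<^sup>2 + e\<^sup>2)) \<le> (1 / e) * norm (x - y)"
  proof (rule field_differentiable_bound[OF convex_UNIV der])
    fix z :: real
    have "e \<le> sqrt (z\<^sup>2 + e\<^sup>2)" using assms by (intro real_le_rsqrt) simp
    then have "e\<^sup>2 * e \<le> (z\<^sup>2 + e\<^sup>2) * sqrt (z\<^sup>2 + e\<^sup>2)" using assms by (intro mult_mono) auto
    then show "norm (e\<^sup>2 / ((z\<^sup>2 + e\<^sup>2) * sqrt (z\<^sup>2 + e\<^sup>2))) \<le> 1 / e"
      using assms pos[of z]
      by (subst real_norm_def, subst abs_of_nonneg, simp, subst frac_le_eq, simp_all)
        (auto intro!: divide_nonpos_pos simp: mult.commute)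
  qed auto
  then show "\<bar>x / sqrt (x\<^sup>2 + e\<^sup>2) - y / sqrt (y\<^sup>2 + e\<^sup>2)\<bar> \<le> (1 / e) * \<bar>x - y\<bar>" by simp
qed

text \<open>Formally, \<open>\<bar>d\<bar>' = sgn d * q \<le> p\<close>.  The chain rule for the approximations \<open>sqrt (d\<^sup>2 + e\<^sup>2)\<close> gives this with
  \<open>p\<close> damped by a factor that tends to the indicator of \<open>d \<noteq> 0\<close>; where \<open>d = 0\<close>, the two sign
  conditions together say \<open>p \<ge> 0\<close>.\<close>

lemma abs_integral_comparison:
  fixes d q p :: "real \<Rightarrow> real"
  assumes q [measurable]: "q \<in> borel_measurable borel" and K: "\<And>s. 0 \<le> s \<Longrightarrow> s \<le> t \<Longrightarrow> \<bar>q s\<bar> \<le> K"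
    and p [measurable]: "p \<in> borel_measurable borel" and Kp: "\<And>s. 0 \<le> s \<Longrightarrow> s \<le> t \<Longrightarrow> \<bar>p s\<bar> \<le> K"
    and d: "\<And>s. 0 \<le> s \<Longrightarrow> s \<le> t \<Longrightarrow> d s = d 0 + (LINT u:{0..s}|lborel. q u)"
    and [measurable]: "d \<in> borel_measurable borel"
    and pos: "\<And>s. 0 \<le> s \<Longrightarrow> s \<le> t \<Longrightarrow> 0 \<le> d s \<Longrightarrow> q s \<le> p s"
    and neg: "\<And>s. 0 \<le> s \<Longrightarrow> s \<le> t \<Longrightarrow> d s \<le> 0 \<Longrightarrow> - q s \<le> p s"
    and t: "0 \<le> t"
  shows "\<bar>d t\<bar> \<le> \<bar>d 0\<bar> + (LINT s:{0..t}|lborel. p s)"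
proof -
  define e where "e n = 1 / real (Suc n)" for n
  have e0: "0 < e n" for n by (simp add: e_def)
  have elim: "e \<longlonglongrightarrow> 0" unfolding e_def using LIMSEQ_inverse_real_of_nat by (simp add: inverse_eq_divide)
  define \<theta> where "\<theta> n x = x / sqrt (x\<^sup>2 + (e n)\<^sup>2)" for n x
  have [measurable]: "\<theta> n \<in> borel_measurable borel" for n unfolding \<theta>_def by measurable
  have \<theta>1: "\<bar>\<theta> n x\<bar> \<le> 1" for n x unfolding \<theta>_def by (rule sqrt_regularization(2)[OF e0])
  have K0: "0 \<le> K" using K[of 0] t by linarith
  have bpq: "\<bar>\<theta> n (d s) * q s\<bar> \<le> K" "\<bar>\<bar>\<theta> n (d s)\<bar> * p s\<bar> \<le> K" if "0 \<le> s" "s \<le> t" for s n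
    using mult_mono[OF \<theta>1 K[OF that], of n "d s"] mult_mono[OF \<theta>1 Kp[OF that], of n "d s"] K0 
    by (simp_all add: abs_mult)
  have step: "sqrt ((d t)\<^sup>2 + (e n)\<^sup>2) \<le> sqrt ((d 0)\<^sup>2 + (e n)\<^sup>2) + (LINT s:{0..t}|lborel. \<bar>\<theta> n (d s)\<bar> * p s)" for n
  proof -
    have "sqrt ((d t)\<^sup>2 + (e n)\<^sup>2) = sqrt ((d 0)\<^sup>2 + (e n)\<^sup>2) + (LINT s:{0..t}|lborel. \<theta> n (d s) * q s)"
      by (rule chain_rule_integral[where K=K and M="1 / e n" and \<phi>'="\<theta> n",
            OF q K d \<open>d \<in> borel_measurable borel\<close> _ _ \<theta>1 t])
        (use sqrt_regularization[OF e0] in \<open>simp_all add: \<theta>_def\<close>)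
    also have "(LINT s:{0..t}|lborel. \<theta> n (d s) * q s) \<le> (LINT s:{0..t}|lborel. \<bar>\<theta> n (d s)\<bar> * p s)"
    proof (rule set_integral_mono)
      show "set_integrable lborel {0..t} (\<lambda>s. \<theta> n (d s) * q s)" "set_integrable lborel {0..t} (\<lambda>s. \<bar>\<theta> n (d s)\<bar> * p s)"
        by (rule set_integrable_bounded_Icc[where K=K]; use bpq in auto)+
      fix s assume s: "s \<in> {0..t}"
      show "\<theta> n (d s) * q s \<le> \<bar>\<theta> n (d s)\<bar> * p s"
      proof (cases "0 \<le> d s")
        case True
        then have "0 \<le> \<theta> n (d s)" unfolding \<theta>_def by simp
        then show ?thesis using pos[of s] s True by (auto intro: mult_left_mono)
      next
        case False
        then have "\<theta> n (d s) \<le> 0" unfolding \<theta>_def by (simp add: divide_nonpos_nonneg)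
        then show ?thesis using mult_left_mono_neg[of "- p s" "q s" "\<theta> n (d s)"] neg[of s] s False by auto
      qed
    qed
    finally show ?thesis by simp
  qed
  have lim: "(\<lambda>n. LINT s:{0..t}|lborel. \<bar>\<theta> n (d s)\<bar> * p s) \<longlonglongrightarrow> (LINT s:{0..t}|lborel. (if d s = 0 then 0 else p s))"
    unfolding set_lebesgue_integral_def
  proof (rule integral_dominated_convergence)
    show "integrable lborel (\<lambda>s. indicator {0..t} s *\<^sub>R K)"
      using set_integrable_bounded_Icc[of "\<lambda>_. K" 0 t K] K0 by (simp add: set_integrable_def)
    show "AE s in lborel. (\<lambda>n. indicator {0..t} s *\<^sub>R (\<bar>\<theta> n (d s)\<bar> * p s))
        \<longlonglongrightarrow> indicator {0..t} s *\<^sub>R (if d s = 0 then 0 else p s)"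
    proof (rule AE_I2)
      fix s
      have "(\<lambda>n. \<bar>\<theta> n (d s)\<bar> * p s) \<longlonglongrightarrow> (if d s = 0 then 0 else p s)"
      proof (cases "d s = 0")
        case False
        have "(\<lambda>n. \<bar>\<theta> n (d s)\<bar> * p s) \<longlonglongrightarrow> \<bar>d s / sqrt ((d s)\<^sup>2 + 0\<^sup>2)\<bar> * p s"
          unfolding \<theta>_def by (intro tendsto_intros elim) (use False in auto)
        then show ?thesis using False by (simp add: abs_divide)
      qed (simp add: \<theta>_def)
      then show "(\<lambda>n. indicator {0..t} s *\<^sub>R (\<bar>\<theta> n (d s)\<bar> * p s))
        \<longlonglongrightarrow> indicator {0..t} s *\<^sub>R (if d s = 0 then 0 else p s)" by (intro tendsto_intros)
    qed
    show "AE s in lborel. norm (indicator {0..t} s *\<^sub>R (\<bar>\<theta> n (d s)\<bar> * p s)) \<le> indicator {0..t} s *\<^sub>R K" for n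
      using bpq by (auto simp: indicator_def)
  qed measurable
  have "sqrt ((d t)\<^sup>2 + 0\<^sup>2) \<le> sqrt ((d 0)\<^sup>2 + 0\<^sup>2) + (LINT s:{0..t}|lborel. (if d s = 0 then 0 else p s))"
  proof (rule LIMSEQ_le)
    show "(\<lambda>n. sqrt ((d t)\<^sup>2 + (e n)\<^sup>2)) \<longlonglongrightarrow> sqrt ((d t)\<^sup>2 + 0\<^sup>2)"
      by (intro tendsto_intros elim)
    show "(\<lambda>n. sqrt ((d 0)\<^sup>2 + (e n)\<^sup>2) + (LINT s:{0..t}|lborel. \<bar>\<theta> n (d s)\<bar> * p s))
      \<longlonglongrightarrow> sqrt ((d 0)\<^sup>2 + 0\<^sup>2) + (LINT s:{0..t}|lborel. (if d s = 0 then 0 else p s))"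
      by (intro tendsto_intros elim lim)
  qed (use step in auto)
  also have "(LINT s:{0..t}|lborel. (if d s = 0 then 0 else p s)) \<le> (LINT s:{0..t}|lborel. p s)"
  proof (rule set_integral_mono)
    show "set_integrable lborel {0..t} (\<lambda>s. if d s = 0 then 0 else p s)" "set_integrable lborel {0..t} p"
      by (rule set_integrable_bounded_Icc[where K=K]; use Kp K0 in auto)+
    fix s assume "s \<in> {0..t}"
    then show "(if d s = 0 then 0 else p s) \<le> p s" using pos[of s] neg[of s] by auto
  qed
  finally show ?thesis by simp
qed

section \<open>Tail integrals with weight \<open>z\<^sup>-\<^sup>2\<close> and the flux\<close>

definition wtail :: "(real \<Rightarrow> real) \<Rightarrow> real \<Rightarrow> real" where
  "wtail k y = (LINT z:{y<..}|lborel. k z / z\<^sup>2)"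

text \<open>For \<open>k = \<Psi> \<circ> F\<close> this is the source term of the evolution, the Stieltjes integral
  \<open>y\<^sup>2 \<integral>\<^bsub>(y,\<infinity>)\<^esub> 1/z dk(z)\<close> after an integration by parts.  Unlike the Stieltjes integral it makes sense for the
  absolute value of a difference of two such functions, to which the contraction proof applies it.\<close>

definition flux :: "(real \<Rightarrow> real) \<Rightarrow> real \<Rightarrow> real" where
  "flux k y = y\<^sup>2 * wtail k y - y * k y"

lemma nn_integral_inverse_square_tail:
  fixes y :: real assumes "0 < y"
  shows "(\<integral>\<^sup>+z\<in>{y<..}. ennreal (1 / z\<^sup>2) \<partial>lborel) = ennreal (1 / y)"
proof -
  have "(\<integral>\<^sup>+z\<in>{y<..}. ennreal (1 / z\<^sup>2) \<partial>lborel)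
      = (\<integral>\<^sup>+z. ennreal (1 / z\<^sup>2) * indicator {y..} z \<partial>lborel)"
    by (rule nn_integral_cong_AE)
      (use AE_lborel_singleton[of y] in eventually_elim, auto simp: indicator_def)
  also have "\<dots> = ennreal (0 - (- 1 / y))"
  proof (rule nn_integral_FTC_atLeast)
    show "((\<lambda>z::real. - 1 / z) \<longlongrightarrow> 0) at_top"
      by real_asymp
    show "DERIV (\<lambda>z. - 1 / z) x :> 1 / x\<^sup>2" if "y \<le> x" for x
      using that assms by (auto intro!: derivative_eq_intros simp: power2_eq_square)
  qed auto
  finally show ?thesis by simp
qed

lemma inverse_square_tail:
  fixes y :: real assumes "0 < y"
  shows "set_integrable lborel {y<..} (\<lambda>z. 1 / z\<^sup>2)"
    and "(LINT z:{y<..}|lborel. 1 / z\<^sup>2) = 1 / y"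
proof -
  have eq: "(\<integral>\<^sup>+z. ennreal (indicator {y<..} z *\<^sub>R (1 / z\<^sup>2)) \<partial>lborel) = ennreal (1 / y)"
    unfolding nn_integral_inverse_square_tail[OF assms, symmetric]
    by (intro nn_integral_cong) (auto simp: indicator_def)
  show 1: "set_integrable lborel {y<..} (\<lambda>z. 1 / z\<^sup>2)"
    unfolding set_integrable_def
    by (rule integrableI_nn_integral_finite[OF _ _ eq]) auto
  show "(LINT z:{y<..}|lborel. 1 / z\<^sup>2) = 1 / y"
    unfolding set_lebesgue_integral_def
    by (rule integral_eq_nn_integral[THEN trans]) (use eq assms in auto)
qed

lemma wtail_integrable:
  fixes k :: "real \<Rightarrow> real"
  assumes [measurable]: "k \<in> borel_measurable borel" and "\<And>z. \<bar>k z\<bar> \<le> C" "0 < y"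
  shows "set_integrable lborel {y<..} (\<lambda>z. k z / z\<^sup>2)"
proof -
  have "0 \<le> C" by (rule order_trans[OF abs_ge_zero assms(2)])
  have "set_integrable lborel {y<..} (\<lambda>z. C * (1 / z\<^sup>2))"
    using inverse_square_tail(1)[OF assms(3)] by (rule set_integrable_mult_right)
  then show ?thesis
    unfolding set_integrable_def
    by (rule Bochner_Integration.integrable_bound)
      (use assms(2) \<open>0 \<le> C\<close> in \<open>auto simp: indicator_def divide_right_mono\<close>)
qed

lemma wtail_const: "0 < y \<Longrightarrow> wtail (\<lambda>_. c) y = c / y"
  using set_integral_mult_right[where f="\<lambda>z::real. 1 / z\<^sup>2" and a=c and A="{y<..}" and M=lborel]
  by (simp add: wtail_def inverse_square_tail)

lemma wtail_mono:
  assumes "k \<in> borel_measurable borel" "\<And>z. \<bar>k z\<bar> \<le> C"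
    and "h \<in> borel_measurable borel" "\<And>z. \<bar>h z\<bar> \<le> C'" and "0 < y" "\<And>z. y < z \<Longrightarrow> k z \<le> h z"
  shows "wtail k y \<le> wtail h y"
  unfolding wtail_def
  by (intro set_integral_mono wtail_integrable) (use assms in \<open>auto simp: divide_right_mono\<close>)

lemma wtail_diff:
  assumes "k \<in> borel_measurable borel" "\<And>z. \<bar>k z\<bar> \<le> C"
    and "h \<in> borel_measurable borel" "\<And>z. \<bar>h z\<bar> \<le> C'" and "0 < y"
  shows "wtail (\<lambda>z. k z - h z) y = wtail k y - wtail h y"
  unfolding wtail_def
  by (subst set_integral_diff(2)[symmetric])
    (auto intro!: wtail_integrable assms simp: diff_divide_distrib)

lemma wtail_abs_le:
  assumes k: "k \<in> borel_measurable borel" "\<And>z. \<bar>k z\<bar> \<le> C" and "0 < y"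
  shows "\<bar>wtail k y\<bar> \<le> wtail (\<lambda>z. \<bar>k z\<bar>) y"
proof -
  have "wtail k y \<le> wtail (\<lambda>z. \<bar>k z\<bar>) y" 
    by (rule wtail_mono[where C=C and C'=C]) (use assms in auto)
  moreover have "wtail (\<lambda>z. 0 - k z) y = wtail (\<lambda>_. 0) y - wtail k y"
    by (rule wtail_diff[where C=0 and C'=C]) (use assms in auto)
  moreover have "wtail (\<lambda>z. 0 - k z) y \<le> wtail (\<lambda>z. \<bar>k z\<bar>) y" 
    by (rule wtail_mono[where C=C and C'=C]) (use assms in auto)
  ultimately show ?thesis by (simp add: wtail_const assms)
qed

lemma wtail_bounds:
  assumes k: "k \<in> borel_measurable borel" and "\<And>z. 0 \<le> k z" "\<And>z. k z \<le> 1" and "0 < y"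
  shows "0 \<le> wtail k y" "y * wtail k y \<le> 1"
proof -
  have b: "\<bar>k z\<bar> \<le> 1" for z using assms(2,3)[of z] by auto
  have "wtail (\<lambda>_. 0) y \<le> wtail k y"
    by (rule wtail_mono[where C=1 and C'=1]) (use assms b in auto)
  then show "0 \<le> wtail k y" by (simp add: wtail_const assms)
  have "wtail k y \<le> wtail (\<lambda>_. 1) y"
    by (rule wtail_mono[where C=1 and C'=1]) (use assms b in auto)
  then show "y * wtail k y \<le> 1" using assms(4) by (simp add: wtail_const field_simps)
qed

lemma wtail_scale:
  assumes "0 < c"
  shows "wtail k (c * y) = wtail (\<lambda>z. k (c * z)) y / c"
proof -
  have "wtail k (c * y) = (LINT z|lborel. indicator {c * y<..} z *\<^sub>R (k z / z\<^sup>2))"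
    by (simp add: wtail_def set_lebesgue_integral_def)
  also have "\<dots> = \<bar>c\<bar> *\<^sub>R (LINT z|lborel. indicator {c * y<..} (0 + c * z) *\<^sub>R (k (0 + c * z) / (0 + c * z)\<^sup>2))"
    using assms by (intro lborel_integral_real_affine) auto
  also have "\<dots> = c * (LINT z|lborel. (1 / c\<^sup>2) * (indicator {y<..} z *\<^sub>R (k (c * z) / z\<^sup>2)))"
    using assms by (auto intro!: arg_cong2[where f="(*)"] Bochner_Integration.integral_cong
        simp: indicator_def power_mult_distrib field_simps)
  also have "\<dots> = wtail (\<lambda>z. k (c * z)) y / c"
    unfolding integral_mult_right_zero wtail_def set_lebesgue_integral_def
    using assms by (simp add: power2_eq_square)
  finally show ?thesis .
qed

lemma flux_scale:
  assumes "0 < c"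
  shows "flux k (c * w) = c * flux (\<lambda>z. k (c * z)) w"
  using assms unfolding flux_def by (simp add: wtail_scale power2_eq_square field_simps)

text \<open>Dominated convergence, with \<open>C / z\<^sup>2\<close> as the dominating function.\<close>

lemma wtail_tendsto:
  assumes "\<And>n. k n \<in> borel_measurable borel" "l \<in> borel_measurable borel"
    and "\<And>n z. \<bar>k n z\<bar> \<le> C" "0 < y" "AE z in lborel. y < z \<longrightarrow> (\<lambda>n. k n z) \<longlonglongrightarrow> l z"
  shows "(\<lambda>n. wtail (k n) y) \<longlonglongrightarrow> wtail l y"
  unfolding wtail_def set_lebesgue_integral_def
proof (rule integral_dominated_convergence)
  show "integrable lborel (\<lambda>z. indicator {y<..} z *\<^sub>R (C / z\<^sup>2))"
    using wtail_integrable[of "\<lambda>_. C" "\<bar>C\<bar>" y] assms(4) by (simp add: set_integrable_def)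
  show "AE z in lborel. (\<lambda>n. indicator {y<..} z *\<^sub>R (k n z / z\<^sup>2)) \<longlonglongrightarrow> indicator {y<..} z *\<^sub>R (l z / z\<^sup>2)"
    using assms(5) by eventually_elim (use assms(4) in \<open>auto simp: indicator_def intro!: tendsto_intros\<close>)
  show "AE z in lborel. norm (indicator {y<..} z *\<^sub>R (k n z / z\<^sup>2)) \<le> indicator {y<..} z *\<^sub>R (C / z\<^sup>2)" for n
    using assms(3) by (auto simp: indicator_def divide_right_mono)
qed (use assms in measurable)

lemma borel_measurable_wtail:
  assumes [measurable]: "(\<lambda>(s, x). k s x) \<in> borel_measurable (M \<Otimes>\<^sub>M borel)"
    and [measurable]: "g \<in> borel_measurable M"
  shows "(\<lambda>s. wtail (k s) (g s)) \<in> borel_measurable M"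
proof -
  have "(\<lambda>(s, z). indicator {g s<..} z *\<^sub>R (k s z / z\<^sup>2)) \<in> borel_measurable (M \<Otimes>\<^sub>M lborel)"
  proof -
    have "(\<lambda>(s, z). (if g s < z then 1 else 0) *\<^sub>R (k s z / z\<^sup>2)) \<in> borel_measurable (M \<Otimes>\<^sub>M lborel)"
      by measurable
    then show ?thesis by (simp add: indicator_def)
  qed
  then show ?thesis
    unfolding wtail_def set_lebesgue_integral_def by (rule lborel.borel_measurable_lebesgue_integral)
qed

lemma borel_measurable_wtail_fixed:
  assumes [measurable]: "k \<in> borel_measurable borel"
  shows "wtail k \<in> borel_measurable borel"
  by (rule borel_measurable_wtail[where k="\<lambda>_. k" and g="\<lambda>x. x"]) measurable

lemma borel_measurable_compose2:
  assumes "(\<lambda>(s, x). k s x) \<in> borel_measurable (N \<Otimes>\<^sub>M borel)" "u \<in> measurable M N" "v \<in> borel_measurable M"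
  shows "(\<lambda>p. k (u p) (v p)) \<in> borel_measurable M"
  using measurable_compose[OF measurable_Pair[OF assms(2,3)] assms(1)] by simp

lemma borel_measurable_pair_section:
  assumes "(\<lambda>(s, x). k s x) \<in> borel_measurable (M \<Otimes>\<^sub>M borel)" "g \<in> borel_measurable M"
  shows "(\<lambda>s. k s (g s)) \<in> borel_measurable M"
  using borel_measurable_compose2[OF assms(1) measurable_ident_sets[OF refl] assms(2)] by simp

lemma wtail_split:
  assumes "k \<in> borel_measurable borel" "\<And>z. \<bar>k z\<bar> \<le> C" "0 < a" "a \<le> b"
  shows "wtail k a = (LINT z:{a<..b}|lborel. k z / z\<^sup>2) + wtail k b"
    and "set_integrable lborel {a<..b} (\<lambda>z. k z / z\<^sup>2)"
proof -
  have i: "set_integrable lborel {a<..} (\<lambda>z. k z / z\<^sup>2)" "set_integrable lborel {b<..} (\<lambda>z. k z / z\<^sup>2)"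
    using assms by (auto intro!: wtail_integrable[where C=C])
  show j: "set_integrable lborel {a<..b} (\<lambda>z. k z / z\<^sup>2)"
    by (rule set_integrable_subset[OF i(1)]) auto
  have "{a<..} = {a<..b} \<union> {b<..}" using assms by auto
  then show "wtail k a = (LINT z:{a<..b}|lborel. k z / z\<^sup>2) + wtail k b"
    unfolding wtail_def by (simp add: set_integral_Un[OF _ j i(2)] disjoint_iff)
qed

lemma wtail_Icc:
  assumes k: "k \<in> borel_measurable borel" "\<And>z. \<bar>k z\<bar> \<le> C" "0 < a" "a \<le> b"
  shows "set_integrable lborel {a..b} (\<lambda>z. k z / z\<^sup>2)"
    and "(LINT z:{a..b}|lborel. k z / z\<^sup>2) = wtail k a - wtail k b"
proof -
  show i: "set_integrable lborel {a..b} (\<lambda>z. k z / z\<^sup>2)"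
    by (rule set_integrable_subset[OF wtail_integrable[OF k(1,2), of "a / 2"]]) (use k in auto)
  have "(LINT z:{a..b}|lborel. k z / z\<^sup>2) = (LINT z:{a<..b}|lborel. k z / z\<^sup>2)"
    using i wtail_split(2)[OF k] AE_lborel_singleton[of a]
    unfolding set_lebesgue_integral_def set_integrable_def
    by (intro integral_cong_AE borel_measurable_integrable) (auto elim!: eventually_mono simp: indicator_def)
  then show "(LINT z:{a..b}|lborel. k z / z\<^sup>2) = wtail k a - wtail k b"
    using wtail_split(1)[OF k] by simp
qed

lemma borel_measurable_flux:
  assumes k: "(\<lambda>(s, x). k s x) \<in> borel_measurable (M \<Otimes>\<^sub>M borel)" and g [measurable]: "g \<in> borel_measurable M"
  shows "(\<lambda>s. flux (k s) (g s)) \<in> borel_measurable M"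
proof -
  note [measurable] = borel_measurable_wtail[OF assms] borel_measurable_pair_section[OF assms]
  show ?thesis unfolding flux_def by measurable
qed

lemma flux_bound:
  assumes k: "k \<in> borel_measurable borel" and "\<And>z. 0 \<le> k z" "\<And>z. k z \<le> 1" and "0 < y"
  shows "\<bar>flux k y\<bar> \<le> y"
proof -
  have "flux k y = y * (y * wtail k y - k y)" by (simp add: flux_def power2_eq_square algebra_simps)
  moreover have "\<bar>y * wtail k y - k y\<bar> \<le> 1"
    using wtail_bounds[OF k assms(2-4)] assms(2,3)[of y] mult_nonneg_nonneg[of y "wtail k y"] assms(4) by linarith
  ultimately show ?thesis using assms(4) by (simp add: abs_mult mult_left_le)
qed

text \<open>\<open>flux k x / x\<^sup>2 = wtail k x - k x / x\<close> is formally the derivative of \<open>x * wtail k x\<close>.  As \<open>k\<close> is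
  merely measurable, the identity is obtained by exchanging the two integrations instead.\<close>

lemma integral_flux:
  assumes k [measurable]: "k \<in> borel_measurable borel" and b: "\<And>z. \<bar>k z\<bar> \<le> C" and ab: "0 < a" "a \<le> b"
  shows "(LINT x:{a..b}|lborel. flux k x / x\<^sup>2) = b * wtail k b - a * wtail k a"
proof -
  let ?K = "\<lambda>z. k z / z\<^sup>2"
  have C: "0 \<le> C" by (rule order_trans[OF abs_ge_zero b])
  define h where "h x z = indicator {a..b} x * (indicator {a<..} z * (indicator {x<..} z * ?K z))" for x z
  have meas: "(\<lambda>(x, z). h x z) \<in> borel_measurable (lborel \<Otimes>\<^sub>M lborel)"
  proof -
    have "(\<lambda>(x, z). indicator {a..b} x * (indicator {a<..} z * ((if x < z then 1 else 0) * ?K z)))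
      \<in> borel_measurable (lborel \<Otimes>\<^sub>M lborel)"
      by measurable
    then show ?thesis by (simp add: indicator_def h_def)
  qed
  have bound: "integrable (lborel \<Otimes>\<^sub>M lborel) (\<lambda>(x, z). h x z)"
  proof -
    define g :: "real \<Rightarrow> real \<Rightarrow> real" where "g x z = indicator {a..b} x * (indicator {a<..} z * (C / z\<^sup>2))" for x z
    have "integrable (lborel \<Otimes>\<^sub>M lborel) (\<lambda>(x, z). g x z)"
    proof (rule lborel_pair.Fubini_integrable)
      have "set_integrable lborel {a<..} (\<lambda>z. C / z\<^sup>2)"
        by (rule wtail_integrable) (use ab C in auto)
      then have i: "integrable lborel (\<lambda>z. indicator {a<..} z * (C / z\<^sup>2))"
        by (simp add: set_integrable_def)
      have i2: "integrable lborel (\<lambda>x::real. indicator {a..b} x :: real)"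
        by (rule integrable_real_indicator) (auto simp: emeasure_lborel_Icc_eq)
      show "AE x in lborel. integrable lborel (\<lambda>y. case (x, y) of (x, z) \<Rightarrow> g x z)"
        using integrable_mult_right[OF i] by (simp add: g_def)
      have "(\<lambda>x. LINT z|lborel. norm (g x z)) = (\<lambda>x. indicator {a..b} x * (LINT z|lborel. (indicator {a<..} z * (C / z\<^sup>2))))"
        unfolding g_def
        by (subst integral_mult_right_zero[symmetric]) (use C in \<open>auto simp: indicator_def abs_mult intro!: ext Bochner_Integration.integral_cong\<close>)
      then show "integrable lborel (\<lambda>x. LINT y|lborel. norm (case (x, y) of (x, z) \<Rightarrow> g x z))"
        using i2 by (simp del: real_norm_def)
    qed (simp add: g_def[abs_def])
    then show ?thesis
      by (rule Bochner_Integration.integrable_bound[OF _ meas])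
        (use b C in \<open>auto simp: indicator_def h_def g_def divide_right_mono\<close>)
  qed
  have swap: "(LINT x|lborel. (LINT z|lborel. h x z)) = (LINT z|lborel. (LINT x|lborel. h x z))"
    using lborel_pair.Fubini_integral[OF bound] by simp
  have L: "(LINT z|lborel. h x z) = indicator {a..b} x * wtail k x" for x
    unfolding wtail_def set_lebesgue_integral_def h_def
    by (subst integral_mult_right_zero[symmetric])
      (auto simp: indicator_def intro!: Bochner_Integration.integral_cong)
  \<comment> \<open>The section at \<open>z\<close> is \<open>k z / z\<^sup>2\<close> times the length of \<open>[a, min z b]\<close>; that length is written as a combination of
    indicators whose coefficients produce the two tails and the term that cancels the local part of the flux.\<close>
  have R: "(LINT x|lborel. h x z) = b * (indicator {b<..} z * ?K z) - a * (indicator {a<..} z * ?K z)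
       + indicator {a<..b} z * (z * ?K z)" for z
  proof -
    have "(LINT x|lborel. h x z) = (LINT x|lborel. (indicator {a<..} z * ?K z) * (if x \<in> {a..min z b} - {z} then 1 else 0))"
      unfolding h_def by (intro Bochner_Integration.integral_cong) (auto simp: indicator_def)
    also have "\<dots> = (indicator {a<..} z * ?K z) * (LINT x|lborel. (if x \<in> {a..min z b} - {z} then 1 else 0))"
      by (rule integral_mult_right_zero)
    also have "(LINT x|lborel. (if x \<in> {a..min z b} - {z} then 1 else 0)) = (LINT x|lborel. indicator {a..min z b} x)"
      by (rule integral_cong_AE) (use AE_lborel_singleton[of z] in \<open>auto simp: indicator_def\<close>)
    also have "(LINT x|lborel. indicator {a..min z b} x) = (if a \<le> min z b then min z b - a else 0)"
      by simp
    finally show ?thesis using ab by (auto simp: indicator_def algebra_simps min_def diff_divide_distrib)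
  qed
  have i1: "integrable lborel (\<lambda>z. indicator {b<..} z * ?K z)" "integrable lborel (\<lambda>z. indicator {a<..} z * ?K z)"
    using wtail_integrable[OF k b, of b] wtail_integrable[OF k b, of a] ab by (simp_all add: set_integrable_def)
  have i3: "integrable lborel (\<lambda>z. indicator {a<..b} z * (z * ?K z))"
  proof (rule Bochner_Integration.integrable_bound)
    show "integrable lborel (\<lambda>z. b * (indicator {a<..} z * (C / z\<^sup>2)))"
      by (intro integrable_mult_right)
        (use wtail_integrable[of "\<lambda>_. C" C a] ab C in \<open>simp add: set_integrable_def\<close>)
    show "AE z in lborel. norm (indicator {a<..b} z * (z * (k z / z\<^sup>2))) \<le> norm (b * (indicator {a<..} z * (C / z\<^sup>2)))"
    proof (rule AE_I2)
      fix z
      have "\<bar>z * (k z / z\<^sup>2)\<bar> \<le> b * (C / z\<^sup>2)" if "a < z" "z \<le> b"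
        unfolding abs_mult abs_divide using that b[of z] C ab
        by (intro mult_mono) (auto simp: divide_right_mono)
      then show "norm (indicator {a<..b} z * (z * (k z / z\<^sup>2))) \<le> norm (b * (indicator {a<..} z * (C / z\<^sup>2)))"
        using ab C by (auto simp: indicator_def)
    qed
  qed measurable
  have U: "integrable lborel (\<lambda>x. indicator {a..b} x * wtail k x)"
    using lborel_pair.integrable_fst'[OF bound] by (simp add: L)
  have lin: "(LINT z|lborel. b * A z - a * B z + D z)
      = b * (LINT z|lborel. A z) - a * (LINT z|lborel. B z) + (LINT z|lborel. D z)"
    if "integrable lborel A" "integrable lborel B" "integrable lborel D" for A B D :: "real \<Rightarrow> real"
    using that by simp
  have "(LINT x|lborel. indicator {a..b} x * wtail k x)
     = b * wtail k b - a * wtail k a + (LINT z|lborel. indicator {a<..b} z * (z * ?K z))"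
    using trans[OF swap[unfolded L R] lin[OF i1 i3]]
    unfolding wtail_def set_lebesgue_integral_def real_scaleR_def .
  moreover have "(LINT x:{a..b}|lborel. flux k x / x\<^sup>2)
    = (LINT x|lborel. indicator {a..b} x * wtail k x - indicator {a<..b} x * (x * ?K x))"
    unfolding set_lebesgue_integral_def
  proof (rule integral_cong_AE)
    show "AE x in lborel. indicator {a..b} x *\<^sub>R (flux k x / x\<^sup>2) = indicator {a..b} x * wtail k x - indicator {a<..b} x * (x * ?K x)"
      using AE_lborel_singleton[of a]
    proof eventually_elim
      case (elim x)
      then show ?case using ab by (auto simp: indicator_def flux_def diff_divide_distrib)
    qed
    have mw: "wtail k \<in> borel_measurable lborel" "k \<in> borel_measurable lborel"
      using borel_measurable_wtail_fixed[OF k] k by simp_all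
    show "(\<lambda>x. indicator {a..b} x *\<^sub>R (flux k x / x\<^sup>2)) \<in> borel_measurable lborel"
      "(\<lambda>x. indicator {a..b} x * wtail k x - indicator {a<..b} x * (x * ?K x)) \<in> borel_measurable lborel"
      unfolding flux_def
      by (intro borel_measurable_scaleR borel_measurable_diff borel_measurable_times
        borel_measurable_divide borel_measurable_indicator borel_measurable_power mw; simp)+
  qed
  ultimately show ?thesis
    unfolding Bochner_Integration.integral_diff[OF U i3] by linarith
qed

text \<open>The form in which \<open>integral_flux\<close> is applied to solutions: in the variable \<open>w\<close> that labels the
  characteristics, the flux at \<open>e\<^sup>s w\<close> is \<open>e\<^sup>s\<close> times the flux of the dilated function at \<open>w\<close> (\<open>flux_scale\<close>).\<close>

lemma integral_flux_evolution:
  assumes K: "(\<lambda>(s, x). K s x) \<in> borel_measurable (borel \<Otimes>\<^sub>M borel)"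
    and K0: "\<And>s z. 0 \<le> K s z" and K1: "\<And>s z. K s z \<le> 1" and ab: "0 < a" "a \<le> b" 
  shows "(LINT w:{a..b}|lborel. (LINT s:{0..t}|lborel. exp s * flux (K s) w) / w\<^sup>2)
       = (LINT s:{0..t}|lborel. exp s * (b * wtail (K s) b - a * wtail (K s) a))"
    and "set_integrable lborel {a..b} (\<lambda>w. (LINT s:{0..t}|lborel. exp s * flux (K s) w) / w\<^sup>2)"
proof -
  have Ks [measurable]: "K s \<in> borel_measurable borel" for s
    using measurable_Pair2[OF K, of s] by simp
  define f where "f w s = exp s * flux (K s) w / w\<^sup>2" for w s
  have fm: "(\<lambda>(w, s). f w s) \<in> borel_measurable (borel \<Otimes>\<^sub>M borel)"
  proof -
    have "(\<lambda>(p, x). K (snd p) x) \<in> borel_measurable ((borel \<Otimes>\<^sub>M borel) \<Otimes>\<^sub>M borel)"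
      unfolding split_beta' by (rule borel_measurable_compose2[OF K]) measurable
    note [measurable] = borel_measurable_flux[OF this measurable_fst]
    show ?thesis unfolding f_def split_beta' by measurable
  qed
  have fb: "\<bar>f w s\<bar> \<le> exp t / a" if "a \<le> w" "w \<le> b" "0 \<le> s" "s \<le> t" for w s
  proof -
    have "\<bar>f w s\<bar> = exp s * (\<bar>flux (K s) w\<bar> / w\<^sup>2)" by (simp add: f_def abs_mult)
    also have "\<dots> \<le> exp t * (w / w\<^sup>2)"
      using that ab by (intro mult_mono divide_right_mono flux_bound[OF Ks K0 K1]) auto
    also have "w / w\<^sup>2 = 1 / w" using that ab by (simp add: power2_eq_square)
    also have "exp t * (1 / w) \<le> exp t * (1 / a)" using that ab by (intro mult_left_mono frac_le) auto
    finally show ?thesis by simp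
  qed
  have eq: "(LINT s:{0..t}|lborel. f w s) = (LINT s:{0..t}|lborel. exp s * flux (K s) w) / w\<^sup>2" for w
    by (simp add: f_def set_integral_divide_zero)
  show "set_integrable lborel {a..b} (\<lambda>w. (LINT s:{0..t}|lborel. exp s * flux (K s) w) / w\<^sup>2)"
    using integral_swap_bounded(2)[OF fm fb, of a b 0 t] unfolding eq by simp
  have "(LINT w:{a..b}|lborel. (LINT s:{0..t}|lborel. exp s * flux (K s) w) / w\<^sup>2)
      = (LINT s:{0..t}|lborel. (LINT w:{a..b}|lborel. f w s))"
    using integral_swap_bounded(1)[OF fm fb, of a b 0 t] unfolding eq by simp
  also have "(\<lambda>s. LINT w:{a..b}|lborel. f w s) = (\<lambda>s. exp s * (b * wtail (K s) b - a * wtail (K s) a))"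
  proof
    fix s
    have "(LINT w:{a..b}|lborel. f w s) = (LINT w:{a..b}|lborel. exp s * (flux (K s) w / w\<^sup>2))"
      by (simp add: f_def)
    also have "\<dots> = exp s * (LINT w:{a..b}|lborel. flux (K s) w / w\<^sup>2)" by (rule set_integral_mult_right)
    also have "(LINT w:{a..b}|lborel. flux (K s) w / w\<^sup>2) = b * wtail (K s) b - a * wtail (K s) a"
      by (rule integral_flux[where C=1]) (use K0 K1 ab in auto)
    finally show "(LINT w:{a..b}|lborel. f w s) = exp s * (b * wtail (K s) b - a * wtail (K s) a)" .
  qed
  finally show "(LINT w:{a..b}|lborel. (LINT s:{0..t}|lborel. exp s * flux (K s) w) / w\<^sup>2)
       = (LINT s:{0..t}|lborel. exp s * (b * wtail (K s) b - a * wtail (K s) a))" .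
qed

lemma wtail_increment_bounds:
  assumes k: "k \<in> borel_measurable borel" "\<And>z. \<bar>k z\<bar> \<le> C" and xy: "0 < x" "x \<le> y"
    and lo: "\<And>z. x \<le> z \<Longrightarrow> z \<le> y \<Longrightarrow> lo \<le> k z" and hi: "\<And>z. x \<le> z \<Longrightarrow> z \<le> y \<Longrightarrow> k z \<le> hi"
  shows "lo * (1 / x - 1 / y) \<le> wtail k x - wtail k y" "wtail k x - wtail k y \<le> hi * (1 / x - 1 / y)"
proof -
  have c: "set_integrable lborel {x..y} (\<lambda>z. c / z\<^sup>2)" "(LINT z:{x..y}|lborel. c / z\<^sup>2) = c * (1 / x - 1 / y)" for c
    using wtail_Icc[of "\<lambda>_. c" "\<bar>c\<bar>", OF _ _ xy] xy by (auto simp: wtail_const right_diff_distrib)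
  note w = wtail_Icc[OF k xy]
  show "lo * (1 / x - 1 / y) \<le> wtail k x - wtail k y"
    unfolding c(2)[symmetric] w(2)[symmetric]
    by (rule set_integral_mono[OF c(1) w(1)]) (use lo in \<open>auto intro: divide_right_mono\<close>)
  show "wtail k x - wtail k y \<le> hi * (1 / x - 1 / y)"
    unfolding c(2)[symmetric] w(2)[symmetric]
    by (rule set_integral_mono[OF w(1) c(1)]) (use hi in \<open>auto intro: divide_right_mono\<close>)
qed

text \<open>Difference quotients with respect to the variable \<open>1 / x\<close> are averages of \<open>k\<close> over the interval
  between \<open>x\<close> and \<open>y\<close>, so bounds for \<open>k\<close> carry over to them.\<close>

lemma wtail_slope_bounds:
  assumes k: "k \<in> borel_measurable borel" "\<And>z. \<bar>k z\<bar> \<le> C" and xy: "0 < x" "0 < y" "x \<noteq> y"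
    and lo: "\<And>z. min x y \<le> z \<Longrightarrow> z \<le> max x y \<Longrightarrow> lo \<le> k z" and hi: "\<And>z. min x y \<le> z \<Longrightarrow> z \<le> max x y \<Longrightarrow> k z \<le> hi"
  shows "lo \<le> (wtail k x - wtail k y) / (1 / x - 1 / y)" "(wtail k x - wtail k y) / (1 / x - 1 / y) \<le> hi"
proof -
  have gen: "lo \<le> (wtail k u - wtail k v) / (1 / u - 1 / v) \<and> (wtail k u - wtail k v) / (1 / u - 1 / v) \<le> hi"
    if uv: "0 < u" "u < v" "u = min x y" "v = max x y" for u v
  proof -
    have "0 < 1 / u - 1 / v" using uv by (simp add: frac_less2)
    then show ?thesis
      using wtail_increment_bounds[OF k uv(1) less_imp_le[OF uv(2)], of lo hi] lo hi uv
      by (simp add: le_divide_eq divide_le_eq mult.commute)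
  qed
  have "(wtail k x - wtail k y) / (1 / x - 1 / y) = (wtail k y - wtail k x) / (1 / y - 1 / x)"
    using minus_divide_divide[of "wtail k x - wtail k y" "1 / x - 1 / y"] by (simp only: minus_diff_eq)
  then show "lo \<le> (wtail k x - wtail k y) / (1 / x - 1 / y)" "(wtail k x - wtail k y) / (1 / x - 1 / y) \<le> hi"
    using gen[of x y] gen[of y x] xy by (cases "x < y"; simp)+
qed

lemma derivative_iff_slope:
  fixes w :: "real \<Rightarrow> real"
  assumes y: "0 < y"
  shows "(w has_real_derivative D) (at y) \<longleftrightarrow> ((\<lambda>x. (w x - w y) / (1 / x - 1 / y)) \<longlongrightarrow> - (y\<^sup>2 * D)) (at y)"
proof -
  have ev: "\<forall>\<^sub>F x in at y. 0 < x \<and> x \<noteq> y"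
    using order_tendstoD(1)[OF tendsto_ident_at y, of UNIV] by (auto simp: eventually_at_filter elim: eventually_mono)
  have e1: "(w x - w y) / (1 / x - 1 / y) = - (x * y) * ((w x - w y) / (x - y))" if "0 < x" "x \<noteq> y" for x
    using that y by (simp add: divide_simps) (simp add: algebra_simps)
  show ?thesis
  proof
    assume "(w has_real_derivative D) (at y)"
    then have "((\<lambda>x. (w x - w y) / (x - y)) \<longlongrightarrow> D) (at y)" by (simp add: has_field_derivative_iff)
    then have "((\<lambda>x. - (x * y) * ((w x - w y) / (x - y))) \<longlongrightarrow> - (y * y) * D) (at y)" by (intro tendsto_intros)
    then show "((\<lambda>x. (w x - w y) / (1 / x - 1 / y)) \<longlongrightarrow> - (y\<^sup>2 * D)) (at y)"
      by (subst tendsto_cong[OF eventually_mono[OF ev e1]]) (auto simp: power2_eq_square)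
  next
    assume l: "((\<lambda>x. (w x - w y) / (1 / x - 1 / y)) \<longlongrightarrow> - (y\<^sup>2 * D)) (at y)"
    have "((\<lambda>x. - (1 / (x * y)) * ((w x - w y) / (1 / x - 1 / y))) \<longlongrightarrow> - (1 / (y * y)) * - (y\<^sup>2 * D)) (at y)"
      using y by (intro tendsto_intros l) auto
    moreover have "- (1 / (x * y)) * ((w x - w y) / (1 / x - 1 / y)) = (w x - w y) / (x - y)" if "0 < x \<and> x \<noteq> y" for x
      using that y by (subst e1) (auto simp del: minus_diff_eq)
    ultimately have "((\<lambda>x. (w x - w y) / (x - y)) \<longlongrightarrow> - (1 / (y * y)) * - (y\<^sup>2 * D)) (at y)"
      by (subst (asm) tendsto_cong[OF eventually_mono[OF ev]]) auto
    then show "(w has_real_derivative D) (at y)"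
      using y by (simp add: has_field_derivative_iff power2_eq_square)
  qed
qed

lemma wtail_isCont:
  assumes k: "k \<in> borel_measurable borel" "\<And>z. \<bar>k z\<bar> \<le> C" and y: "0 < y"
  shows "isCont (wtail k) y"
proof -
  have ev: "\<forall>\<^sub>F x in at y. 0 < x \<and> x \<noteq> y"
    using order_tendstoD(1)[OF tendsto_ident_at y, of UNIV] by (auto simp: eventually_at_filter elim: eventually_mono)
  have "((\<lambda>x. wtail k x - wtail k y) \<longlongrightarrow> 0) (at y)"
  proof (rule Lim_null_comparison)
    show "((\<lambda>x. C * \<bar>1 / x - 1 / y\<bar>) \<longlongrightarrow> 0) (at y)"
      using y by (auto intro!: tendsto_eq_intros)
    show "\<forall>\<^sub>F x in at y. norm (wtail k x - wtail k y) \<le> C * \<bar>1 / x - 1 / y\<bar>"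
      using ev
    proof eventually_elim
      case (elim x)
      have b: "- C \<le> k z" "k z \<le> C" for z using abs_le_D1[OF k(2)] abs_le_D2[OF k(2), of z] by auto
      have "\<bar>(wtail k x - wtail k y) / (1 / x - 1 / y)\<bar> \<le> C"
        using wtail_slope_bounds[OF k _ y, of x "- C" C] elim b by (intro abs_leI) auto
      moreover have "1 / x - 1 / y \<noteq> 0" using elim y by auto
      then have pos: "0 < \<bar>1 / x - 1 / y\<bar>" by simp
      ultimately show ?case
        unfolding abs_divide real_norm_def pos_divide_le_eq[OF pos] by simp
    qed
  qed
  then show ?thesis by (simp add: isCont_def LIM_zero_iff)
qed

lemma wtail_has_derivative:
  assumes k: "k \<in> borel_measurable borel" "\<And>z. \<bar>k z\<bar> \<le> C" and y: "0 < y" and cont: "isCont k y"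
  shows "(wtail k has_real_derivative - k y / y\<^sup>2) (at y)"
  unfolding derivative_iff_slope[OF y]
proof (rule tendstoI)
  fix e :: real assume e: "0 < e"
  obtain d where d: "0 < d" "\<And>z. dist z y < d \<Longrightarrow> dist (k z) (k y) < e / 2"
    using cont e unfolding continuous_at_eps_delta by (metis half_gt_zero)
  have "\<forall>\<^sub>F x in at y. dist x y < min d y \<and> x \<noteq> y"
    using d(1) y by (auto simp: eventually_at intro!: exI[of _ "min d y"])
  then show "\<forall>\<^sub>F x in at y. dist ((wtail k x - wtail k y) / (1 / x - 1 / y)) (- (y\<^sup>2 * (- k y / y\<^sup>2))) < e"
  proof eventually_elim
    case (elim x)
    then have x: "0 < x" "x \<noteq> y" by (auto simp: dist_real_def)
    have "\<bar>k z - k y\<bar> < e / 2" if "min x y \<le> z" "z \<le> max x y" for z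
      using d(2)[of z] that elim d(1) by (auto simp: dist_real_def min_def max_def split: if_splits)
    then have "\<And>z. min x y \<le> z \<Longrightarrow> z \<le> max x y \<Longrightarrow> k y - e / 2 \<le> k z"
      "\<And>z. min x y \<le> z \<Longrightarrow> z \<le> max x y \<Longrightarrow> k z \<le> k y + e / 2"
      by (smt (verit, best))+
    from wtail_slope_bounds[OF k x(1) y x(2) this]
    show ?case using e y by (auto simp: dist_real_def abs_less_iff)
  qed
qed

text \<open>For monotone \<open>k\<close> the averages over \<open>(y, x)\<close> are at least \<open>k y\<close> and those over \<open>(x, y)\<close> at most \<open>k y\<close>.
  If they have a common limit, it must be \<open>k y\<close>: a two-sided derivative of the tail integral determines \<open>k\<close>
  at every point and rules out jumps.\<close>

lemma mono_eq_wtail_derivative: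
  assumes k: "mono k" "\<And>z. \<bar>k z\<bar> \<le> C" and y: "0 < y" and der: "(wtail k has_real_derivative D) (at y)"
  shows "k y = - (y\<^sup>2 * D)"
proof -
  have km: "k \<in> borel_measurable borel" by (rule borel_measurable_mono[OF k(1)])
  have b: "- C \<le> k z" "k z \<le> C" for z using abs_le_D1[OF k(2)] abs_le_D2[OF k(2), of z] by auto
  have lim: "((\<lambda>x. (wtail k x - wtail k y) / (1 / x - 1 / y)) \<longlongrightarrow> - (y\<^sup>2 * D)) (at y)"
    using der unfolding derivative_iff_slope[OF y] .
  have "k y \<le> - (y\<^sup>2 * D)"
  proof (rule tendsto_lowerbound)
    show "((\<lambda>x. (wtail k x - wtail k y) / (1 / x - 1 / y)) \<longlongrightarrow> - (y\<^sup>2 * D)) (at_right y)"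
      using lim by (rule filterlim_mono) (auto simp: at_within_le_at)
    show "\<forall>\<^sub>F x in at_right y. k y \<le> (wtail k x - wtail k y) / (1 / x - 1 / y)"
      using eventually_at_right_less[of y]
    proof eventually_elim
      case (elim x)
      then show ?case
        using wtail_slope_bounds(1)[OF km k(2), of x y "k y" C] k(1) b y by (auto simp: mono_def)
    qed
  qed simp
  moreover have "- (y\<^sup>2 * D) \<le> k y"
  proof (rule tendsto_upperbound)
    show "((\<lambda>x. (wtail k x - wtail k y) / (1 / x - 1 / y)) \<longlongrightarrow> - (y\<^sup>2 * D)) (at_left y)"
      using lim by (rule filterlim_mono) (auto simp: at_within_le_at)
    show "\<forall>\<^sub>F x in at_left y. (wtail k x - wtail k y) / (1 / x - 1 / y) \<le> k y"
      using eventually_at_left_real[OF y]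
    proof eventually_elim
      case (elim x)
      then show ?case
        using wtail_slope_bounds(2)[OF km k(2), of x y "- C" "k y"] k(1) b y by (auto simp: mono_def)
    qed
  qed simp
  ultimately show ?thesis by simp
qed

section \<open>The norm with weight \<open>x\<^sup>-\<^sup>2\<close>\<close>

lemma norm_x2_minus_commute: "norm_x2 (\<lambda>x. f x - g x) = norm_x2 (\<lambda>x. g x - f x)"
  unfolding norm_x2_def by (simp add: abs_minus_commute)

lemma norm_x2_triangle:
  assumes [measurable]: "f \<in> borel_measurable borel" "g \<in> borel_measurable borel" "h \<in> borel_measurable borel"
  shows "norm_x2 (\<lambda>x. f x - h x) \<le> norm_x2 (\<lambda>x. f x - g x) + norm_x2 (\<lambda>x. g x - h x)"
proof -
  have "norm_x2 (\<lambda>x. f x - h x) \<le> (\<integral>\<^sup>+x. ennreal (\<bar>f x - g x\<bar> / x\<^sup>2) * indicator {0<..} x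
      + ennreal (\<bar>g x - h x\<bar> / x\<^sup>2) * indicator {0<..} x \<partial>lborel)"
    unfolding norm_x2_def
    by (intro nn_integral_mono)
      (auto simp: indicator_def ennreal_plus[symmetric] add_divide_distrib[symmetric]
        simp del: ennreal_plus intro!: ennreal_leI divide_right_mono)
  also have "\<dots> = norm_x2 (\<lambda>x. f x - g x) + norm_x2 (\<lambda>x. g x - h x)"
    unfolding norm_x2_def by (intro nn_integral_add) measurable
  finally show ?thesis .
qed

lemma norm_x2_scale:
  assumes [measurable]: "f \<in> borel_measurable borel" and "0 < c"
  shows "norm_x2 (\<lambda>x. f (c * x)) = ennreal c * norm_x2 f"
proof -
  have "norm_x2 f = \<bar>c\<bar> * (\<integral>\<^sup>+x. ennreal (\<bar>f (0 + c * x)\<bar> / (0 + c * x)\<^sup>2) * indicator {0<..} (0 + c * x) \<partial>lborel)"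
    unfolding norm_x2_def using assms(2) by (intro nn_integral_real_affine) auto
  also have "(\<integral>\<^sup>+x. ennreal (\<bar>f (0 + c * x)\<bar> / (0 + c * x)\<^sup>2) * indicator {0<..} (0 + c * x) \<partial>lborel)
    = (\<integral>\<^sup>+x. ennreal (1 / c\<^sup>2) * (ennreal (\<bar>f (c * x)\<bar> / x\<^sup>2) * indicator {0<..} x) \<partial>lborel)"
    using assms(2)
    by (intro nn_integral_cong) (auto simp: indicator_def ennreal_mult[symmetric] power_mult_distrib zero_less_mult_iff)
  also have "\<dots> = ennreal (1 / c\<^sup>2) * norm_x2 (\<lambda>x. f (c * x))"
    unfolding norm_x2_def by (intro nn_integral_cmult) measurable
  finally have "ennreal c * norm_x2 f
      = (ennreal c * (ennreal c * ennreal (1 / c\<^sup>2))) * norm_x2 (\<lambda>x. f (c * x))"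
    using assms(2) by (simp add: mult.assoc)
  also have "ennreal c * (ennreal c * ennreal (1 / c\<^sup>2)) = 1"
    using assms(2) by (simp add: ennreal_mult[symmetric] power2_eq_square)
  finally show ?thesis by simp
qed

text \<open>Fatou's lemma.\<close>

lemma norm_x2_le_limit:
  assumes [measurable]: "\<And>n. u n \<in> borel_measurable borel" "l \<in> borel_measurable borel"
    and lim: "AE x in lborel. 0 < x \<longrightarrow> (\<lambda>n::nat. u n x) \<longlonglongrightarrow> l x"
    and le: "\<forall>\<^sub>F n in sequentially. norm_x2 (u n) \<le> C"
  shows "norm_x2 l \<le> C"
proof -
  have "norm_x2 l \<le> (\<integral>\<^sup>+x. liminf (\<lambda>n. ennreal (\<bar>u n x\<bar> / x\<^sup>2) * indicator {0<..} x) \<partial>lborel)"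
    unfolding norm_x2_def
  proof (rule nn_integral_mono_AE)
    show "AE x in lborel. ennreal (\<bar>l x\<bar> / x\<^sup>2) * indicator {0<..} x
        \<le> liminf (\<lambda>n. ennreal (\<bar>u n x\<bar> / x\<^sup>2) * indicator {0<..} x)"
      using lim
    proof eventually_elim
      case (elim x)
      show ?case
      proof (cases "0 < x")
        case True
        have "(\<lambda>n. ennreal (\<bar>u n x\<bar> / x\<^sup>2)) \<longlonglongrightarrow> ennreal (\<bar>l x\<bar> / x\<^sup>2)"
          using elim True by (intro tendsto_intros) auto
        then have "liminf (\<lambda>n. ennreal (\<bar>u n x\<bar> / x\<^sup>2)) = ennreal (\<bar>l x\<bar> / x\<^sup>2)"
          by (rule lim_imp_Liminf[rotated]) simp
        then show ?thesis using True by simp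
      qed simp
    qed
  qed
  also have "\<dots> \<le> liminf (\<lambda>n. norm_x2 (u n))"
    unfolding norm_x2_def by (rule nn_integral_liminf) measurable
  also have "\<dots> \<le> limsup (\<lambda>n. norm_x2 (u n))" by (rule Liminf_le_Limsup) simp
  also have "\<dots> \<le> C" by (rule Limsup_bounded[OF le])
  finally show ?thesis .
qed

text \<open>Only bounds over \<open>[a, b]\<close> with large \<open>b\<close> are required, because the estimates to which this is applied
  improve with \<open>b\<close>.\<close>

lemma norm_x2_le_intervals:
  assumes [measurable]: "f \<in> borel_measurable borel"
    and le: "\<And>a b. 0 < a \<Longrightarrow> a \<le> b \<Longrightarrow> N \<le> b \<Longrightarrow> (\<integral>\<^sup>+x\<in>{a..b}. ennreal (\<bar>f x\<bar> / x\<^sup>2) \<partial>lborel) \<le> C"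
  shows "norm_x2 f \<le> C"
proof (rule norm_x2_le_limit)
  let ?a = "\<lambda>n::nat. 1 / real (Suc n)" and ?b = "\<lambda>n::nat. real (Suc n) + \<bar>N\<bar>"
  let ?u = "\<lambda>n x. f x * indicator {?a n..?b n} x"
  show "?u n \<in> borel_measurable borel" for n by measurable
  have ab: "0 < ?a n" "?a n \<le> ?b n" "N \<le> ?b n" for n
    using divide_le_eq_1[of 1 "real (Suc n)"] by (auto intro: order_trans[of _ 1])
  show "\<forall>\<^sub>F n in sequentially. norm_x2 (?u n) \<le> C"
  proof (intro always_eventually allI)
    fix n
    have "0 < x" if "x \<in> {?a n..?b n}" for x using that ab(1)[of n] by (metis atLeastAtMost_iff less_le_trans)
    then have "norm_x2 (?u n) = (\<integral>\<^sup>+x\<in>{?a n..?b n}. ennreal (\<bar>f x\<bar> / x\<^sup>2) \<partial>lborel)"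
      unfolding norm_x2_def
      by (intro nn_integral_cong) (simp add: indicator_def)
    also have "\<dots> \<le> C" by (rule le[OF ab])
    finally show "norm_x2 (?u n) \<le> C" .
  qed
  show "AE x in lborel. 0 < x \<longrightarrow> (\<lambda>n. ?u n x) \<longlonglongrightarrow> f x"
  proof (intro AE_I2 impI tendsto_eventually)
    fix x :: real assume x: "0 < x"
    have "\<forall>\<^sub>F n in sequentially. ?a n < x"
      using order_tendstoD(2)[OF LIMSEQ_inverse_real_of_nat x] by (simp add: inverse_eq_divide)
    moreover have "\<forall>\<^sub>F n in sequentially. x < real n"
      using filterlim_real_sequentially by (simp add: filterlim_at_top_dense)
    ultimately show "\<forall>\<^sub>F n in sequentially. ?u n x = f x"
      by eventually_elim (auto simp: indicator_def)
  qed
qed simp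

text \<open>The sum over \<open>n\<close> of the differences has finite weighted integral, hence is finite almost everywhere.\<close>

lemma AE_tendsto_of_summable_norm_x2:
  assumes [measurable]: "\<And>n. u n \<in> borel_measurable borel" "l \<in> borel_measurable borel"
    and le: "\<And>n. norm_x2 (\<lambda>x. u n x - l x) \<le> ennreal (c n)" and c: "summable c" "\<And>n. 0 \<le> c n"
  shows "AE x in lborel. 0 < x \<longrightarrow> (\<lambda>n::nat. u n x) \<longlonglongrightarrow> l x"
proof -
  define g where "g n x = \<bar>u n x - l x\<bar> / x\<^sup>2 * indicator {0<..} x" for n x
  have [measurable]: "g n \<in> borel_measurable borel" for n unfolding g_def by measurable
  have g0: "0 \<le> g n x" for n x by (simp add: g_def)
  have "(\<integral>\<^sup>+x. (\<Sum>n. ennreal (g n x)) \<partial>lborel) = (\<Sum>n. \<integral>\<^sup>+x. ennreal (g n x) \<partial>lborel)"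
    by (rule nn_integral_suminf) measurable
  also have "(\<lambda>n. \<integral>\<^sup>+x. ennreal (g n x) \<partial>lborel) = (\<lambda>n. norm_x2 (\<lambda>x. u n x - l x))"
    unfolding norm_x2_def g_def by (intro ext nn_integral_cong) (auto simp: indicator_def)
  also have "(\<Sum>n. norm_x2 (\<lambda>x. u n x - l x)) \<le> (\<Sum>n. ennreal (c n))"
    by (intro suminf_le le summableI)
  also have "\<dots> < top" using ennreal_suminf_neq_top[OF c] by (simp add: less_top)
  finally have "AE x in lborel. (\<Sum>n. ennreal (g n x)) \<noteq> \<infinity>"
    by (intro nn_integral_PInf_AE) auto
  then show ?thesis
  proof eventually_elim
    case (elim x)
    show ?case
    proof
      assume x: "0 < x"
      have "summable (\<lambda>n. g n x)" using g0 elim by (intro summable_suminf_not_top) (auto simp: top_ennreal_def)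
      then have "(\<lambda>n. x\<^sup>2 * g n x) \<longlonglongrightarrow> x\<^sup>2 * 0" by (intro tendsto_intros summable_LIMSEQ_zero)
      then have "(\<lambda>n. \<bar>u n x - l x\<bar>) \<longlonglongrightarrow> 0" using x by (simp add: g_def)
      then show "(\<lambda>n. u n x) \<longlonglongrightarrow> l x" by (simp add: LIM_zero_iff tendsto_rabs_zero_iff)
    qed
  qed
qed

section \<open>Functions in \<open>\<D>\<^sub>1\<close>\<close>

lemma AE_lborel_in_interval:
  fixes a b :: real
  assumes "AE x in lborel. P x" "a < b"
  obtains y where "a < y" "y < b" "P y"
proof -
  have "\<exists>y. a < y \<and> y < b \<and> P y"
  proof (rule ccontr)
    assume "\<nexists>y. a < y \<and> y < b \<and> P y"
    then have "AE x in lborel. x \<notin> {a<..<b}"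
      using assms(1) by (auto elim!: eventually_mono)
    then have "{a<..<b} \<in> null_sets lborel" by (subst AE_iff_null_sets) auto
    then show False using assms(2) by (simp add: null_sets_def ennreal_eq_0_iff)
  qed
  then show ?thesis using that by blast
qed

lemma right_limit_sequence:
  assumes "continuous (at_right (x :: real)) (F :: real \<Rightarrow> real)" "\<And>n. x < u n" "u \<longlonglongrightarrow> x"
  shows "(\<lambda>n. F (u n)) \<longlonglongrightarrow> F x"
proof -
  have "filterlim u (at_right x) sequentially"
    unfolding filterlim_at using assms(2,3) by (auto simp: less_imp_neq[symmetric])
  then show ?thesis
    using assms(1) unfolding continuous_within by (rule filterlim_compose[rotated])
qed

text \<open>Monotonicity bounds \<open>F\<close> from below by \<open>F x\<close> on \<open>[x, 2 x]\<close>, which alone contributes at least \<open>F x / (4 x)\<close> to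
  the norm.  In particular \<open>F\<close> vanishes at \<open>0\<close>, so its Stieltjes measure has no atom there.\<close>

lemma D1_linear_bound:
  assumes F: "F \<in> \<D>\<^sub>1" and x: "0 < x"
  shows "F x \<le> 4 * x"
proof -
  have mono: "mono_on {0..} F" and img: "F ` {0..} \<subseteq> {0..1}" and norm: "norm_x2 F \<le> 1"
    using F by (auto simp: cal_D1_def cal_D_def)
  have rng: "0 \<le> F x" using img x by (auto simp: image_subset_iff)
  have "ennreal (F x / (4 * x)) = (\<integral>\<^sup>+z. ennreal (F x / (4 * x\<^sup>2)) * indicator {x..2 * x} z \<partial>lborel)"
    using x rng by (simp add: nn_integral_cmult_indicator ennreal_mult[symmetric] power2_eq_square)
  also have "\<dots> \<le> norm_x2 F"
    unfolding norm_x2_def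
  proof (intro nn_integral_mono)
    fix z
    have "F x / (4 * x\<^sup>2) \<le> \<bar>F z\<bar> / z\<^sup>2" if "x \<le> z" "z \<le> 2 * x"
    proof (rule frac_le)
      have "F x \<le> F z" using mono that x by (auto simp: mono_on_def)
      then show "F x \<le> \<bar>F z\<bar>" by simp
      have "z\<^sup>2 \<le> (2 * x)\<^sup>2" using that x by (intro power_mono) auto
      then show "z\<^sup>2 \<le> 4 * x\<^sup>2" by (simp add: power_mult_distrib)
    qed (use that x rng in auto)
    then show "ennreal (F x / (4 * x\<^sup>2)) * indicator {x..2 * x} z \<le> ennreal (\<bar>F z\<bar> / z\<^sup>2) * indicator {0<..} z"
      using x by (auto simp: indicator_def intro!: ennreal_leI)
  qed
  also have "\<dots> \<le> ennreal 1" using norm by simp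
  finally have "F x / (4 * x) \<le> 1" by (subst (asm) ennreal_le_iff) auto
  then show ?thesis using x by simp
qed

lemma D1_nonpos:
  assumes F: "F \<in> \<D>\<^sub>1" and "x \<le> 0"
  shows "F x = 0"
proof (cases "x = 0")
  case True
  have m: "mono_on {0..} F" and "0 \<le> F 0" using F by (auto simp: cal_D1_def cal_D_def)
  have "F 0 \<le> 0 + e" if "0 < e" for e
  proof -
    have "F 0 \<le> F (e / 4)" using m that by (auto simp: mono_on_def)
    then show ?thesis using D1_linear_bound[OF F, of "e / 4"] that by simp
  qed
  then have "F 0 \<le> 0" by (rule field_le_epsilon)
  then show ?thesis using \<open>0 \<le> F 0\<close> True by simp
qed (use assms in \<open>auto simp: cal_D1_def cal_D_def\<close>)

lemma D1_range:
  assumes F: "F \<in> \<D>\<^sub>1" shows "0 \<le> F x" "F x \<le> 1"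
proof -
  have "F x \<in> {0..1}"
  proof (cases "0 \<le> x")
    case True
    have "F ` {0..} \<subseteq> {0..1}" using F by (simp add: cal_D1_def cal_D_def)
    then show ?thesis using True by (auto simp: image_subset_iff)
  qed (use D1_nonpos[OF F, of x] in simp)
  then show "0 \<le> F x" "F x \<le> 1" by simp_all
qed

lemma D1_mono:
  assumes "F \<in> \<D>\<^sub>1" shows "mono F"
proof (rule monoI)
  fix x y :: real assume "x \<le> y"
  then show "F x \<le> F y"
    using D1_nonpos[OF assms, of x] D1_range[OF assms, of y] assms
    by (cases "x \<le> 0") (auto simp: cal_D1_def cal_D_def mono_on_def)
qed

lemma D1_measurable: "F \<in> \<D>\<^sub>1 \<Longrightarrow> F \<in> borel_measurable borel"
  by (intro borel_measurable_mono D1_mono)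

lemma D1_right_continuous:
  assumes "F \<in> \<D>\<^sub>1" shows "continuous (at_right x) F"
proof (cases "0 \<le> x")
  case False
  have "\<forall>\<^sub>F y in at_right x. F y = 0"
    using eventually_at_right_real[of x 0] False D1_nonpos[OF assms]
    by (auto elim!: eventually_mono)
  then have "(F \<longlongrightarrow> 0) (at_right x)" by (rule tendsto_eventually)
  then show ?thesis using D1_nonpos[OF assms, of x] False by (simp add: continuous_within)
qed (use assms in \<open>auto simp: cal_D1_def cal_D_def is_cadlag_def\<close>)

lemma D1_I:
  assumes "mono F" "\<And>x. 0 \<le> x \<Longrightarrow> continuous (at_right x) F" "\<And>x. 0 \<le> F x" "\<And>x. F x \<le> 1"
    "\<And>x. x < 0 \<Longrightarrow> F x = 0" "norm_x2 F \<le> 1"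
  shows "F \<in> \<D>\<^sub>1"
proof -
  have "\<exists>l. (F \<longlongrightarrow> l) (at_left x)" for x
    using Lim_left_bound[of UNIV x F 1] assms(1,4) by (auto simp: mono_def)
  then show ?thesis
    using assms by (auto simp: cal_D1_def cal_D_def is_cadlag_def mono_def intro: mono_onI)
qed

lemma D1_norm_difference:
  assumes "F \<in> \<D>\<^sub>1" "G \<in> \<D>\<^sub>1"
  shows "norm_x2 (\<lambda>x. F x - G x) \<le> ennreal 2"
proof -
  have "norm_x2 (\<lambda>x. F x - G x) \<le> norm_x2 (\<lambda>x. F x - 0) + norm_x2 (\<lambda>x. 0 - G x)"
    by (rule norm_x2_triangle[OF D1_measurable[OF assms(1)] _ D1_measurable[OF assms(2)]]) simp
  also have "\<dots> \<le> 1 + 1"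
    using assms norm_x2_minus_commute[of "\<lambda>_. 0" G] by (intro add_mono) (simp_all add: cal_D1_def)
  finally show ?thesis by simp
qed

text \<open>The two functions agree almost everywhere, hence along a sequence decreasing to any given point.\<close>

lemma D1_eqI:
  assumes F: "F \<in> \<D>\<^sub>1" and G: "G \<in> \<D>\<^sub>1" and z: "norm_x2 (\<lambda>x. F x - G x) = 0"
  shows "F = G"
proof
  fix x
  note [measurable] = D1_measurable[OF F] D1_measurable[OF G]
  show "F x = G x"
  proof (cases "0 \<le> x")
    case True
    have "AE x in lborel. ennreal (\<bar>F x - G x\<bar> / x\<^sup>2) * indicator {0<..} x = 0"
      using z unfolding norm_x2_def by (subst (asm) nn_integral_0_iff_AE) auto
    then have AE: "AE x in lborel. 0 < x \<longrightarrow> F x = G x"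
      by eventually_elim (auto simp: indicator_def ennreal_eq_0_iff divide_le_0_iff split: if_splits)
    have "\<exists>u. x < u \<and> u < x + 1 / real (Suc n) \<and> F u = G u" for n
      by (rule AE_lborel_in_interval[OF AE, of x "x + 1 / real (Suc n)"]) (use True in auto)
    then obtain u where u: "\<And>n. x < u n" "\<And>n. u n < x + 1 / real (Suc n)" "\<And>n. F (u n) = G (u n)" by metis
    have "(\<lambda>n. x + 1 / real (Suc n)) \<longlonglongrightarrow> x"
      using tendsto_add[OF tendsto_const LIMSEQ_inverse_real_of_nat, of x] by (simp add: inverse_eq_divide)
    then have ul: "u \<longlonglongrightarrow> x"
      by (rule tendsto_sandwich[OF always_eventually always_eventually tendsto_const, rotated 2])
        (use u less_imp_le in blast)+
    show ?thesis
      using LIMSEQ_unique[OF right_limit_sequence[OF D1_right_continuous[OF F] u(1) ul]]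
        right_limit_sequence[OF D1_right_continuous[OF G] u(1) ul] by (simp add: u(3))
  qed (use D1_nonpos[OF F] D1_nonpos[OF G] in auto)
qed

section \<open>Lebesgue-Stieltjes measures\<close>

text \<open>Tonelli applied to \<open>1 / z = \<integral>\<^bsub>[z,\<infinity>)\<^esub> 1 / w\<^sup>2 dw\<close>.  The case \<open>y = 0\<close> says that \<open>x\<^sup>-\<^sup>1 dG\<close> has as total mass the
  weighted norm of \<open>G - G 0\<close>.\<close>

lemma nn_integral_stieltjes_tail:
  assumes mono: "\<And>x y. x \<le> y \<Longrightarrow> G x \<le> G y" and rc: "\<And>x. continuous (at_right x) G" and y: "0 \<le> y"
  shows "(\<integral>\<^sup>+z\<in>{y<..}. ennreal (1 / z) \<partial>interval_measure G) = (\<integral>\<^sup>+w\<in>{y<..}. ennreal ((G w - G y) / w\<^sup>2) \<partial>lborel)"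
proof -
  let ?\<mu> = "interval_measure G"
  interpret sigma_finite_measure ?\<mu> by (rule sigma_finite_interval_measure[OF mono rc])
  interpret pair_sigma_finite lborel ?\<mu> by unfold_locales
  define h :: "real \<Rightarrow> real \<Rightarrow> ennreal" where
    "h w z = (if y < z \<and> z \<le> w then ennreal (1 / w\<^sup>2) else 0)" for w z
  have [measurable]: "(\<lambda>(w, z). h w z) \<in> borel_measurable (lborel \<Otimes>\<^sub>M ?\<mu>)"
    unfolding h_def by measurable
  have "(\<integral>\<^sup>+z\<in>{y<..}. ennreal (1 / z) \<partial>?\<mu>) = (\<integral>\<^sup>+z. (\<integral>\<^sup>+w. h w z \<partial>lborel) \<partial>?\<mu>)"
  proof (rule nn_integral_cong)
    fix z
    have "(\<integral>\<^sup>+w. h w z \<partial>lborel) = ennreal (1 / z)" if "y < z"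
    proof -
      have "(\<integral>\<^sup>+w. h w z \<partial>lborel) = (\<integral>\<^sup>+w\<in>{z<..}. ennreal (1 / w\<^sup>2) \<partial>lborel)"
      proof (rule nn_integral_cong_AE)
        show "AE w in lborel. h w z = ennreal (1 / w\<^sup>2) * indicator {z<..} w"
          using AE_lborel_singleton[of z]
          by eventually_elim (use that in \<open>auto simp: indicator_def h_def\<close>)
      qed
      then show ?thesis using that y by (simp add: nn_integral_inverse_square_tail)
    qed
    then show "ennreal (1 / z) * indicator {y<..} z = (\<integral>\<^sup>+w. h w z \<partial>lborel)"
      by (cases "y < z") (auto simp: h_def)
  qed
  also have "\<dots> = (\<integral>\<^sup>+w. (\<integral>\<^sup>+z. h w z \<partial>?\<mu>) \<partial>lborel)"
    by (rule Fubini') measurable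
  also have "\<dots> = (\<integral>\<^sup>+w\<in>{y<..}. ennreal ((G w - G y) / w\<^sup>2) \<partial>lborel)"
  proof (rule nn_integral_cong)
    fix w
    have "(\<integral>\<^sup>+z. h w z \<partial>?\<mu>) = (\<integral>\<^sup>+z. ennreal (1 / w\<^sup>2) * indicator {y<..w} z \<partial>?\<mu>)"
      by (intro nn_integral_cong) (auto simp: h_def indicator_def)
    also have "\<dots> = ennreal (1 / w\<^sup>2) * emeasure ?\<mu> {y<..w}"
      by (rule nn_integral_cmult_indicator) simp
    also have "\<dots> = ennreal ((G w - G y) / w\<^sup>2) * indicator {y<..} w"
      using mono[of y w]
      by (auto simp: emeasure_interval_measure_Ioc_eq[OF mono rc] indicator_def ennreal_mult[symmetric])
    finally show "(\<integral>\<^sup>+z. h w z \<partial>?\<mu>) = ennreal ((G w - G y) / w\<^sup>2) * indicator {y<..} w" .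
  qed
  finally show ?thesis .
qed

lemma stieltjes_tail_eq_wtail:
  assumes mono: "\<And>x y. x \<le> y \<Longrightarrow> G x \<le> G y" and rc: "\<And>x. continuous (at_right x) G"
    and b: "\<And>x. \<bar>G x\<bar> \<le> C" and y: "0 < y"
  shows "(LINT z:{y<..}|interval_measure G. 1 / z) = wtail G y - G y / y"
proof -
  have [measurable]: "G \<in> borel_measurable borel" using mono by (intro borel_measurable_mono monoI)
  have "(LINT z:{y<..}|interval_measure G. 1 / z)
      = enn2real (\<integral>\<^sup>+z. ennreal (indicator {y<..} z *\<^sub>R (1 / z)) \<partial>interval_measure G)"
    unfolding set_lebesgue_integral_def
    by (rule integral_eq_nn_integral) (use y in \<open>auto simp: indicator_def\<close>)
  also have "(\<integral>\<^sup>+z. ennreal (indicator {y<..} z *\<^sub>R (1 / z)) \<partial>interval_measure G) = (\<integral>\<^sup>+z\<in>{y<..}. ennreal (1 / z) \<partial>interval_measure G)"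
    by (intro nn_integral_cong) (auto simp: indicator_def)
  also have "\<dots> = (\<integral>\<^sup>+w\<in>{y<..}. ennreal ((G w - G y) / w\<^sup>2) \<partial>lborel)"
    using y by (intro nn_integral_stieltjes_tail mono rc) auto
  also have "\<dots> = (\<integral>\<^sup>+w. ennreal (indicator {y<..} w *\<^sub>R ((G w - G y) / w\<^sup>2)) \<partial>lborel)"
    by (intro nn_integral_cong) (auto simp: indicator_def)
  also have "enn2real \<dots> = wtail (\<lambda>w. G w - G y) y"
    unfolding wtail_def set_lebesgue_integral_def
    by (rule integral_eq_nn_integral[symmetric]) (use mono in \<open>auto simp: indicator_def\<close>)
  also have "\<dots> = wtail G y - wtail (\<lambda>_. G y) y"
    by (rule wtail_diff) (use b y in auto)
  finally show ?thesis using y by (simp add: wtail_const)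
qed

lemma stieltjes_measure_D1:
  assumes L: "L \<in> \<D>\<^sub>1" and top: "(L \<longlongrightarrow> 1) at_top"
  shows "real_distribution (interval_measure L)" "cdf (interval_measure L) = L"
    "AE x in interval_measure L. 0 < x" "measure (interval_measure L) {0..} = 1"
proof -
  have mono: "L x \<le> L y" if "x \<le> y" for x y using D1_mono[OF L] that by (rule monoD)
  have bot: "(L \<longlongrightarrow> 0) at_bot"
    by (rule tendsto_eventually[OF eventually_mono[OF eventually_le_at_bot[of 0]]]) (rule D1_nonpos[OF L])
  show rd: "real_distribution (interval_measure L)"
    by (rule real_distribution_interval_measure[OF mono D1_right_continuous[OF L] bot top])
  then interpret real_distribution "interval_measure L" .
  show cdf: "cdf (interval_measure L) = L"
    by (rule cdf_interval_measure[OF mono D1_right_continuous[OF L] bot])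
  have "measure (interval_measure L) {..0} = 0"
    using fun_cong[OF cdf, of 0] D1_nonpos[OF L, of 0] by (simp add: cdf_def)
  then have "{..0} \<in> null_sets (interval_measure L)"
    by (simp add: null_sets_def emeasure_eq_measure)
  from AE_not_in[OF this] show pos: "AE x in interval_measure L. 0 < x" by eventually_elim auto
  have "AE x in interval_measure L. x \<in> {0..}" using pos by eventually_elim auto
  then show "measure (interval_measure L) {0..} = 1" by (subst prob_eq_1) auto
qed

section \<open>Joint measurability of evolutions\<close>

lemma D1_subset_L1_loc: "\<D>\<^sub>1 \<subseteq> L1_loc"
  unfolding L1_loc_def
proof safe
  fix F :: "real \<Rightarrow> real" and N :: real assume "F \<in> \<D>\<^sub>1"
  then show "set_integrable lborel {0..N} F"
    using D1_range[of F] by (intro set_integrable_bounded_Icc[where K=1] D1_measurable) auto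
qed

lemma evolution_in_D1:
  assumes "F \<in> \<X>\<^sub>1" "0 \<le> t" shows "F t \<in> \<D>\<^sub>1"
proof -
  have "F t \<in> space (borel_of (subtopology L1_loc_topology \<D>\<^sub>1))"
    using assms(1) unfolding measurable_evolutions_def
    by (rule measurable_space) (use assms(2) in \<open>simp add: space_restrict_space\<close>)
  then show ?thesis by (auto simp: borel_of_def space_measure_of_conv)
qed

text \<open>Integration over \<open>[a, b]\<close> is continuous for \<open>L\<^sup>1\<close> convergence on compacts.\<close>

lemma evolution_average_measurable:
  assumes F: "F \<in> \<X>\<^sub>1" and ab: "0 \<le> a" "a \<le> b"
  shows "(\<lambda>t. LINT x:{a..b}|lborel. F t x) \<in> borel_measurable (restrict_space borel {0..})"
  unfolding borel_measurable_iff_greater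
proof
  fix c
  define U where "U = {f \<in> L1_loc. c < (LINT x:{a..b}|lborel. f x)}"
  have "openin L1_loc_topology U"
    unfolding openin_L1_loc_topology
  proof (intro conjI ballI)
    fix f assume f: "f \<in> U"
    have "g \<in> U" if g: "g \<in> L1_loc" "L1_dist (b + 1) f g < (LINT x:{a..b}|lborel. f x) - c" for g
    proof -
      have i: "set_integrable lborel {0..b + 1} f" "set_integrable lborel {0..b + 1} g"
        using f g unfolding U_def L1_loc_def by blast+
      have j: "set_integrable lborel {a..b} f" "set_integrable lborel {a..b} g"
        by (rule set_integrable_subset[OF i(1)] set_integrable_subset[OF i(2)]; use ab in auto)+
      have "(LINT x:{a..b}|lborel. f x) - (LINT x:{a..b}|lborel. g x) = (LINT x:{a..b}|lborel. f x - g x)"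
        using j by (simp add: set_integral_diff)
      also have "\<dots> \<le> (LINT x:{0..b + 1}|lborel. \<bar>f x - g x\<bar>)"
        unfolding set_lebesgue_integral_def
        using set_integral_diff(1)[OF j] set_integrable_abs[OF set_integral_diff(1)[OF i]] ab
        by (intro integral_mono) (auto simp: indicator_def set_integrable_def)
      finally show ?thesis using g unfolding U_def L1_dist_def by simp
    qed
    moreover have "0 < (LINT x:{a..b}|lborel. f x) - c" using f by (simp add: U_def)
    ultimately show "\<exists>N>0. \<exists>e>0. \<forall>g\<in>L1_loc. L1_dist N f g < e \<longrightarrow> g \<in> U"
      using ab by (intro exI[of _ "b + 1"]) (auto intro!: exI[of _ "(LINT x:{a..b}|lborel. f x) - c"])
  qed (auto simp: U_def)
  then have "openin (subtopology L1_loc_topology \<D>\<^sub>1) (U \<inter> \<D>\<^sub>1)"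
    by (auto simp: openin_subtopology)
  then have "U \<inter> \<D>\<^sub>1 \<in> sets (borel_of (subtopology L1_loc_topology \<D>\<^sub>1))"
    unfolding borel_of_def
    by (subst sets_measure_of) (use openin_subset in \<open>blast intro: sigma_sets.Basic\<close>)+
  from measurable_sets[OF F[unfolded measurable_evolutions_def] this]
  have "F -` (U \<inter> \<D>\<^sub>1) \<inter> {0..} \<in> sets (restrict_space borel {0..})"
    by (simp add: space_restrict_space)
  also have "F -` (U \<inter> \<D>\<^sub>1) \<inter> {0..} = {w \<in> space (restrict_space borel {0..}). c < (LINT x:{a..b}|lborel. F w x)}"
    using evolution_in_D1[OF F] D1_subset_L1_loc by (auto simp: U_def space_restrict_space)
  finally show "{w \<in> space (restrict_space borel {0..}). c < (LINT x:{a..b}|lborel. F w x)} \<in> sets (restrict_space borel {0..})" .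
qed

text \<open>By right continuity the value at \<open>x\<close> is the limit of the averages over shrinking intervals to the right
  of \<open>x\<close>.\<close>

lemma evolution_value_measurable:
  assumes F: "F \<in> \<X>\<^sub>1"
  shows "(\<lambda>t. F t x) \<in> borel_measurable (restrict_space borel {0..})"
proof (cases "0 \<le> x")
  case True
  define u where "u n = x + 1 / real (Suc n)" for n
  have u: "x < u n" for n by (simp add: u_def)
  have ulim: "u \<longlonglongrightarrow> x" unfolding u_def
    using tendsto_add[OF tendsto_const LIMSEQ_inverse_real_of_nat, of x] by (simp add: inverse_eq_divide)
  show ?thesis
  proof (rule borel_measurable_LIMSEQ_real)
    show "(\<lambda>t. real (Suc n) * (LINT y:{x..u n}|lborel. F t y)) \<in> borel_measurable (restrict_space borel {0..})" for n
      using evolution_average_measurable[OF F True, of "u n"] u[of n] by simp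
    fix t :: real assume "t \<in> space (restrict_space borel {0..})"
    then have D: "F t \<in> \<D>\<^sub>1" using evolution_in_D1[OF F] by (simp add: space_restrict_space)
    have i: "set_integrable lborel {x..u n} (\<lambda>_. c :: real)" for n c
      by (rule set_integrable_bounded_Icc[where K="\<bar>c\<bar>"]) auto
    have c: "(LINT y:{x..u n}|lborel. c) = c / real (Suc n)" for n and c :: real
      using u[of n] by (simp add: set_lebesgue_integral_def u_def)
    have j: "set_integrable lborel {x..u n} (F t)" for n
      using D1_range[OF D] by (intro set_integrable_bounded_Icc[where K=1] D1_measurable[OF D]) auto
    have lo: "F t x \<le> real (Suc n) * (LINT y:{x..u n}|lborel. F t y)" for n
    proof -
      have "(LINT y:{x..u n}|lborel. F t x) \<le> (LINT y:{x..u n}|lborel. F t y)"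
        by (intro set_integral_mono i j) (use D1_mono[OF D] in \<open>auto simp: mono_def\<close>)
      then show ?thesis unfolding c by (simp add: divide_le_eq mult.commute)
    qed
    have hi: "real (Suc n) * (LINT y:{x..u n}|lborel. F t y) \<le> F t (u n)" for n
    proof -
      have "(LINT y:{x..u n}|lborel. F t y) \<le> (LINT y:{x..u n}|lborel. F t (u n))"
        by (intro set_integral_mono i j) (use D1_mono[OF D] in \<open>auto simp: mono_def\<close>)
      then show ?thesis unfolding c by (simp add: le_divide_eq mult.commute)
    qed
    show "(\<lambda>n. real (Suc n) * (LINT y:{x..u n}|lborel. F t y)) \<longlonglongrightarrow> F t x"
      by (rule tendsto_sandwich[OF always_eventually always_eventually tendsto_const
            right_limit_sequence[OF D1_right_continuous[OF D] u ulim]]) (use lo hi in blast)+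
  qed
next
  case False
  have "(\<lambda>t. F t x) \<in> borel_measurable (restrict_space borel {0..}) \<longleftrightarrow>
    (\<lambda>t::real. 0 :: real) \<in> borel_measurable (restrict_space borel {0..})"
    by (rule measurable_cong)
      (use D1_nonpos[OF evolution_in_D1[OF F]] False in \<open>auto simp: space_restrict_space\<close>)
  then show ?thesis by simp
qed

text \<open>Right continuity again: replace \<open>x\<close> by the next larger point of a grid of mesh \<open>1 / (n + 1)\<close>, which takes
  countably many values.  Freezing the evolution for negative times gives a function on the whole plane.\<close>

lemma evolution_jointly_measurable:
  assumes F: "F \<in> \<X>\<^sub>1"
  shows "(\<lambda>(t, x). F (max 0 t) x) \<in> borel_measurable (borel \<Otimes>\<^sub>M borel)"
proof (rule borel_measurable_LIMSEQ_real)
  define u where "u n x = (of_int \<lfloor>real (Suc n) * x\<rfloor> + 1) / real (Suc n)" for n x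
  have meas: "(\<lambda>t. F (max 0 t) x) \<in> borel_measurable borel" for x
    by (rule measurable_compose[OF _ evolution_value_measurable[OF F]])
      (auto intro!: measurable_restrict_space2)
  show "(\<lambda>p. F (max 0 (fst p)) (u n (snd p))) \<in> borel_measurable (borel \<Otimes>\<^sub>M borel)" for n
  proof -
    have "(\<lambda>p. F (max 0 (fst p)) ((of_int \<lfloor>real (Suc n) * snd p\<rfloor> + 1) / real (Suc n)))
        \<in> borel_measurable (borel \<Otimes>\<^sub>M borel)"
    proof (rule measurable_compose_countable[where f="\<lambda>(i::int) p. F (max 0 (fst p)) ((of_int i + 1) / real (Suc n))"
          and g="\<lambda>p. \<lfloor>real (Suc n) * snd p\<rfloor>"])
      show "(\<lambda>p. F (max 0 (fst p)) ((of_int i + 1) / real (Suc n))) \<in> borel_measurable (borel \<Otimes>\<^sub>M borel)" for i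
        by (rule measurable_compose[OF measurable_fst meas])
    qed measurable
    then show ?thesis by (simp add: u_def)
  qed
  fix p :: "real \<times> real"
  obtain t x where p: "p = (t, x)" by (cases p)
  have D: "F (max 0 t) \<in> \<D>\<^sub>1" using evolution_in_D1[OF F] by simp
  have gt: "x < u n x" for n
    unfolding u_def by (subst less_divide_eq) (auto simp: mult.commute)
  have le: "u n x \<le> x + 1 / real (Suc n)" for n
    unfolding u_def by (subst divide_le_eq) (auto simp: algebra_simps)
  have "(\<lambda>n. x + 1 / real (Suc n)) \<longlonglongrightarrow> x"
    using tendsto_add[OF tendsto_const LIMSEQ_inverse_real_of_nat, of x] by (simp add: inverse_eq_divide)
  then have "(\<lambda>n. u n x) \<longlonglongrightarrow> x"
    by (rule tendsto_sandwich[OF always_eventually always_eventually tendsto_const, rotated 2])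
      (use gt le less_imp_le in blast)+
  then show "(\<lambda>n. F (max 0 (fst p)) (u n (snd p))) \<longlonglongrightarrow> (case p of (t, x) \<Rightarrow> F (max 0 t) x)"
    unfolding p using right_limit_sequence[OF D1_right_continuous[OF D] gt] by simp
qed

section \<open>Mild solutions\<close>

text \<open>The properties of a continuous distribution function of a probability measure on \<open>(0,1]\<close> through which
  \<open>\<Psi>\<close> enters the evolution.\<close>

locale continuous_choice =
  fixes \<Psi> :: "real \<Rightarrow> real"
  assumes \<Psi>_mono: "mono \<Psi>" and \<Psi>_cont: "continuous_on UNIV \<Psi>" and \<Psi>_0: "\<Psi> 0 = 0" and \<Psi>_1: "\<Psi> 1 = 1"
begin

lemma \<Psi>_measurable [measurable]: "\<Psi> \<in> borel_measurable borel"
  by (rule borel_measurable_continuous_onI[OF \<Psi>_cont])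

lemma \<Psi>_isCont: "isCont \<Psi> x"
  using \<Psi>_cont by (simp add: continuous_on_eq_continuous_at)

lemma \<Psi>_range: "0 \<le> x \<Longrightarrow> 0 \<le> \<Psi> x" "x \<le> 1 \<Longrightarrow> \<Psi> x \<le> 1"
  using monoD[OF \<Psi>_mono, of 0 x] monoD[OF \<Psi>_mono, of x 1] \<Psi>_0 \<Psi>_1 by auto

lemma \<Psi>_D1:
  assumes F: "F \<in> \<D>\<^sub>1"
  shows "(\<lambda>z. \<Psi> (F z)) \<in> borel_measurable borel" "0 \<le> \<Psi> (F z)" "\<Psi> (F z) \<le> 1"
    "x \<le> y \<Longrightarrow> \<Psi> (F x) \<le> \<Psi> (F y)" "continuous (at_right x) (\<lambda>z. \<Psi> (F z))"
proof -
  show "(\<lambda>z. \<Psi> (F z)) \<in> borel_measurable borel"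
    by (rule measurable_compose[OF D1_measurable[OF F] \<Psi>_measurable])
  show "0 \<le> \<Psi> (F z)" "\<Psi> (F z) \<le> 1"
    by (rule \<Psi>_range; rule D1_range[OF F])+
  show "\<Psi> (F x) \<le> \<Psi> (F y)" if "x \<le> y"
    by (rule monoD[OF \<Psi>_mono monoD[OF D1_mono[OF F] that]])
  show "continuous (at_right x) (\<lambda>z. \<Psi> (F z))"
    using D1_right_continuous[OF F, of x] isCont_tendsto_compose[OF \<Psi>_isCont]
    unfolding continuous_within by blast
qed

lemma stieltjes_tail_D1:
  assumes F: "F \<in> \<D>\<^sub>1" and y: "0 < y"
  shows "stieltjes_tail \<Psi> F y = wtail (\<lambda>z. \<Psi> (F z)) y - \<Psi> (F y) / y"
    and "y\<^sup>2 * stieltjes_tail \<Psi> F y = flux (\<lambda>z. \<Psi> (F z)) y"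
proof -
  show "stieltjes_tail \<Psi> F y = wtail (\<lambda>z. \<Psi> (F z)) y - \<Psi> (F y) / y"
    unfolding stieltjes_tail_def
    by (rule stieltjes_tail_eq_wtail[where C=1]) (use \<Psi>_D1[OF F] y in auto)
  then show "y\<^sup>2 * stieltjes_tail \<Psi> F y = flux (\<lambda>z. \<Psi> (F z)) y"
    using y by (simp add: flux_def power2_eq_square right_diff_distrib)
qed

text \<open>The evolution equation in integrated form along the characteristics \<open>t \<mapsto> e\<^sup>t w\<close>, which start at \<open>w\<close> at time
  \<open>0\<close>.  Measurability and tightness are required for all real times, so that no side conditions on the time
  variable arise; the equation itself only concerns \<open>t \<ge> 0\<close>.\<close>

definition mild_solution :: "(real \<Rightarrow> real \<Rightarrow> real) \<Rightarrow> bool" where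
  "mild_solution f \<longleftrightarrow> (\<lambda>(s, x). f s x) \<in> borel_measurable (borel \<Otimes>\<^sub>M borel) \<and> (\<forall>s. f s \<in> \<D>\<^sub>1) \<and>
     (\<forall>t\<ge>0. \<forall>w>0. f t (exp t * w) = f 0 w + (LINT s:{0..t}|lborel. flux (\<lambda>z. \<Psi> (f s z)) (exp s * w))) \<and>
     (\<forall>e>0. \<exists>N>0. \<forall>s. \<forall>x\<ge>N. 1 - e < f s x)"

lemma mild_solutionD:
  assumes "mild_solution f"
  shows "(\<lambda>(s, x). f s x) \<in> borel_measurable (borel \<Otimes>\<^sub>M borel)" "f s \<in> \<D>\<^sub>1"
    "0 \<le> t \<Longrightarrow> 0 < w \<Longrightarrow> f t (exp t * w) = f 0 w + (LINT s:{0..t}|lborel. flux (\<lambda>z. \<Psi> (f s z)) (exp s * w))"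
    "0 < e \<Longrightarrow> \<exists>N>0. \<forall>s. \<forall>x\<ge>N. 1 - e < f s x"
  using assms unfolding mild_solution_def by blast+

lemma frak_F_mild_solution:
  assumes F: "F \<in> frak_F \<Psi>"
  shows "mild_solution (\<lambda>s. F (max 0 s))"
proof -
  have X: "F \<in> \<X>\<^sub>1" and S: "\<And>t x. 0 \<le> t \<Longrightarrow> 0 \<le> x \<Longrightarrow> F t x = S_op \<Psi> F t x" and T: "tight_family {0..} F"
    using F by (auto simp: frak_F_def)
  have D: "F (max 0 s) \<in> \<D>\<^sub>1" for s using evolution_in_D1[OF X] by simp
  show ?thesis unfolding mild_solution_def
  proof (intro conjI allI impI)
    fix t w :: real assume tw: "0 \<le> t" "0 < w"
    have "F t (exp t * w) = F 0 (exp (- t) * (exp t * w)) + (LINT s:{0..t}|lborel.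
        (exp (s - t) * (exp t * w))\<^sup>2 * stieltjes_tail \<Psi> (F s) (exp (s - t) * (exp t * w)))"
      using S[of t "exp t * w"] tw by (simp add: S_op_def)
    also have "exp (- t) * (exp t * w) = w" by (simp add: exp_minus)
    also have "(LINT s:{0..t}|lborel. (exp (s - t) * (exp t * w))\<^sup>2 * stieltjes_tail \<Psi> (F s) (exp (s - t) * (exp t * w)))
       = (LINT s:{0..t}|lborel. flux (\<lambda>z. \<Psi> (F (max 0 s) z)) (exp s * w))"
    proof (rule set_lebesgue_integral_cong)
      show "\<forall>s. s \<in> {0..t} \<longrightarrow> (exp (s - t) * (exp t * w))\<^sup>2 * stieltjes_tail \<Psi> (F s) (exp (s - t) * (exp t * w))
         = flux (\<lambda>z. \<Psi> (F (max 0 s) z)) (exp s * w)"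
      proof (intro allI impI)
        fix s assume "s \<in> {0..t}"
        moreover have e: "exp (s - t) * (exp t * w) = exp s * w" by (simp add: exp_diff)
        ultimately show "(exp (s - t) * (exp t * w))\<^sup>2 * stieltjes_tail \<Psi> (F s) (exp (s - t) * (exp t * w))
         = flux (\<lambda>z. \<Psi> (F (max 0 s) z)) (exp s * w)"
          unfolding e using stieltjes_tail_D1(2)[OF D[of s], of "exp s * w"] tw by simp
      qed
    qed simp
    finally show "F (max 0 t) (exp t * w) = F (max 0 0) w + (LINT s:{0..t}|lborel. flux (\<lambda>z. \<Psi> (F (max 0 s) z)) (exp s * w))"
      using tw by simp
  next
    fix e :: real assume "0 < e"
    then obtain N where N: "0 \<le> N" "\<And>s. 0 \<le> s \<Longrightarrow> 1 - e < F s N"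
      using T unfolding tight_family_def by (meson atLeast_iff)
    have "1 - e < F (max 0 s) x" if "N + 1 \<le> x" for s x
      using N(2)[of "max 0 s"] monoD[OF D1_mono[OF D], of N x s] that by simp
    then show "\<exists>N>0. \<forall>s. \<forall>x\<ge>N. 1 - e < F (max 0 s) x" using N(1) by (intro exI[of _ "N + 1"]) auto
  qed (use D evolution_jointly_measurable[OF X] in auto)
qed

lemma mild_flux_measurable:
  assumes "mild_solution f" "g \<in> borel_measurable borel"
  shows "(\<lambda>s. flux (\<lambda>z. \<Psi> (f s z)) (g s)) \<in> borel_measurable borel"
  by (rule borel_measurable_flux[OF _ assms(2)])
    (use measurable_compose[OF mild_solutionD(1)[OF assms(1)] \<Psi>_measurable] in \<open>simp add: split_beta'\<close>)

lemma mild_flux_bound: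
  assumes "mild_solution f" "0 < y"
  shows "\<bar>flux (\<lambda>z. \<Psi> (f s z)) y\<bar> \<le> y"
  using \<Psi>_D1[OF mild_solutionD(2)[OF assms(1)]] assms(2) by (intro flux_bound) auto

lemma mild_solution_shift:
  assumes f: "mild_solution f" and r: "0 \<le> r"
  shows "mild_solution (\<lambda>s. f (r + s))"
  unfolding mild_solution_def
proof (intro conjI allI impI)
  show "(\<lambda>(s, x). f (r + s) x) \<in> borel_measurable (borel \<Otimes>\<^sub>M borel)"
    unfolding split_beta' by (rule borel_measurable_compose2[OF mild_solutionD(1)[OF f]]) measurable
  fix t w :: real assume tw: "0 \<le> t" "0 < w"
  \<comment> \<open>The label at time \<open>0\<close> of the characteristic that is at \<open>w\<close> at time \<open>r\<close>.\<close>
  define w' where "w' = exp (- r) * w"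
  have w': "0 < w'" "exp r * w' = w" "exp (r + s) * w' = exp s * w" for s
    using tw by (simp_all add: w'_def exp_add exp_minus)
  define q where "q s = flux (\<lambda>z. \<Psi> (f s z)) (exp s * w')" for s
  have q [measurable]: "q \<in> borel_measurable borel"
    unfolding q_def by (rule mild_flux_measurable[OF f]) simp
  have i: "set_integrable lborel {0..r + t} q"
  proof (rule set_integrable_bounded_Icc[OF q])
    fix s assume s: "0 \<le> s" "s \<le> r + t"
    have "\<bar>q s\<bar> \<le> exp s * w'" unfolding q_def using w' by (intro mild_flux_bound f) simp
    also have "\<dots> \<le> exp (r + t) * w'" using s w'(1) by (intro mult_right_mono) auto
    finally show "\<bar>q s\<bar> \<le> exp (r + t) * w'" .
  qed
  have "f (r + t) (exp (r + t) * w') = f r (exp r * w') + (LINT s:{r..r + t}|lborel. q s)"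
    using mild_solutionD(3)[OF f, of "r + t" w'] mild_solutionD(3)[OF f, of r w'] r tw w'(1)
      set_integral_Icc_split[OF i, of r]
    by (simp add: q_def[symmetric])
  also have "(LINT s:{r..r + t}|lborel. q s) = (LINT s:{0..t}|lborel. q (r + s))"
    unfolding set_lebesgue_integral_def
    by (subst lborel_integral_real_affine[where c=1 and t=r])
      (auto intro!: Bochner_Integration.integral_cong simp: indicator_def)
  finally show "f (r + t) (exp t * w) = f (r + 0) w
      + (LINT s:{0..t}|lborel. flux (\<lambda>z. \<Psi> (f (r + s) z)) (exp s * w))"
    by (simp add: q_def w')
next
  fix e :: real assume "0 < e"
  then show "\<exists>N>0. \<forall>s. \<forall>x\<ge>N. 1 - e < f (r + s) x" using mild_solutionD(4)[OF f, of e] by blast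
qed (rule mild_solutionD(2)[OF f])

section \<open>Contraction\<close>

text \<open>Let \<open>A\<close> and \<open>B\<close> denote the two functions composed with \<open>\<Psi>\<close>, at time \<open>s\<close> and in the coordinate \<open>w\<close>.  The
  difference along a characteristic changes at the rate
  \<open>e\<^sup>s (w\<^sup>2 wtail (A - B) w - w (A w - B w))\<close>.  As \<open>A w - B w\<close> has the sign of the difference itself, the last term is
  pure damping, and replacing \<open>A - B\<close> by its absolute value everywhere bounds the growth of the absolute value.\<close>

lemma mild_difference_bound:
  assumes f: "mild_solution f" and h: "mild_solution h" and t: "0 \<le> t" and w: "0 < w"
  defines "K \<equiv> \<lambda>s z. \<bar>\<Psi> (f s (exp s * z)) - \<Psi> (h s (exp s * z))\<bar>"
  shows "\<bar>f t (exp t * w) - h t (exp t * w)\<bar> \<le> \<bar>f 0 w - h 0 w\<bar> + (LINT s:{0..t}|lborel. exp s * flux (K s) w)"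
    and "(\<lambda>(s, x). K s x) \<in> borel_measurable (borel \<Otimes>\<^sub>M borel)"
    and "0 \<le> K s z" "K s z \<le> 1"
proof -
  have sc: "(\<lambda>(s, x). u s (exp s * x)) \<in> borel_measurable (borel \<Otimes>\<^sub>M borel)" if "mild_solution u" for u
    unfolding split_beta' by (rule borel_measurable_compose2[OF mild_solutionD(1)[OF that]]) measurable
  note [measurable] = sc[OF f, unfolded split_beta'] sc[OF h, unfolded split_beta']
  show Km: "(\<lambda>(s, x). K s x) \<in> borel_measurable (borel \<Otimes>\<^sub>M borel)"
    unfolding K_def split_beta' by measurable
  note Df = \<Psi>_D1[OF mild_solutionD(2)[OF f]] and Dh = \<Psi>_D1[OF mild_solutionD(2)[OF h]]
  show K0: "0 \<le> K s z" and K1: "K s z \<le> 1" for s z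
    using Df(2,3)[of s "exp s * z"] Dh(2,3)[of s "exp s * z"] by (auto simp: K_def)
  have Ks: "K s \<in> borel_measurable borel" for s
    using measurable_Pair2[OF Km, of s] by simp
  define A where "A = (\<lambda>s z. \<Psi> (f s (exp s * z)))"
  define B where "B = (\<lambda>s z. \<Psi> (h s (exp s * z)))"
  have AB: "A s \<in> borel_measurable borel" "B s \<in> borel_measurable borel"
    "\<bar>A s z\<bar> \<le> 1" "\<bar>B s z\<bar> \<le> 1" for s z
    using measurable_compose[OF _ Df(1)[of s], of "\<lambda>z. exp s * z" borel]
      measurable_compose[OF _ Dh(1)[of s], of "\<lambda>z. exp s * z" borel]
      Df(2,3)[of s "exp s * z"] Dh(2,3)[of s "exp s * z"] by (auto simp: A_def B_def abs_le_iff)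
  have K_eq: "K s = (\<lambda>z. \<bar>A s z - B s z\<bar>)" for s
    by (simp add: K_def A_def B_def)
  define q where "q s = flux (\<lambda>z. \<Psi> (f s z)) (exp s * w) - flux (\<lambda>z. \<Psi> (h s z)) (exp s * w)" for s
  define d where "d s = f s (exp s * w) - h s (exp s * w)" for s
  have q_eq: "q s = exp s * (w\<^sup>2 * wtail (\<lambda>z. A s z - B s z) w - w * (A s w - B s w))" for s
  proof -
    have "q s = exp s * (flux (A s) w - flux (B s) w)"
      unfolding q_def by (simp add: flux_scale A_def B_def right_diff_distrib)
    also have "flux (A s) w - flux (B s) w = w\<^sup>2 * wtail (\<lambda>z. A s z - B s z) w - w * (A s w - B s w)"
      unfolding flux_def wtail_diff[OF AB(1,3) AB(2,4) w] by (simp add: algebra_simps)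
    finally show ?thesis .
  qed
  have tail: "\<bar>wtail (\<lambda>z. A s z - B s z) w\<bar> \<le> wtail (K s) w" for s
    unfolding K_eq
  proof (rule wtail_abs_le[where C=2])
    show "\<bar>A s z - B s z\<bar> \<le> 2" for z
      using AB(3,4)[of s z] by linarith
  qed (use AB w in auto)
  have p_eq: "exp s * flux (K s) w = exp s * (w\<^sup>2 * wtail (K s) w - w * \<bar>A s w - B s w\<bar>)" for s
    by (simp add: flux_def K_eq)
  have cmp: "exp s * (w\<^sup>2 * x - w * u) \<le> exp s * (w\<^sup>2 * x' - w * u)" if "x \<le> x'" for s x x' u :: real
    using that w by (intro mult_left_mono diff_right_mono) auto
  have "\<bar>d t\<bar> \<le> \<bar>d 0\<bar> + (LINT s:{0..t}|lborel. exp s * flux (K s) w)"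
  proof (rule abs_integral_comparison[where K="2 * (exp t * w)" and q=q])
    show "q \<in> borel_measurable borel"
      unfolding q_def by (intro borel_measurable_diff mild_flux_measurable f h) auto
    show "d \<in> borel_measurable borel"
      unfolding d_def
      by (intro borel_measurable_diff borel_measurable_pair_section[OF mild_solutionD(1)[OF f]]
          borel_measurable_pair_section[OF mild_solutionD(1)[OF h]]) simp_all
    show "(\<lambda>s. exp s * flux (K s) w) \<in> borel_measurable borel"
      by (intro borel_measurable_times borel_measurable_flux[OF Km]) auto
    fix s assume s: "0 \<le> s" "s \<le> t"
    have e: "exp s * w \<le> exp t * w" using s w by (intro mult_right_mono) auto
    have "0 < exp s * w" using w by simp
    from mild_flux_bound[OF f this, of s] mild_flux_bound[OF h this, of s] e
    show "\<bar>q s\<bar> \<le> 2 * (exp t * w)" unfolding q_def by linarith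
    have "exp s * \<bar>flux (K s) w\<bar> \<le> exp s * w" by (intro mult_left_mono flux_bound Ks K0 K1 w) simp
    with e \<open>0 < exp s * w\<close> show "\<bar>exp s * flux (K s) w\<bar> \<le> 2 * (exp t * w)"
      unfolding abs_mult abs_exp_cancel by linarith
    have bnd: "\<bar>flux (\<lambda>z. \<Psi> (u v z)) (exp v * w)\<bar> \<le> exp s * w" if "mild_solution u" "0 \<le> v" "v \<le> s" for u v
    proof -
      have "\<bar>flux (\<lambda>z. \<Psi> (u v z)) (exp v * w)\<bar> \<le> exp v * w" using w by (intro mild_flux_bound that) simp
      also have "\<dots> \<le> exp s * w" using that w by (intro mult_right_mono) auto
      finally show ?thesis .
    qed
    have int: "set_integrable lborel {0..s} (\<lambda>v. flux (\<lambda>z. \<Psi> (u v z)) (exp v * w))" if "mild_solution u" for u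
      by (rule set_integrable_bounded_Icc[OF mild_flux_measurable[OF that] bnd[OF that]]) auto
    show "d s = d 0 + (LINT v:{0..s}|lborel. q v)"
      using mild_solutionD(3)[OF f s(1) w] mild_solutionD(3)[OF h s(1) w]
      unfolding d_def q_def set_integral_diff(2)[OF int[OF f] int[OF h]] by simp
    show "q s \<le> exp s * flux (K s) w" if "0 \<le> d s"
    proof -
      have "B s w \<le> A s w" using that monoD[OF \<Psi>_mono] by (simp add: A_def B_def d_def)
      then show ?thesis unfolding q_eq p_eq using cmp[OF abs_le_D1[OF tail]] by simp
    qed
    show "- q s \<le> exp s * flux (K s) w" if "d s \<le> 0"
    proof -
      have "A s w \<le> B s w" using that monoD[OF \<Psi>_mono] by (simp add: A_def B_def d_def)
      moreover have "- q s = exp s * (w\<^sup>2 * (- wtail (\<lambda>z. A s z - B s z) w) - w * (B s w - A s w))"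
        unfolding q_eq by (simp add: algebra_simps)
      ultimately show ?thesis unfolding p_eq using cmp[OF abs_le_D2[OF tail]] by simp
    qed
  qed (rule t)
  then show "\<bar>f t (exp t * w) - h t (exp t * w)\<bar> \<le> \<bar>f 0 w - h 0 w\<bar> + (LINT s:{0..t}|lborel. exp s * flux (K s) w)"
    by (simp add: d_def)
qed

text \<open>Tightness survives the composition with \<open>\<Psi>\<close> because \<open>\<Psi>\<close> is continuous at \<open>1\<close>.\<close>

lemma \<Psi>_tight:
  assumes f: "mild_solution f" and "0 < e"
  shows "\<exists>N>0. \<forall>s. \<forall>x\<ge>N. 1 - e < \<Psi> (f s x)"
proof -
  have "(\<Psi> \<longlongrightarrow> 1) (at 1)" using \<Psi>_isCont[of 1] \<Psi>_1 by (simp add: isCont_def)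
  then have "\<forall>\<^sub>F x in at 1. 1 - e < \<Psi> x" by (rule order_tendstoD(1)) (use assms(2) in simp)
  then obtain r where r: "0 < r" "\<And>x. x \<noteq> 1 \<Longrightarrow> dist x 1 < r \<Longrightarrow> 1 - e < \<Psi> x"
    unfolding eventually_at by auto
  have "1 - e < \<Psi> (1 - r / 2)" using r by (intro r(2)) (auto simp: dist_real_def)
  moreover obtain N where "0 < N" "\<And>s x. N \<le> x \<Longrightarrow> 1 - r / 2 < f s x"
    using mild_solutionD(4)[OF f, of "r / 2"] r(1) by auto
  ultimately show ?thesis using monoD[OF \<Psi>_mono, of "1 - r / 2"]
    by (intro exI[of _ N] conjI allI impI) (blast intro: less_le_trans less_imp_le)+
qed

text \<open>By \<open>mild_difference_bound\<close> and \<open>integral_flux_evolution\<close>, over \<open>[a, b]\<close> the weighted integral of the difference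
  grows in time \<open>t\<close> by at most \<open>\<integral> e\<^sup>s b wtail K b ds\<close>, and this is small for large \<open>b\<close> by tightness.  Letting \<open>a\<close>
  tend to \<open>0\<close> and \<open>b\<close> to infinity shows that the norm does not increase along characteristics; the factor \<open>e\<^sup>-\<^sup>t\<close> is
  the effect of the dilation on the norm.\<close>

lemma mild_contraction:
  assumes f: "mild_solution f" and h: "mild_solution h" and t: "0 \<le> t"
  shows "norm_x2 (\<lambda>x. f t x - h t x) \<le> ennreal (exp (- t)) * norm_x2 (\<lambda>x. f 0 x - h 0 x)"
proof -
  define K where "K s z = \<bar>\<Psi> (f s (exp s * z)) - \<Psi> (h s (exp s * z))\<bar>" for s z
  note K = mild_difference_bound[OF f h t, folded K_def]
  have Km: "(\<lambda>(s, x). K s x) \<in> borel_measurable (borel \<Otimes>\<^sub>M borel)" and K0: "\<And>s z. 0 \<le> K s z" and K1: "\<And>s z. K s z \<le> 1"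
    using K(2,3,4)[OF zero_less_one] by auto
  have Ks: "K s \<in> borel_measurable borel" for s
    using measurable_Pair2[OF Km, of s] by simp
  note [measurable] = D1_measurable[OF mild_solutionD(2)[OF f]] D1_measurable[OF mild_solutionD(2)[OF h]]
  let ?D = "\<lambda>w. f t (exp t * w) - h t (exp t * w)" and ?E = "\<lambda>w. f 0 w - h 0 w"
  have rng: "0 \<le> f s x" "f s x \<le> 1" "0 \<le> h s x" "h s x \<le> 1" for s x
    using D1_range[OF mild_solutionD(2)[OF f]] D1_range[OF mild_solutionD(2)[OF h]] by auto
  have D1: "\<bar>?D w\<bar> \<le> 1" "\<bar>?E w\<bar> \<le> 1" for w
    using rng[of t "exp t * w"] rng[of 0 w] by (simp_all add: abs_le_iff)
  have "norm_x2 ?D \<le> norm_x2 ?E"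
  proof (rule ennreal_le_epsilon)
    fix e :: real assume e: "0 < e"
    \<comment> \<open>The boundary term at \<open>b\<close>, integrated over \<open>[0, t]\<close>, will be at most \<open>t * exp t * \<eta>\<close>; the summand \<open>1\<close>
      covers \<open>t = 0\<close>.\<close>
    define \<eta> where "\<eta> = e / (t * exp t + 1)"
    have den: "0 < t * exp t + 1" using t by (simp add: add_nonneg_pos)
    have \<eta>: "0 < \<eta>" "t * exp t * \<eta> \<le> e"
      using e den by (simp_all add: \<eta>_def divide_le_eq algebra_simps)
    obtain N1 where N1: "0 < N1" "\<And>s x. N1 \<le> x \<Longrightarrow> 1 - \<eta> < \<Psi> (f s x)" using \<Psi>_tight[OF f \<eta>(1)] by blast
    obtain N2 where N2: "0 < N2" "\<And>s x. N2 \<le> x \<Longrightarrow> 1 - \<eta> < \<Psi> (h s x)" using \<Psi>_tight[OF h \<eta>(1)] by blast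
    define N where "N = max N1 N2"
    \<comment> \<open>Beyond \<open>N\<close> both compositions with \<open>\<Psi>\<close> lie between \<open>1 - \<eta>\<close> and \<open>1\<close>, and the dilation by \<open>exp s\<close> moves
      arguments to the right.\<close>
    have small: "K s z \<le> \<eta>" if "N \<le> z" "0 \<le> s" for s z
    proof -
      have "z \<le> exp s * z" using that N1 by (simp add: N_def)
      then have "1 - \<eta> < \<Psi> (f s (exp s * z))" "1 - \<eta> < \<Psi> (h s (exp s * z))"
        using that by (auto intro!: N1 N2 simp: N_def)
      moreover have "\<Psi> (f s (exp s * z)) \<le> 1" "\<Psi> (h s (exp s * z)) \<le> 1"
        using \<Psi>_D1(3) mild_solutionD(2) f h by blast+
      ultimately show ?thesis unfolding K_def by linarith
    qed
    show "norm_x2 ?D \<le> norm_x2 ?E + ennreal e"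
    proof (rule norm_x2_le_intervals)
      fix a b assume ab: "0 < a" "a \<le> b" "N \<le> b"
      have w2: "a\<^sup>2 \<le> w\<^sup>2" if "a \<le> w" for w using that ab by (intro power_mono) auto
      have i: "set_integrable lborel {a..b} (\<lambda>w. \<bar>?D w\<bar> / w\<^sup>2)"
      proof (rule set_integrable_bounded_Icc[where K="1 / a\<^sup>2"])
        fix w assume "a \<le> w" "w \<le> b"
        then show "\<bar>\<bar>?D w\<bar> / w\<^sup>2\<bar> \<le> 1 / a\<^sup>2"
          using D1[of w] w2[of w] ab by (auto intro!: frac_le)
      qed measurable
      have i0: "set_integrable lborel {a..b} (\<lambda>w. \<bar>?E w\<bar> / w\<^sup>2)"
      proof (rule set_integrable_bounded_Icc[where K="1 / a\<^sup>2"])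
        fix w assume "a \<le> w" "w \<le> b"
        then show "\<bar>\<bar>?E w\<bar> / w\<^sup>2\<bar> \<le> 1 / a\<^sup>2"
          using D1[of w] w2[of w] ab by (auto intro!: frac_le)
      qed measurable
      have nn: "(\<integral>\<^sup>+x\<in>{a..b}. ennreal (u x) \<partial>lborel) = ennreal (LINT x:{a..b}|lborel. u x)"
        if "set_integrable lborel {a..b} u" "\<And>x. 0 \<le> u x" for u :: "real \<Rightarrow> real"
      proof -
        have "(\<integral>\<^sup>+x. ennreal (indicator {a..b} x *\<^sub>R u x) \<partial>lborel) = ennreal (LINT x:{a..b}|lborel. u x)"
          unfolding set_lebesgue_integral_def
          by (rule nn_integral_eq_integral) (use that in \<open>auto simp: set_integrable_def\<close>)
        moreover have "(\<integral>\<^sup>+x\<in>{a..b}. ennreal (u x) \<partial>lborel) = (\<integral>\<^sup>+x. ennreal (indicator {a..b} x *\<^sub>R u x) \<partial>lborel)"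
          by (intro nn_integral_cong) (auto simp: indicator_def)
        ultimately show ?thesis by simp
      qed
      note ev = integral_flux_evolution[OF Km K0 K1 ab(1,2), of t]
      have "(LINT w:{a..b}|lborel. \<bar>?D w\<bar> / w\<^sup>2)
        \<le> (LINT w:{a..b}|lborel. \<bar>?E w\<bar> / w\<^sup>2 + (LINT s:{0..t}|lborel. exp s * flux (K s) w) / w\<^sup>2)"
      proof (rule set_integral_mono[OF i set_integral_add(1)[OF i0 ev(2)]])
        fix w assume "w \<in> {a..b}"
        then have "0 < w" using ab by auto
        from divide_right_mono[OF K(1)[OF this], of "w\<^sup>2"]
        show "\<bar>?D w\<bar> / w\<^sup>2 \<le> \<bar>?E w\<bar> / w\<^sup>2 + (LINT s:{0..t}|lborel. exp s * flux (K s) w) / w\<^sup>2"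
          by (simp add: add_divide_distrib)
      qed
      also have "\<dots> = (LINT w:{a..b}|lborel. \<bar>?E w\<bar> / w\<^sup>2)
          + (LINT s:{0..t}|lborel. exp s * (b * wtail (K s) b - a * wtail (K s) a))"
        unfolding set_integral_add(2)[OF i0 ev(2)] ev(1) ..
      also have "(LINT s:{0..t}|lborel. exp s * (b * wtail (K s) b - a * wtail (K s) a)) \<le> (LINT s:{0..t}|lborel. exp t * \<eta>)"
      proof (rule set_integral_mono)
        have wm: "(\<lambda>s. wtail (K s) c) \<in> borel_measurable borel" for c
          by (rule borel_measurable_wtail[OF Km]) simp
        have wb: "0 \<le> c * wtail (K s) c" "c * wtail (K s) c \<le> 1" if "0 < c" for c s
          using wtail_bounds[OF Ks K0 K1 that, of s] that by auto
        show "set_integrable lborel {0..t} (\<lambda>s. exp s * (b * wtail (K s) b - a * wtail (K s) a))"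
        proof (rule set_integrable_bounded_Icc[where K="exp t * 1"])
          fix s assume "0 \<le> s" "s \<le> t"
          then show "\<bar>exp s * (b * wtail (K s) b - a * wtail (K s) a)\<bar> \<le> exp t * 1"
            using wb[of a s] wb[of b s] ab unfolding abs_mult by (intro mult_mono) auto
        qed (intro borel_measurable_times borel_measurable_diff wm; simp)
        show "set_integrable lborel {0..t} (\<lambda>s. exp t * \<eta>)"
          by (rule set_integrable_bounded_Icc[where K="\<bar>exp t * \<eta>\<bar>"]) auto
        fix s assume s: "s \<in> {0..t}"
        have "wtail (K s) b \<le> wtail (\<lambda>_. \<eta>) b"
          by (rule wtail_mono[where C=1 and C'=\<eta>]) (use small s ab K0 K1 Ks \<eta> in auto)
        then have "b * wtail (K s) b \<le> \<eta>" using ab by (simp add: wtail_const field_simps)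
        then show "exp s * (b * wtail (K s) b - a * wtail (K s) a) \<le> exp t * \<eta>"
          using wb(1)[OF ab(1), of s] s \<eta>
          by (intro order_trans[OF mult_left_mono[of _ \<eta>] mult_right_mono]) auto
      qed
      also have "(LINT s:{0..t}|lborel. exp t * \<eta>) = t * exp t * \<eta>" using t by (simp add: set_lebesgue_integral_def)
      finally have "(LINT w:{a..b}|lborel. \<bar>?D w\<bar> / w\<^sup>2) \<le> (LINT w:{a..b}|lborel. \<bar>?E w\<bar> / w\<^sup>2) + e"
        using \<eta>(2) by linarith
      then have "ennreal (LINT w:{a..b}|lborel. \<bar>?D w\<bar> / w\<^sup>2) \<le> ennreal (LINT w:{a..b}|lborel. \<bar>?E w\<bar> / w\<^sup>2) + ennreal e"
        using e by (subst ennreal_plus[symmetric]) (auto intro!: ennreal_leI Bochner_Integration.integral_nonneg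
            simp: set_lebesgue_integral_def simp del: ennreal_plus)
      also have "ennreal (LINT w:{a..b}|lborel. \<bar>?E w\<bar> / w\<^sup>2) \<le> norm_x2 ?E"
        unfolding norm_x2_def nn[OF i0, symmetric, simplified]
        using ab by (intro nn_integral_mono) (auto simp: indicator_def)
      finally show "(\<integral>\<^sup>+x\<in>{a..b}. ennreal (\<bar>?D x\<bar> / x\<^sup>2) \<partial>lborel) \<le> norm_x2 ?E + ennreal e"
        by (subst nn[OF i]) auto
    qed measurable
  qed
  then have "ennreal (exp t) * norm_x2 (\<lambda>x. f t x - h t x) \<le> norm_x2 ?E"
    using norm_x2_scale[of "\<lambda>x. f t x - h t x" "exp t"] by simp
  from mult_left_mono[OF this, of "ennreal (exp (- t))"]
  show ?thesis by (simp add: mult.assoc[symmetric] ennreal_mult[symmetric] flip: exp_add)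
qed

section \<open>Convergence to a limit profile\<close>

text \<open>Contraction between the solution and its time shift by \<open>r\<close>.\<close>

lemma mild_cauchy:
  assumes f: "mild_solution f" and r: "0 \<le> r" and t: "0 \<le> t"
  shows "norm_x2 (\<lambda>x. f (r + t) x - f t x) \<le> ennreal (2 * exp (- t))"
proof -
  have two: "norm_x2 (\<lambda>x. f r x - f 0 x) \<le> ennreal 2"
    by (intro D1_norm_difference mild_solutionD(2)[OF f])
  have "norm_x2 (\<lambda>x. f (r + t) x - f t x) \<le> ennreal (exp (- t)) * norm_x2 (\<lambda>x. f r x - f 0 x)"
    using mild_contraction[OF mild_solution_shift[OF f r] f t] by simp
  also have "\<dots> \<le> ennreal (exp (- t)) * ennreal 2" by (intro mult_left_mono two) simp
  also have "\<dots> = ennreal (2 * exp (- t))" by (subst ennreal_mult[symmetric]) (simp_all add: mult.commute)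
  finally show ?thesis .
qed

definition is_limit :: "(real \<Rightarrow> real \<Rightarrow> real) \<Rightarrow> (real \<Rightarrow> real) \<Rightarrow> bool" where
  "is_limit f L \<longleftrightarrow> L \<in> \<D>\<^sub>1 \<and> (L \<longlongrightarrow> 1) at_top \<and>
     (\<forall>t\<ge>0. norm_x2 (\<lambda>x. f t x - L x) \<le> ennreal (2 * exp (- t)))"

lemma is_limitD:
  assumes "is_limit f L"
  shows "L \<in> \<D>\<^sub>1" "(L \<longlongrightarrow> 1) at_top" "0 \<le> t \<Longrightarrow> norm_x2 (\<lambda>x. f t x - L x) \<le> ennreal (2 * exp (- t))"
  using assms unfolding is_limit_def by blast+

text \<open>The limit is taken along a subsequence of integer times by Helly's theorem and is a limit along all times
  by the Cauchy property and Fatou's lemma.  Since subsequential convergence is only available at almost every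
  point, pointwise bounds for \<open>L\<close> at \<open>x\<close> come from nearby points and monotonicity.\<close>

lemma mild_limit_exists:
  assumes f: "mild_solution f"
  shows "\<exists>L. is_limit f L"
proof -
  have D: "f s \<in> \<D>\<^sub>1" for s by (rule mild_solutionD(2)[OF f])
  have [measurable]: "f s \<in> borel_measurable borel" for s by (rule D1_measurable[OF D])
  have "\<bar>f s x\<bar> \<le> 1" for s x using D1_range[OF D, of s x] by simp
  then obtain \<sigma> L where \<sigma>: "strict_mono \<sigma>" and Lrc: "\<And>x. continuous (at_right x) L" and Lmono: "mono L"
    and conv: "\<And>x. isCont L x \<Longrightarrow> (\<lambda>n. f (real (\<sigma> n)) x) \<longlonglongrightarrow> L x"
    using Helly_selection[of "\<lambda>n. f (real n)" 1] D1_right_continuous[OF D] D1_mono[OF D] by auto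
  have [measurable]: "L \<in> borel_measurable borel" by (rule borel_measurable_mono[OF Lmono])
  have "AE x in lborel. x \<notin> {a. \<not> isCont L a}"
    by (intro AE_not_in countable_imp_null_set_lborel mono_ctble_discont Lmono)
  then have AE: "AE x in lborel. (\<lambda>n. f (real (\<sigma> n)) x) \<longlonglongrightarrow> L x"
    by eventually_elim (use conv in auto)
  \<comment> \<open>Bounds on the approximants near \<open>x\<close> carry over to \<open>L x\<close> via a nearby point of convergence.\<close>
  have L_upper: "L x \<le> c" if xy: "x < y" and le: "\<And>z. z < y \<Longrightarrow> \<forall>n. f (real (\<sigma> n)) z \<le> c" for x y c
  proof -
    obtain z where z: "x < z" "z < y" "(\<lambda>n. f (real (\<sigma> n)) z) \<longlonglongrightarrow> L z"
      using AE_lborel_in_interval[OF AE xy] by blast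
    have "L x \<le> L z" using z Lmono by (simp add: monoD)
    also have "\<dots> \<le> c" by (rule LIMSEQ_le_const2[OF z(3)]) (use le[OF z(2)] in auto)
    finally show ?thesis .
  qed
  have L_lower: "c \<le> L x" if xy: "y < x" and le: "\<And>z. y < z \<Longrightarrow> \<forall>n. c \<le> f (real (\<sigma> n)) z" for x y c
  proof -
    obtain z where z: "y < z" "z < x" "(\<lambda>n. f (real (\<sigma> n)) z) \<longlonglongrightarrow> L z"
      using AE_lborel_in_interval[OF AE xy] by blast
    have "c \<le> L z" by (rule LIMSEQ_le_const[OF z(3)]) (use le[OF z(1)] in auto)
    also have "\<dots> \<le> L x" using z Lmono by (simp add: monoD)
    finally show ?thesis .
  qed
  have L0: "0 \<le> L x" for x using L_lower[of "x - 1" x 0] D1_range[OF D] by auto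
  have L1: "L x \<le> 1" for x using L_upper[of x "x + 1" 1] D1_range[OF D] by auto
  have Lneg: "L x = 0" if "x < 0" for x
    using L_upper[of x 0 0] L0[of x] that D1_nonpos[OF D] by force
  have "norm_x2 L \<le> 1"
    by (rule norm_x2_le_limit[where u="\<lambda>n. f (real (\<sigma> n))"])
      (use AE D in \<open>auto simp: cal_D1_def elim: eventually_mono\<close>)
  then have LD: "L \<in> \<D>\<^sub>1" by (intro D1_I Lmono Lrc L0 L1 Lneg)
  have "(L \<longlongrightarrow> 1) at_top"
  proof (rule tendstoI)
    fix e :: real assume e: "0 < e"
    obtain N where N: "0 < N" "\<And>s x. N \<le> x \<Longrightarrow> 1 - e / 2 < f s x"
      using mild_solutionD(4)[OF f, of "e / 2"] e by auto
    have "1 - e / 2 \<le> L x" if "N < x" for x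
      by (rule L_lower[OF that]) (auto intro!: less_imp_le N)
    then have "dist (L x) 1 < e" if "N < x" for x
      using L1[of x] that e by (fastforce simp: dist_real_def)
    then show "\<forall>\<^sub>F x in at_top. dist (L x) 1 < e"
      by (rule eventually_mono[OF eventually_gt_at_top])
  qed
  moreover have "norm_x2 (\<lambda>x. f t x - L x) \<le> ennreal (2 * exp (- t))" if t: "0 \<le> t" for t
  proof (rule norm_x2_le_limit[where u="\<lambda>n x. f t x - f (real (\<sigma> n)) x"])
    show "AE x in lborel. 0 < x \<longrightarrow> (\<lambda>n. f t x - f (real (\<sigma> n)) x) \<longlonglongrightarrow> f t x - L x"
      using AE by eventually_elim (auto intro!: tendsto_intros)
    have "\<forall>\<^sub>F n in sequentially. t \<le> real n"
      using filterlim_real_sequentially by (simp add: filterlim_at_top)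
    then have "\<forall>\<^sub>F n in sequentially. t \<le> real (\<sigma> n)"
      by eventually_elim (use seq_suble[OF \<sigma>] of_nat_mono order_trans in blast)
    then show "\<forall>\<^sub>F n in sequentially. norm_x2 (\<lambda>x. f t x - f (real (\<sigma> n)) x) \<le> ennreal (2 * exp (- t))"
    proof eventually_elim
      case (elim n)
      then show ?case using mild_cauchy[OF f, of "real (\<sigma> n) - t" t] t
        by (simp add: norm_x2_minus_commute)
    qed
  qed measurable
  ultimately show ?thesis using LD by (auto simp: is_limit_def)
qed

text \<open>Needed for every \<open>s\<close> separately: the integrated equation between the times \<open>n\<close> and \<open>n + t\<close> involves all
  times \<open>n + s\<close> with \<open>0 \<le> s \<le> t\<close>.\<close>

lemma is_limit_AE:
  assumes f: "mild_solution f" and L: "is_limit f L" and s: "0 \<le> s"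
  shows "AE x in lborel. 0 < x \<longrightarrow> (\<lambda>n. f (real n + s) x) \<longlonglongrightarrow> L x"
proof (rule AE_tendsto_of_summable_norm_x2)
  show "f (real n + s) \<in> borel_measurable borel" "L \<in> borel_measurable borel" for n
    using mild_solutionD(2)[OF f] L by (auto simp: is_limit_def intro!: D1_measurable)
  show "norm_x2 (\<lambda>x. f (real n + s) x - L x) \<le> ennreal (2 * exp (- 1) ^ n)" for n
  proof -
    have "norm_x2 (\<lambda>x. f (real n + s) x - L x) \<le> ennreal (2 * exp (- (real n + s)))"
      by (rule is_limitD(3)[OF L]) (use s in simp)
    also have "exp (- (real n + s)) \<le> exp (- real n)" using s by simp
    also have "exp (- real n) = exp (- 1) ^ n" by (simp add: exp_of_nat_mult[symmetric])
    finally show ?thesis by (simp add: ennreal_leI)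
  qed
  show "summable (\<lambda>n. 2 * exp (- 1 :: real) ^ n)" by (intro summable_mult summable_geometric) simp
qed simp

section \<open>The equation for the limit profile\<close>

text \<open>The evolution equation divided by \<open>w\<^sup>2\<close> and integrated over \<open>[a, b]\<close>.  It no longer contains pointwise
  values of the solution.\<close>

lemma mild_integrated:
  assumes f: "mild_solution f" and ab: "0 < a" "a \<le> b" and t: "0 \<le> t"
  shows "exp t * (wtail (f t) (exp t * a) - wtail (f t) (exp t * b)) = wtail (f 0) a - wtail (f 0) b
     + (LINT s:{0..t}|lborel. exp s * (exp s * b * wtail (\<lambda>z. \<Psi> (f s z)) (exp s * b)
          - exp s * a * wtail (\<lambda>z. \<Psi> (f s z)) (exp s * a)))"
proof -
  define K where "K s z = \<Psi> (f s (exp s * z))" for s z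
  have D: "f s \<in> \<D>\<^sub>1" for s by (rule mild_solutionD(2)[OF f])
  have fb: "\<bar>f s x\<bar> \<le> 1" for s x using D1_range[OF D, of s x] by simp
  have fm [measurable]: "f s \<in> borel_measurable borel" for s by (rule D1_measurable[OF D])
  have Km: "(\<lambda>(s, x). K s x) \<in> borel_measurable (borel \<Otimes>\<^sub>M borel)"
    unfolding K_def split_beta'
    by (rule measurable_compose[OF borel_measurable_compose2[OF mild_solutionD(1)[OF f]] \<Psi>_measurable]) measurable
  have K01: "0 \<le> K s z" "K s z \<le> 1" for s z unfolding K_def by (rule \<Psi>_D1[OF D])+
  have u: "(\<lambda>z. f t (exp t * z)) \<in> borel_measurable borel" by measurable
  have "exp t * (wtail (f t) (exp t * a) - wtail (f t) (exp t * b))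
      = wtail (\<lambda>z. f t (exp t * z)) a - wtail (\<lambda>z. f t (exp t * z)) b"
    by (simp add: wtail_scale right_diff_distrib)
  also have "\<dots> = (LINT w:{a..b}|lborel. f t (exp t * w) / w\<^sup>2)"
    by (rule wtail_Icc(2)[symmetric, OF u fb ab])
  also have "\<dots> = (LINT w:{a..b}|lborel. f 0 w / w\<^sup>2 + (LINT s:{0..t}|lborel. exp s * flux (K s) w) / w\<^sup>2)"
  proof (rule set_lebesgue_integral_cong)
    have "f t (exp t * w) = f 0 w + (LINT s:{0..t}|lborel. exp s * flux (K s) w)" if "w \<in> {a..b}" for w
      using mild_solutionD(3)[OF f t, of w] that ab by (simp add: flux_scale K_def[abs_def])
    then show "\<forall>w. w \<in> {a..b} \<longrightarrow> f t (exp t * w) / w\<^sup>2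
        = f 0 w / w\<^sup>2 + (LINT s:{0..t}|lborel. exp s * flux (K s) w) / w\<^sup>2"
      by (simp add: add_divide_distrib)
  qed simp
  also have "\<dots> = wtail (f 0) a - wtail (f 0) b
      + (LINT s:{0..t}|lborel. exp s * (b * wtail (K s) b - a * wtail (K s) a))"
    using integral_flux_evolution[OF Km K01 ab, of t] wtail_Icc[OF fm fb ab, of 0] by (simp add: set_integral_add)
  also have "(\<lambda>s. exp s * (b * wtail (K s) b - a * wtail (K s) a))
     = (\<lambda>s. exp s * (exp s * b * wtail (\<lambda>z. \<Psi> (f s z)) (exp s * b) - exp s * a * wtail (\<lambda>z. \<Psi> (f s z)) (exp s * a)))"
    by (simp add: wtail_scale K_def[abs_def])
  finally show ?thesis .
qed

text \<open>The average of \<open>\<Psi> \<circ> L\<close> over \<open>(y, \<infinity>)\<close> with respect to the probability density \<open>y / z\<^sup>2\<close>.\<close>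

definition tail_average :: "(real \<Rightarrow> real) \<Rightarrow> real \<Rightarrow> real" where
  "tail_average L y = y * wtail (\<lambda>z. \<Psi> (L z)) y"

lemma tail_average_bounds:
  assumes "L \<in> \<D>\<^sub>1" "0 < y"
  shows "\<Psi> (L y) \<le> tail_average L y" "tail_average L y \<le> 1" "0 \<le> tail_average L y" "\<bar>tail_average L y\<bar> \<le> 1"
proof -
  note P = \<Psi>_D1[OF assms(1)]
  have "wtail (\<lambda>_. \<Psi> (L y)) y \<le> wtail (\<lambda>z. \<Psi> (L z)) y"
    by (rule wtail_mono[where C=1 and C'=1]) (use P assms in auto)
  then show "\<Psi> (L y) \<le> tail_average L y" using assms(2) by (simp add: wtail_const tail_average_def field_simps)
  then show *: "0 \<le> tail_average L y" using P(2)[of y] by linarith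
  show **: "tail_average L y \<le> 1" unfolding tail_average_def by (rule wtail_bounds) (use P assms in auto)
  show "\<bar>tail_average L y\<bar> \<le> 1" using * ** by simp
qed

lemma tail_average_measurable:
  assumes "L \<in> \<D>\<^sub>1" shows "tail_average L \<in> borel_measurable borel"
  unfolding tail_average_def[abs_def]
  by (intro borel_measurable_times borel_measurable_wtail_fixed \<Psi>_D1(1)[OF assms]) auto

lemma tail_average_at_top:
  assumes "L \<in> \<D>\<^sub>1" "(L \<longlongrightarrow> 1) at_top"
  shows "(tail_average L \<longlongrightarrow> 1) at_top"
proof (rule tendsto_sandwich[of "\<lambda>y. \<Psi> (L y)" _ _ "\<lambda>_. 1"])
  show "((\<lambda>y. \<Psi> (L y)) \<longlongrightarrow> 1) at_top"
    using isCont_tendsto_compose[OF \<Psi>_isCont assms(2)] \<Psi>_1 by simp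
  show "\<forall>\<^sub>F y in at_top. \<Psi> (L y) \<le> tail_average L y" "\<forall>\<^sub>F y in at_top. tail_average L y \<le> 1"
    by (rule eventually_mono[OF eventually_gt_at_top[of 0]], rule tail_average_bounds[OF assms(1)], assumption)+
qed simp

text \<open>Pass to the limit \<open>n \<rightarrow> \<infinity>\<close> in \<open>mild_integrated\<close> for the time shifts by \<open>n\<close>; all tail integrals converge by
  dominated convergence.\<close>

lemma limit_equation_interval:
  assumes f: "mild_solution f" and L: "is_limit f L" and ab: "0 < a" "a \<le> b" and t: "0 \<le> t"
  shows "exp t * (wtail L (exp t * a) - wtail L (exp t * b)) = wtail L a - wtail L b
     + (LINT s:{0..t}|lborel. exp s * (tail_average L (exp s * b) - tail_average L (exp s * a)))"
proof -
  have D: "f s \<in> \<D>\<^sub>1" and LD: "L \<in> \<D>\<^sub>1" for s using mild_solutionD(2)[OF f] L by (auto simp: is_limit_def)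
  have fb: "\<bar>f s x\<bar> \<le> 1" for s x using D1_range[OF D, of s x] by simp
  have lim: "(\<lambda>n. wtail (f (real n + s)) y) \<longlonglongrightarrow> wtail L y" if "0 \<le> s" "0 < y" for s y
    by (rule wtail_tendsto[where C=1])
      (use is_limit_AE[OF f L that(1)] fb that D1_measurable[OF D] D1_measurable[OF LD] in \<open>auto elim!: eventually_mono\<close>)
  have limJ: "(\<lambda>n. tail_average (f (real n + s)) y) \<longlonglongrightarrow> tail_average L y" if "0 \<le> s" "0 < y" for s y
    unfolding tail_average_def
  proof (intro tendsto_intros wtail_tendsto[where C=1])
    show "AE z in lborel. y < z \<longrightarrow> (\<lambda>n. \<Psi> (f (real n + s) z)) \<longlonglongrightarrow> \<Psi> (L z)"
      using is_limit_AE[OF f L that(1)]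
      by eventually_elim (use that isCont_tendsto_compose[OF \<Psi>_isCont] in auto)
  qed (use \<Psi>_D1[OF D] \<Psi>_D1[OF LD] that in auto)
  have eq: "exp t * (wtail (f (real n + t)) (exp t * a) - wtail (f (real n + t)) (exp t * b))
      = wtail (f (real n + 0)) a - wtail (f (real n + 0)) b
     + (LINT s:{0..t}|lborel. exp s * (tail_average (f (real n + s)) (exp s * b) - tail_average (f (real n + s)) (exp s * a)))" for n :: nat
    using mild_integrated[OF mild_solution_shift[OF f, of "real n"] ab t] by (simp add: tail_average_def)
  have Jm: "(\<lambda>s. tail_average (f (real n + s)) (exp s * c)) \<in> borel_measurable borel" for n c
    unfolding tail_average_def
  proof (intro borel_measurable_times borel_measurable_wtail)
    show "(\<lambda>(s, x). \<Psi> (f (real n + s) x)) \<in> borel_measurable (borel \<Otimes>\<^sub>M borel)"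
      unfolding split_beta'
      by (rule measurable_compose[OF borel_measurable_compose2[OF mild_solutionD(1)[OF f]] \<Psi>_measurable]) measurable
  qed auto
  have "(\<lambda>n. LINT s:{0..t}|lborel. exp s * (tail_average (f (real n + s)) (exp s * b) - tail_average (f (real n + s)) (exp s * a)))
     \<longlonglongrightarrow> (LINT s:{0..t}|lborel. exp s * (tail_average L (exp s * b) - tail_average L (exp s * a)))"
  proof (rule set_integral_Icc_bounded_convergence[where K="exp t * 2"])
    show "(\<lambda>s. exp s * (tail_average (f (real n + s)) (exp s * b) - tail_average (f (real n + s)) (exp s * a))) \<in> borel_measurable borel" for n
      by (intro borel_measurable_times borel_measurable_diff Jm) auto
    show "(\<lambda>s. exp s * (tail_average L (exp s * b) - tail_average L (exp s * a))) \<in> borel_measurable borel"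
      by (intro borel_measurable_times borel_measurable_diff measurable_compose[OF _ tail_average_measurable[OF LD]]) auto
    fix s assume s: "0 \<le> s" "s \<le> t"
    show "\<bar>exp s * (tail_average (f (real n + s)) (exp s * b) - tail_average (f (real n + s)) (exp s * a))\<bar> \<le> exp t * 2" for n
      unfolding abs_mult
      using tail_average_bounds(4)[OF D, of "exp s * b" "real n + s"] tail_average_bounds(4)[OF D, of "exp s * a" "real n + s"] s ab
      by (intro mult_mono) auto
    show "(\<lambda>n. exp s * (tail_average (f (real n + s)) (exp s * b) - tail_average (f (real n + s)) (exp s * a)))
        \<longlonglongrightarrow> exp s * (tail_average L (exp s * b) - tail_average L (exp s * a))"
      using s ab by (intro tendsto_intros limJ) auto
  qed
  then have r: "(\<lambda>n. wtail (f (real n + 0)) a - wtail (f (real n + 0)) b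
     + (LINT s:{0..t}|lborel. exp s * (tail_average (f (real n + s)) (exp s * b) - tail_average (f (real n + s)) (exp s * a))))
     \<longlonglongrightarrow> wtail L a - wtail L b + (LINT s:{0..t}|lborel. exp s * (tail_average L (exp s * b) - tail_average L (exp s * a)))"
    using ab by (intro tendsto_add tendsto_diff lim) auto
  have l: "(\<lambda>n. exp t * (wtail (f (real n + t)) (exp t * a) - wtail (f (real n + t)) (exp t * b)))
     \<longlonglongrightarrow> exp t * (wtail L (exp t * a) - wtail L (exp t * b))"
    using ab t by (intro tendsto_intros lim) auto
  show ?thesis using LIMSEQ_unique[OF l r[folded eq]] .
qed

text \<open>Let \<open>b \<rightarrow> \<infinity>\<close>: the tail integral of \<open>L\<close> at \<open>b\<close> vanishes in the limit, and the tail average tends to \<open>1\<close>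
  because \<open>L\<close> does.\<close>

lemma limit_equation:
  assumes f: "mild_solution f" and L: "is_limit f L" and a: "0 < a" and t: "0 \<le> t"
  shows "exp t * wtail L (exp t * a) = wtail L a + (LINT s:{0..t}|lborel. exp s * (1 - tail_average L (exp s * a)))"
proof -
  have LD: "L \<in> \<D>\<^sub>1" and Ltop: "(L \<longlongrightarrow> 1) at_top" using L by (auto simp: is_limit_def)
  let ?b = "\<lambda>n::nat. a + real n"
  have btop: "filterlim (\<lambda>n. c * ?b n) at_top sequentially" if "0 < c" for c
    using that by (intro filterlim_tendsto_pos_mult_at_top[OF tendsto_const] 
        filterlim_tendsto_add_at_top[OF tendsto_const] filterlim_real_sequentially)
  have "((\<lambda>y. wtail L y) \<longlongrightarrow> 0) at_top"
  proof (rule tendsto_sandwich[of "\<lambda>_. 0" _ _ "\<lambda>y. 1 / y"])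
    have "0 \<le> wtail L y \<and> wtail L y \<le> 1 / y" if "0 < y" for y
      using wtail_bounds[OF D1_measurable[OF LD] D1_range[OF LD] that] that by (simp add: field_simps)
    then show "\<forall>\<^sub>F y in at_top. 0 \<le> wtail L y" "\<forall>\<^sub>F y in at_top. wtail L y \<le> 1 / y"
      by (intro eventually_mono[OF eventually_gt_at_top[of 0]], blast)+
    show "((\<lambda>y::real. 1 / y) \<longlongrightarrow> 0) at_top" by real_asymp
  qed simp
  note W = filterlim_compose[OF this btop] and JJ = filterlim_compose[OF tail_average_at_top[OF LD Ltop] btop]
  have "(\<lambda>n. LINT s:{0..t}|lborel. exp s * (tail_average L (exp s * ?b n) - tail_average L (exp s * a)))
     \<longlonglongrightarrow> (LINT s:{0..t}|lborel. exp s * (1 - tail_average L (exp s * a)))"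
  proof (rule set_integral_Icc_bounded_convergence[where K="exp t * 2"])
    show "(\<lambda>s. exp s * (tail_average L (exp s * ?b n) - tail_average L (exp s * a))) \<in> borel_measurable borel" for n
      by (intro borel_measurable_times borel_measurable_diff measurable_compose[OF _ tail_average_measurable[OF LD]]) auto
    show "(\<lambda>s. exp s * (1 - tail_average L (exp s * a))) \<in> borel_measurable borel"
      by (intro borel_measurable_times borel_measurable_diff measurable_compose[OF _ tail_average_measurable[OF LD]]) auto
    fix s assume s: "0 \<le> s" "s \<le> t"
    show "\<bar>exp s * (tail_average L (exp s * ?b n) - tail_average L (exp s * a))\<bar> \<le> exp t * 2" for n
      unfolding abs_mult
      using tail_average_bounds(4)[OF LD, of "exp s * ?b n"] tail_average_bounds(4)[OF LD, of "exp s * a"] s a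
      by (intro mult_mono) (auto simp: add_pos_nonneg)
    show "(\<lambda>n. exp s * (tail_average L (exp s * ?b n) - tail_average L (exp s * a))) \<longlonglongrightarrow> exp s * (1 - tail_average L (exp s * a))"
      by (intro tendsto_intros JJ) auto
  qed
  then have r: "(\<lambda>n. wtail L a - wtail L (1 * ?b n) + (LINT s:{0..t}|lborel. exp s * (tail_average L (exp s * ?b n) - tail_average L (exp s * a))))
     \<longlonglongrightarrow> wtail L a - 0 + (LINT s:{0..t}|lborel. exp s * (1 - tail_average L (exp s * a)))"
    by (intro tendsto_add tendsto_diff tendsto_const W) auto
  have l: "(\<lambda>n. exp t * (wtail L (exp t * a) - wtail L (exp t * ?b n))) \<longlonglongrightarrow> exp t * (wtail L (exp t * a) - 0)"
    by (intro tendsto_intros W) auto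
  have eq: "wtail L a - wtail L (1 * ?b n) + (LINT s:{0..t}|lborel. exp s * (tail_average L (exp s * ?b n) - tail_average L (exp s * a)))
    = exp t * (wtail L (exp t * a) - wtail L (exp t * ?b n))" for n
    using limit_equation_interval[OF f L a _ t, of "?b n"] by simp
  show ?thesis using LIMSEQ_unique[OF l r[unfolded eq]] by simp
qed

section \<open>Regularity of the limit profile\<close>

context
  fixes f L
  assumes f: "mild_solution f" and L: "is_limit f L"
begin

lemma limit_D1: "L \<in> \<D>\<^sub>1" and limit_at_top: "(L \<longlongrightarrow> 1) at_top"
  using is_limitD[OF L] by auto

lemma limit_abs_le: "\<bar>L z\<bar> \<le> 1" using D1_range[OF limit_D1, of z] by simp

lemma \<Psi>_limit_abs_le: "\<bar>\<Psi> (L z)\<bar> \<le> 1" using \<Psi>_D1(2,3)[OF limit_D1, of z] by simp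

lemma tail_average_isCont: "0 < y \<Longrightarrow> isCont (tail_average L) y"
  unfolding tail_average_def[abs_def]
  by (intro continuous_intros wtail_isCont[OF \<Psi>_D1(1)[OF limit_D1] \<Psi>_limit_abs_le])

text \<open>Differentiate \<open>limit_equation\<close> in \<open>t\<close>, at the time when the characteristic from \<open>a\<close> passes through \<open>y\<close>.\<close>

lemma wtail_limit_derivative:
  assumes y: "0 < y"
  shows "(wtail L has_real_derivative (1 - tail_average L y - wtail L y) / y) (at y)"
proof -
  \<comment> \<open>Any starting point below \<open>y\<close> would do: the passage time \<open>ln (y / a)\<close> is then an interior point of the time
    axis, so that a two-sided derivative exists.\<close>
  define a where "a = y / 2"
  have a: "0 < a" "a < y" using y by (simp_all add: a_def)
  define g where "g s = exp s * (1 - tail_average L (exp s * a))" for s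
  define E where "E \<tau> = wtail L a + (LINT s:{0..\<tau>}|lborel. g s)" for \<tau>
  have g: "continuous_on {0..T} g" for T
  proof (intro continuous_at_imp_continuous_on ballI)
    fix s
    have "isCont (\<lambda>s. tail_average L (exp s * a)) s"
      by (rule isCont_o2[OF _ tail_average_isCont]) (use a in \<open>auto intro!: continuous_intros\<close>)
    then show "isCont g s" unfolding g_def by (intro continuous_intros)
  qed
  have t: "0 < ln (y / a)" using a by simp
  have "(E has_real_derivative g (ln (y / a))) (at (ln (y / a)))"
    unfolding E_def[abs_def] using has_derivative_set_integral[OF g t, of "ln (y / a) + 1"]
    by (auto intro!: derivative_eq_intros)
  moreover have "((\<lambda>x. ln (x / a)) has_real_derivative 1 / y) (at y)"
    using a y by (auto intro!: derivative_eq_intros)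
  ultimately have 1: "((\<lambda>x. E (ln (x / a))) has_real_derivative g (ln (y / a)) * (1 / y)) (at y)"
    by (rule DERIV_chain2)
  have gy: "g (ln (y / a)) = y / a * (1 - tail_average L y)" using a y by (simp add: g_def)
  have Ex: "a / x * E (ln (x / a)) = wtail L x" if "a < x" for x
  proof -
    have "x / a * wtail L x = E (ln (x / a))"
      using limit_equation[OF f L a(1), of "ln (x / a)"] that a by (simp add: E_def g_def)
    then show ?thesis using that a by (simp add: field_simps)
  qed
  have "((\<lambda>x. a / x * E (ln (x / a))) has_real_derivative
      - a / y\<^sup>2 * E (ln (y / a)) + g (ln (y / a)) * (1 / y) * (a / y)) (at y)"
    by (rule DERIV_mult[OF _ 1]) (use y in \<open>auto intro!: derivative_eq_intros simp: power2_eq_square\<close>)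
  also have "- a / y\<^sup>2 * E (ln (y / a)) = - (a / y * E (ln (y / a))) / y" by (simp add: power2_eq_square)
  also have "\<dots> + g (ln (y / a)) * (1 / y) * (a / y) = (1 - tail_average L y - wtail L y) / y"
    unfolding Ex[OF a(2)] gy using a y by (simp add: field_simps)
  finally show ?thesis
    by (rule has_field_derivative_transform_within_open[of _ _ _ "{a<..}"]) (use a Ex in auto)
qed

lemma limit_formula:
  assumes "0 < y" shows "L y = y * (tail_average L y + wtail L y - 1)"
proof -
  have "L y = - (y\<^sup>2 * ((1 - tail_average L y - wtail L y) / y))"
    by (rule mono_eq_wtail_derivative[OF D1_mono[OF limit_D1] limit_abs_le assms wtail_limit_derivative[OF assms]])
  also have "\<dots> = - (y * (1 - tail_average L y - wtail L y))" using assms by (simp add: power2_eq_square)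
  also have "\<dots> = y * (tail_average L y + wtail L y - 1)" by (simp add: algebra_simps)
  finally show ?thesis .
qed

lemma limit_isCont:
  assumes "0 < y" shows "isCont L y"
proof -
  have "isCont (\<lambda>y. y * (tail_average L y + wtail L y - 1)) y"
    by (intro continuous_intros tail_average_isCont wtail_isCont[OF D1_measurable[OF limit_D1] limit_abs_le] assms)
  moreover have "\<forall>\<^sub>F x in nhds y. L x = x * (tail_average L x + wtail L x - 1)"
    by (rule eventually_mono[OF eventually_nhds_in_open[of "{0<..}" y]]) (use assms limit_formula in auto)
  ultimately show ?thesis by (simp only: isCont_cong[of L "\<lambda>x. x * (tail_average L x + wtail L x - 1)"])
qed

text \<open>Differentiating \<open>limit_formula\<close>, which is legitimate now that \<open>L\<close> is known to be continuous, gives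
  \<open>L' = L / y + (A - \<Psi> \<circ> L) - L / y\<close> with the tail average \<open>A\<close>.\<close>

lemma limit_derivative:
  assumes y: "0 < y"
  shows "(L has_real_derivative tail_average L y - \<Psi> (L y)) (at y)"
proof -
  have W: "(wtail (\<lambda>z. \<Psi> (L z)) has_real_derivative - \<Psi> (L y) / y\<^sup>2) (at y)"
    by (rule wtail_has_derivative[OF \<Psi>_D1(1)[OF limit_D1] \<Psi>_limit_abs_le y isCont_o2[OF limit_isCont[OF y] \<Psi>_isCont]])
  have V: "(wtail L has_real_derivative - L y / y\<^sup>2) (at y)"
    by (rule wtail_has_derivative[OF D1_measurable[OF limit_D1] limit_abs_le y limit_isCont[OF y]])
  have "((\<lambda>y. y * (tail_average L y + wtail L y - 1)) has_real_derivative
      1 * (tail_average L y + wtail L y - 1) + (1 * wtail (\<lambda>z. \<Psi> (L z)) y + (- \<Psi> (L y) / y\<^sup>2) * y + - L y / y\<^sup>2 - 0) * y) (at y)"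
    unfolding tail_average_def by (rule DERIV_mult DERIV_ident DERIV_add DERIV_diff DERIV_const W V)+
  also have "1 * (tail_average L y + wtail L y - 1) + (1 * wtail (\<lambda>z. \<Psi> (L z)) y + (- \<Psi> (L y) / y\<^sup>2) * y + - L y / y\<^sup>2 - 0) * y
     = (tail_average L y + wtail L y - 1) - L y / y + tail_average L y - \<Psi> (L y)"
    using y by (simp add: tail_average_def power2_eq_square field_simps)
  also have "\<dots> = tail_average L y - \<Psi> (L y)" using y by (simp add: limit_formula[OF y])
  finally show ?thesis
    by (rule has_field_derivative_transform_within_open[of _ _ _ "{0<..}"]) (use y limit_formula in auto)
qed

lemma limit_at_0: "(L \<longlongrightarrow> 0) (at_right 0)"
  using D1_right_continuous[OF limit_D1, of 0] D1_nonpos[OF limit_D1, of 0] by (simp add: continuous_within)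

lemma \<Psi>_limit_at_0: "((\<lambda>y. \<Psi> (L y)) \<longlongrightarrow> 0) (at_right 0)"
  using isCont_tendsto_compose[OF \<Psi>_isCont limit_at_0] \<Psi>_0 by simp

text \<open>Split at a point \<open>d\<close> up to which \<open>\<Psi> \<circ> L \<le> e / 2\<close>: the part below \<open>d\<close> contributes at most \<open>e / 2\<close> to the
  average, the part above \<open>d\<close> at most \<open>y / d\<close>.\<close>

lemma tail_average_at_0: "(tail_average L \<longlongrightarrow> 0) (at_right 0)"
proof (rule tendstoI)
  fix e :: real assume e: "0 < e"
  have "\<forall>\<^sub>F y in at_right 0. \<Psi> (L y) < e / 2"
    using order_tendstoD(2)[OF \<Psi>_limit_at_0, of "e / 2"] e by simp
  then have "\<forall>\<^sub>F y in at_right 0. 0 < y \<and> \<Psi> (L y) < e / 2"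
    using eventually_at_right_less[of 0] by (rule eventually_elim2) simp
  then obtain d where d: "0 < d" "\<Psi> (L d) < e / 2"
    using eventually_happens[of _ "at_right (0::real)"] trivial_limit_at_right_real by blast
  \<comment> \<open>The bound \<open>d * e / 2\<close> makes \<open>y / d < e / 2\<close>.\<close>
  have "\<forall>\<^sub>F y in at_right 0. y \<in> {0<..<min d (d * e / 2)}"
    using d e by (intro eventually_at_right_real) auto
  then show "\<forall>\<^sub>F y in at_right 0. dist (tail_average L y) 0 < e"
  proof eventually_elim
    case (elim y)
    then have y: "0 < y" "y < d" "y < d * e / 2" by auto
    have "wtail (\<lambda>z. \<Psi> (L z)) y - wtail (\<lambda>z. \<Psi> (L z)) d \<le> e / 2 * (1 / y - 1 / d)"
      by (rule wtail_increment_bounds(2)[OF \<Psi>_D1(1)[OF limit_D1] \<Psi>_limit_abs_le, where lo = 0])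
        (use y d(2) \<Psi>_D1(2)[OF limit_D1] order_trans[OF \<Psi>_D1(4)[OF limit_D1], of _ d "e / 2"] in auto)
    also have "\<dots> \<le> e / 2 * (1 / y)" using d e by (intro mult_left_mono) auto
    finally have "y * wtail (\<lambda>z. \<Psi> (L z)) y \<le> y * (e / 2 * (1 / y) + wtail (\<lambda>z. \<Psi> (L z)) d)"
      using y by (intro mult_left_mono) auto
    also have "\<dots> = e / 2 + y * wtail (\<lambda>z. \<Psi> (L z)) d" using y by (simp add: distrib_left)
    also have "y * wtail (\<lambda>z. \<Psi> (L z)) d \<le> y * (1 / d)"
      using tail_average_bounds(2)[OF limit_D1 d(1)] y d by (intro mult_left_mono) (auto simp: tail_average_def field_simps)
    also have "\<dots> < e / 2" using y d by (simp add: divide_less_eq mult.commute)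
    finally show ?case using tail_average_bounds(3)[OF limit_D1 y(1)] by (simp add: tail_average_def)
  qed
qed

text \<open>The right derivative at \<open>0\<close>, from the mean value theorem and \<open>L' \<rightarrow> 0\<close>.\<close>

lemma limit_derivative_at_0: "((\<lambda>y. L y / y) \<longlongrightarrow> 0) (at_right 0)"
proof (rule tendstoI)
  fix e :: real assume e: "0 < e"
  have "((\<lambda>y. tail_average L y - \<Psi> (L y)) \<longlongrightarrow> 0 - 0) (at_right 0)" by (intro tendsto_intros tail_average_at_0 \<Psi>_limit_at_0)
  then have "\<forall>\<^sub>F y in at_right 0. dist (tail_average L y - \<Psi> (L y)) (0 - 0) < e" using e by (rule tendstoD)
  then obtain d where d: "0 < d" "\<And>y. 0 < y \<Longrightarrow> y < d \<Longrightarrow> \<bar>tail_average L y - \<Psi> (L y)\<bar> < e"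
    by (auto simp: eventually_at_right_field)
  have "\<forall>\<^sub>F y in at_right 0. y \<in> {0<..<d}" by (rule eventually_at_right_real[OF d(1)])
  then show "\<forall>\<^sub>F y in at_right 0. dist (L y / y) 0 < e"
  proof eventually_elim
    case (elim y)
    have cont: "continuous_on {0..y} L"
      unfolding continuous_on_eq_continuous_within
    proof
      fix x assume "x \<in> {0..y}"
      then consider "x = 0" | "0 < x" by force
      then show "continuous (at x within {0..y}) L"
      proof cases
        case 1
        then show ?thesis using limit_at_0 elim D1_nonpos[OF limit_D1, of 0]
          by (simp add: continuous_within at_within_Icc_at_right)
      next
        case 2
        show ?thesis by (rule continuous_at_imp_continuous_at_within[OF limit_isCont[OF 2]])
      qed
    qed
    have diff: "L differentiable (at x)" if "0 < x" for x
      unfolding real_differentiable_def by (rule exI, rule limit_derivative[OF that])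
    have "0 < y" using elim by simp
    from MVT[OF this cont diff] obtain l z
      where z: "0 < z" "z < y" "(L has_real_derivative l) (at z)" "L y - L 0 = (y - 0) * l" by blast
    have "l = tail_average L z - \<Psi> (L z)" using DERIV_unique[OF z(3) limit_derivative[OF z(1)]] .
    then have "L y / y = tail_average L z - \<Psi> (L z)" using z(4) \<open>0 < y\<close> D1_nonpos[OF limit_D1, of 0] by simp
    then show ?case using z d(2)[of z] elim by simp
  qed
qed

text \<open>By \<open>limit_formula\<close> the tail integral of \<open>L\<close> at \<open>y\<close> is \<open>1 + L y / y - tail_average L y\<close>, which tends to \<open>1\<close> at \<open>0\<close>.\<close>

lemma limit_norm: "norm_x2 L = 1"
proof (rule antisym)
  show "norm_x2 L \<le> 1" using limit_D1 by (simp add: cal_D1_def)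
  have "((\<lambda>y. L y / y - tail_average L y + 1) \<longlongrightarrow> 0 - 0 + 1) (at_right 0)"
    by (intro tendsto_intros limit_derivative_at_0 tail_average_at_0)
  then have "(wtail L \<longlongrightarrow> 0 - 0 + 1) (at_right 0)"
    by (rule Lim_transform_eventually) (use eventually_at_right_less[of 0] in eventually_elim, simp add: limit_formula)
  then have lim: "((\<lambda>y. ennreal (wtail L y)) \<longlongrightarrow> ennreal 1) (at_right 0)" by (intro tendsto_intros) simp
  have "ennreal (wtail L y) \<le> norm_x2 L" if "0 < y" for y
  proof -
    have "ennreal (wtail L y) = (\<integral>\<^sup>+z. ennreal (indicator {y<..} z *\<^sub>R (L z / z\<^sup>2)) \<partial>lborel)"
      unfolding wtail_def set_lebesgue_integral_def
      by (rule nn_integral_eq_integral[symmetric])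
        (use wtail_integrable[OF D1_measurable[OF limit_D1] limit_abs_le that] D1_range[OF limit_D1] in \<open>auto simp: set_integrable_def\<close>)
    also have "\<dots> \<le> norm_x2 L"
      unfolding norm_x2_def using that D1_range[OF limit_D1] by (intro nn_integral_mono) (auto simp: indicator_def)
    finally show ?thesis .
  qed
  then show "1 \<le> norm_x2 L"
    using tendsto_upperbound[OF lim eventually_mono[OF eventually_at_right_less[of 0]]] by simp
qed

lemma limit_stieltjes_derivative:
  "0 < x \<Longrightarrow> x * (LINT z:{x<..}|interval_measure (\<lambda>z. \<Psi> (L z)). 1 / z) = tail_average L x - \<Psi> (L x)"
  using stieltjes_tail_D1(1)[OF limit_D1, of x] by (simp add: stieltjes_tail_def tail_average_def right_diff_distrib)

lemma limit_continuously_differentiable: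
  defines "F' \<equiv> \<lambda>x. x * (LINT z:{x<..}|interval_measure (\<lambda>z. \<Psi> (L z)). 1 / z)"
  shows "continuous_on {0..} F'" "0 \<le> x \<Longrightarrow> (L has_real_derivative F' x) (at x within {0..})"
proof -
  have F'_eq: "F' y = tail_average L y - \<Psi> (L y)" if "0 < y" for y
    using limit_stieltjes_derivative[OF that] by (simp add: F'_def)
  have F'0: "F' 0 = 0" by (simp add: F'_def)
  show "continuous_on {0..} F'"
    unfolding continuous_on_eq_continuous_within
  proof
    fix y :: real assume "y \<in> {0..}"
    then consider "y = 0" | "0 < y" by force
    then show "continuous (at y within {0..}) F'"
    proof cases
      case 1
      have "((\<lambda>y. tail_average L y - \<Psi> (L y)) \<longlongrightarrow> 0 - 0) (at_right 0)" by (intro tendsto_intros tail_average_at_0 \<Psi>_limit_at_0)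
      then have "(F' \<longlongrightarrow> 0 - 0) (at_right 0)"
        by (rule Lim_transform_eventually) (use eventually_at_right_less[of 0] in eventually_elim, simp add: F'_eq)
      then show ?thesis using 1 F'0 by (simp add: continuous_within at_within_Ici_at_right)
    next
      case 2
      have "isCont (\<lambda>y. tail_average L y - \<Psi> (L y)) y"
        by (intro continuous_intros tail_average_isCont isCont_o2[OF limit_isCont \<Psi>_isCont] 2)
      moreover have "\<forall>\<^sub>F x in nhds y. F' x = tail_average L x - \<Psi> (L x)"
        by (rule eventually_mono[OF eventually_nhds_in_open[of "{0<..}" y]]) (use 2 F'_eq in auto)
      ultimately have "isCont F' y" by (simp only: isCont_cong[of F' "\<lambda>y. tail_average L y - \<Psi> (L y)"])
      then show ?thesis by (rule continuous_at_imp_continuous_at_within)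
    qed
  qed
  assume "0 \<le> x"
  then consider "x = 0" | "0 < x" by force
  then show "(L has_real_derivative F' x) (at x within {0..})"
  proof cases
    case 1
    show ?thesis
      using limit_derivative_at_0 D1_nonpos[OF limit_D1, of 0] F'0
      by (simp add: 1 has_field_derivative_iff at_within_Ici_at_right)
  next
    case 2
    then show ?thesis using has_field_derivative_at_within[OF limit_derivative[OF 2]] by (simp add: F'_eq)
  qed
qed

section \<open>Stationarity and size biasing of the limit profile\<close>

text \<open>By \<open>limit_derivative\<close> the integrand in the fixed-point equation is the derivative of \<open>s \<mapsto> L (e\<^bsup>s-t\<^esup> x)\<close>.\<close>

lemma limit_stationary: "(\<lambda>t. L) \<in> frak_F \<Psi>"
  unfolding frak_F_def
proof (intro CollectI conjI allI impI)
  show "(\<lambda>t. L) \<in> \<X>\<^sub>1"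
    unfolding measurable_evolutions_def
    by (rule measurable_const)
      (use limit_D1 D1_subset_L1_loc in \<open>auto simp: borel_of_def space_measure_of_conv topspace_L1_loc_topology\<close>)
  show "(L \<longlongrightarrow> 1) at_top" by (rule limit_at_top)
  show "tight_family {0..} (\<lambda>t. L)"
    unfolding tight_family_def
  proof (intro allI impI)
    fix e :: real assume "0 < e"
    then have "\<forall>\<^sub>F x in at_top. 1 - e < L x" using order_tendstoD(1)[OF limit_at_top, of "1 - e"] by simp
    then have "\<forall>\<^sub>F x in at_top. 0 \<le> x \<and> 1 - e < L x"
      using eventually_ge_at_top[of 0] by (rule eventually_elim2) simp
    then obtain N where "0 \<le> N" "1 - e < L N" by (auto simp: eventually_at_top_linorder)
    then show "\<exists>N\<ge>0. \<forall>i\<in>{0..}. 1 - e < L N" by auto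
  qed
  fix t x :: real assume t: "0 \<le> t" and x: "0 \<le> x"
  show "L x = S_op \<Psi> (\<lambda>t. L) t x"
  proof (cases "x = 0")
    case False
    define q where "q y = y * (tail_average L y - \<Psi> (L y))" for y
    have pos: "0 < exp (s - t) * x" for s using False x by simp
    have qc: "isCont (\<lambda>s. q (exp (s - t) * x)) s" for s
    proof -
      have "isCont q (exp (s - t) * x)"
        unfolding q_def by (intro continuous_intros tail_average_isCont isCont_o2[OF limit_isCont \<Psi>_isCont] pos)
      moreover have "isCont (\<lambda>s. exp (s - t) * x) s" by (intro continuous_intros)
      ultimately show ?thesis by (rule isCont_o2[rotated])
    qed
    have "(LINT s:{0..t}|lborel. (exp (s - t) * x)\<^sup>2 * stieltjes_tail \<Psi> L (exp (s - t) * x))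
      = (LINT s:{0..t}|lborel. q (exp (s - t) * x))"
    proof (rule set_lebesgue_integral_cong)
      have "y\<^sup>2 * stieltjes_tail \<Psi> L y = q y" if "0 < y" for y
        using limit_stieltjes_derivative[OF that] by (simp add: q_def stieltjes_tail_def power2_eq_square mult.assoc)
      then show "\<forall>s. s \<in> {0..t} \<longrightarrow> (exp (s - t) * x)\<^sup>2 * stieltjes_tail \<Psi> L (exp (s - t) * x) = q (exp (s - t) * x)"
        using pos by blast
    qed simp
    also have "\<dots> = L (exp (t - t) * x) - L (exp (0 - t) * x)"
      unfolding set_lebesgue_integral_def
    proof (rule integral_FTC_Icc[OF t])
      show "continuous_on {0..t} (\<lambda>s. q (exp (s - t) * x))"
        using qc by (intro continuous_at_imp_continuous_on) auto
      fix s
      have "((\<lambda>s. L (exp (s - t) * x)) has_real_derivative (tail_average L (exp (s - t) * x) - \<Psi> (L (exp (s - t) * x))) * (exp (s - t) * x)) (at s)"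
        by (rule DERIV_chain2[where f=L and g="\<lambda>s. exp (s - t) * x" and x=s, OF limit_derivative[OF pos]]) (auto intro!: derivative_eq_intros)
      then have "((\<lambda>s. L (exp (s - t) * x)) has_real_derivative q (exp (s - t) * x)) (at s)"
        by (simp add: q_def mult.commute)
      then show "((\<lambda>s. L (exp (s - t) * x)) has_vector_derivative q (exp (s - t) * x)) (at s within {0..t})"
        by (simp add: has_real_derivative_iff_has_vector_derivative has_vector_derivative_at_within)
    qed
    finally show ?thesis by (simp add: S_op_def)
  qed (simp add: S_op_def set_lebesgue_integral_def)
qed

lemma limit_size_biased:
  shows "prob_space (density (interval_measure L) (\<lambda>x. ennreal (1 / x)))"
    and "has_bochner_integral (density (interval_measure L) (\<lambda>x. ennreal (1 / x))) (\<lambda>x. x) 1"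
proof -
  interpret real_distribution "interval_measure L" by (rule stieltjes_measure_D1(1)[OF limit_D1 limit_at_top])
  note pos = stieltjes_measure_D1(3)[OF limit_D1 limit_at_top]
  show "prob_space (density (interval_measure L) (\<lambda>x. ennreal (1 / x)))"
  proof (rule prob_spaceI)
    have "emeasure (density (interval_measure L) (\<lambda>x. ennreal (1 / x))) UNIV
        = (\<integral>\<^sup>+x. ennreal (1 / x) \<partial>interval_measure L)"
      by (simp add: emeasure_density)
    also have "\<dots> = (\<integral>\<^sup>+x\<in>{0<..}. ennreal (1 / x) \<partial>interval_measure L)"
      by (rule nn_integral_cong_AE) (use pos in eventually_elim, simp)
    also have "\<dots> = (\<integral>\<^sup>+w\<in>{0<..}. ennreal ((L w - L 0) / w\<^sup>2) \<partial>lborel)"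
      by (rule nn_integral_stieltjes_tail[OF monoD[OF D1_mono[OF limit_D1]] D1_right_continuous[OF limit_D1]]) auto
    also have "\<dots> = norm_x2 L"
      unfolding norm_x2_def using D1_range[OF limit_D1] D1_nonpos[OF limit_D1, of 0] by simp
    finally show "emeasure (density (interval_measure L) (\<lambda>x. ennreal (1 / x)))
        (space (density (interval_measure L) (\<lambda>x. ennreal (1 / x)))) = 1"
      by (simp add: limit_norm)
  qed
  show "has_bochner_integral (density (interval_measure L) (\<lambda>x. ennreal (1 / x))) (\<lambda>x. x) 1"
  proof (rule has_bochner_integral_density)
    have "has_bochner_integral (interval_measure L) (\<lambda>x. 1 :: real) 1"
      using prob_space by (simp add: has_bochner_integral_iff)
    moreover have "AE x in interval_measure L. 1 = (1 / x) *\<^sub>R x" using pos by eventually_elim simp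
    ultimately show "has_bochner_integral (interval_measure L) (\<lambda>x. (1 / x) *\<^sub>R x) 1"
      by (subst has_bochner_integral_cong_AE[symmetric]) auto
    show "AE x in interval_measure L. 0 \<le> 1 / x" using pos by eventually_elim simp
  qed auto
qed

end

end

section \<open>Convergence and uniqueness\<close>

lemma distribution_function_continuous_choice:
  assumes "distribution_function_on {0<..1} \<Psi>" "continuous_on UNIV \<Psi>"
  shows "continuous_choice \<Psi>"
proof -
  obtain M where M: "real_distribution M" "measure M {0<..1} = 1" "\<Psi> = cdf M"
    using assms(1) by (auto simp: distribution_function_on_def)
  interpret real_distribution M by (rule M(1))
  have "measure M ({..0} \<union> {0<..1}) = measure M {..0} + measure M {0<..1}"
    by (rule finite_measure_Union) auto
  then have "measure M {..0} \<le> 0" using prob_le_1[of "{..0} \<union> {0<..1}"] M(2) by simp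
  then have "\<Psi> 0 = 0" using M(3) by (simp add: cdf_def antisym)
  moreover have "measure M {0<..1} \<le> measure M {..1}" by (rule finite_measure_mono) auto
  then have "\<Psi> 1 = 1" using M prob_le_1[of "{..1}"] by (simp add: cdf_def)
  moreover have "mono \<Psi>" using M(3) cdf_nondecreasing by (auto simp: mono_def)
  ultimately show ?thesis using assms(2) by unfold_locales auto
qed

theorem lemma3p5:
  fixes \<Psi> :: "real \<Rightarrow> real"
  assumes "distribution_function_on {0<..1} \<Psi>"
    and "continuous_on UNIV \<Psi>"
    and "frak_F \<Psi> \<noteq> {}"
  shows "\<exists>F\<Psi>. distribution_function_on {0..} F\<Psi> \<and> F\<Psi> \<in> \<D>\<^sub>1 \<and>
    (\<forall>F\<in>frak_F \<Psi>. \<forall>t\<ge>0. norm_x2 (\<lambda>x. F t x - F\<Psi> x) \<le> ennreal (2 * exp (- t))) \<and>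
    (\<forall>G. distribution_function_on {0..} G \<and> G \<in> \<D>\<^sub>1 \<and>
       (\<forall>F\<in>frak_F \<Psi>. \<forall>t\<ge>0. norm_x2 (\<lambda>x. F t x - G x) \<le> ennreal (2 * exp (- t)))
       \<longrightarrow> G = F\<Psi>) \<and>
    (\<lambda>t. F\<Psi>) \<in> frak_F \<Psi> \<and>
    (\<exists>F'. continuous_on {0..} F' \<and>
       (\<forall>x\<ge>0. (F\<Psi> has_real_derivative F' x) (at x within {0..})) \<and>
       (\<forall>x\<ge>0. F' x = x * (LINT z:{x<..}|interval_measure (\<lambda>z. \<Psi> (F\<Psi> z)). 1 / z))) \<and>
    norm_x2 F\<Psi> = 1 \<and>
    prob_space (density (interval_measure F\<Psi>) (\<lambda>x. ennreal (1 / x))) \<and>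
    has_bochner_integral (density (interval_measure F\<Psi>) (\<lambda>x. ennreal (1 / x))) (\<lambda>x. x) 1"
proof -
  interpret continuous_choice \<Psi> by (rule distribution_function_continuous_choice[OF assms(1,2)])
  obtain F\<^sub>0 where F0: "F\<^sub>0 \<in> frak_F \<Psi>" using assms(3) by blast
  note f = frak_F_mild_solution[OF F0]
  obtain L where L: "is_limit (\<lambda>s. F\<^sub>0 (max 0 s)) L" using mild_limit_exists[OF f] by blast
  note LD = limit_D1[OF f L] and Ltop = limit_at_top[OF f L] and stat = limit_stationary[OF f L]
  have conv: "norm_x2 (\<lambda>x. F t x - L x) \<le> ennreal (2 * exp (- t))" if F: "F \<in> frak_F \<Psi>" and t: "0 \<le> t" for F t
  proof -
    have "F 0 \<in> \<D>\<^sub>1" using F evolution_in_D1[of F 0] by (simp add: frak_F_def)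
    have "norm_x2 (\<lambda>x. F t x - L x) \<le> ennreal (exp (- t)) * norm_x2 (\<lambda>x. F 0 x - L x)"
      using mild_contraction[OF frak_F_mild_solution[OF F] frak_F_mild_solution[OF stat] t] t by simp
    also have "\<dots> \<le> ennreal (exp (- t)) * ennreal 2"
      by (intro mult_left_mono D1_norm_difference \<open>F 0 \<in> \<D>\<^sub>1\<close> LD) simp
    also have "\<dots> = ennreal (2 * exp (- t))" by (subst ennreal_mult[symmetric]) (simp_all add: mult.commute)
    finally show ?thesis .
  qed
  \<comment> \<open>The stationary evolution itself belongs to the class, so the bound for \<open>G\<close> applied to it compares \<open>L\<close> with \<open>G\<close>
    at all times.\<close>
  have unique: "G = L" if GD: "G \<in> \<D>\<^sub>1"
    and G: "\<forall>F\<in>frak_F \<Psi>. \<forall>t\<ge>0. norm_x2 (\<lambda>x. F t x - G x) \<le> ennreal (2 * exp (- t))" for G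
  proof -
    have "((\<lambda>t::real. ennreal (2 * exp (- t))) \<longlongrightarrow> ennreal 0) at_top"
      by (intro tendsto_ennrealI) real_asymp
    moreover have "\<forall>\<^sub>F t in at_top. norm_x2 (\<lambda>x. L x - G x) \<le> ennreal (2 * exp (- t))"
      by (rule eventually_mono[OF eventually_ge_at_top[of 0]]) (use bspec[OF G stat] in simp)
    ultimately have "norm_x2 (\<lambda>x. L x - G x) \<le> ennreal 0" by (intro tendsto_lowerbound) auto
    then show "G = L" using D1_eqI[OF LD GD] by simp
  qed
  have dist: "distribution_function_on {0..} L"
    unfolding distribution_function_on_def
    using stieltjes_measure_D1(1,2,4)[OF LD Ltop] by (intro exI[of _ "interval_measure L"]) simp
  have convs: "\<forall>F\<in>frak_F \<Psi>. \<forall>t\<ge>0. norm_x2 (\<lambda>x. F t x - L x) \<le> ennreal (2 * exp (- t))"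
    using conv by simp
  have uniq: "\<forall>G. distribution_function_on {0..} G \<and> G \<in> \<D>\<^sub>1 \<and>
       (\<forall>F\<in>frak_F \<Psi>. \<forall>t\<ge>0. norm_x2 (\<lambda>x. F t x - G x) \<le> ennreal (2 * exp (- t))) \<longrightarrow> G = L"
    by (intro allI impI, elim conjE, rule unique)
  have diff: "\<exists>F'. continuous_on {0..} F' \<and>
       (\<forall>x\<ge>0. (L has_real_derivative F' x) (at x within {0..})) \<and>
       (\<forall>x\<ge>0. F' x = x * (LINT z:{x<..}|interval_measure (\<lambda>z. \<Psi> (L z)). 1 / z))"
    by (rule exI[of _ "\<lambda>x. x * (LINT z:{x<..}|interval_measure (\<lambda>z. \<Psi> (L z)). 1 / z)"])
      (simp add: limit_continuously_differentiable[OF f L])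
  show ?thesis
    by (rule exI[of _ L])
      (intro conjI dist LD convs uniq stat diff limit_norm[OF f L] limit_size_biased[OF f L])
qed

end
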